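(* Let $G$ be one of the following wallpaper groups: (1) the fundamental group of the Klein bottle $\mathbb{Z}\rtimes_{-1}\mathbb{Z}$, where a generator of the second factor acts on the first by $-1$; (2) $\mathbb{Z}^2\rtimes_{A_n}\mathbb{Z}/n$ with $n\in\{2,3,4,6\}$, where a generator of $\mathbb{Z}/n$ acts on $\mathbb{Z}^2$ by the matrix $A_n$ of order $n$ given by $$A_2=\begin{pmatrix}-1&0\\0&-1\end{pmatrix},\quad A_3=\begin{pmatrix}0&-1\\1&-1\end{pmatrix},\quad A_4=\begin{pmatrix}0&-1\\1&0\end{pmatrix},\quad A_6=\begin{pmatrix}1&-1\\1&0\end{pmatrix}.$$ Then $E_{\mathsf{com}}(G)$ is homotopy equivalent to $\bigvee_{\mathbb{N}} S^1$.
   Context: For a discrete group $G$, the sets $\mathrm{Hom}(\mathbb{Z}^n,G)\subseteq G^n$ of $n$-tuples of pairwise commuting elements form a simplicial subset of the usual simplicial model (nerve) of the classifying space $BG$; its geometric realization is $B_{\mathsf{com}}(G)$. The space $E_{\mathsf{com}}(G)$ is the pullback of the universal bundle $EG\to BG$ along $B_{\mathsf{com}}(G)\to BG$, equivalently (up to homotopy) the homotopy fiber of $B_{\mathsf{com}}(G)\to BG$. For discrete $G$, $E_{\mathsf{com}}(G)$ is homotopy equivalent to the geometric realization (of the nerve) of the poset of all cosets $gA$ with $g\in G$ and $A\le G$ an abelian subgroup, ordered by inclusion. *)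

theory Defs
  imports "HOL-Homology.Homology" "HOL-Algebra.Bij"
begin

section \<open>Quotient spaces, fibre products, wedges\<close>

text \<open>The quotient of \<open>X\<close> by the equivalence relation generated by \<open>r\<close>; its points are the
  equivalence classes.  The relation \<open>r\<close> is meant to relate only points of \<open>X\<close>.\<close>

definition quotient_class :: "('a \<Rightarrow> 'a \<Rightarrow> bool) \<Rightarrow> 'a \<Rightarrow> 'a set" where
  "quotient_class r x = {y. equivclp r x y}"

definition quotient_topology :: "'a topology \<Rightarrow> ('a \<Rightarrow> 'a \<Rightarrow> bool) \<Rightarrow> 'a set topology" where
  "quotient_topology X r =
     topology (\<lambda>U. U \<subseteq> quotient_class r ` topspace X \<and>
                   openin X {x \<in> topspace X. quotient_class r x \<in> U})"

lemma openin_quotient_topology: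
  "openin (quotient_topology X r) U \<longleftrightarrow>
     U \<subseteq> quotient_class r ` topspace X \<and> openin X {x \<in> topspace X. quotient_class r x \<in> U}"
proof -
  have "istopology (\<lambda>U. U \<subseteq> quotient_class r ` topspace X \<and>
                   openin X {x \<in> topspace X. quotient_class r x \<in> U})"
    unfolding istopology_def
  proof (intro conjI allI impI)
    fix S T
    assume S: "S \<subseteq> quotient_class r ` topspace X \<and> openin X {x \<in> topspace X. quotient_class r x \<in> S}"
      and T: "T \<subseteq> quotient_class r ` topspace X \<and> openin X {x \<in> topspace X. quotient_class r x \<in> T}"
    show "S \<inter> T \<subseteq> quotient_class r ` topspace X"
      using S by blast
    have "{x \<in> topspace X. quotient_class r x \<in> S \<inter> T} =
        {x \<in> topspace X. quotient_class r x \<in> S} \<inter> {x \<in> topspace X. quotient_class r x \<in> T}"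
      by blast
    then show "openin X {x \<in> topspace X. quotient_class r x \<in> S \<inter> T}"
      using S T by (metis (no_types, lifting) openin_Int)
  next
    fix K
    assume K: "\<forall>S\<in>K. S \<subseteq> quotient_class r ` topspace X \<and>
                  openin X {x \<in> topspace X. quotient_class r x \<in> S}"
    show "\<Union>K \<subseteq> quotient_class r ` topspace X"
      using K by blast
    have "{x \<in> topspace X. quotient_class r x \<in> \<Union>K} =
        (\<Union>S\<in>K. {x \<in> topspace X. quotient_class r x \<in> S})"
      by blast
    moreover have "openin X (\<Union>S\<in>K. {x \<in> topspace X. quotient_class r x \<in> S})"
      using K by (intro openin_Union) blast
    ultimately show "openin X {x \<in> topspace X. quotient_class r x \<in> \<Union>K}"
      by simp
  qed
  then show ?thesis
    unfolding quotient_topology_def by (simp add: topology_inverse')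
qed

lemma topspace_quotient_topology:
  "topspace (quotient_topology X r) = quotient_class r ` topspace X"
proof
  show "topspace (quotient_topology X r) \<subseteq> quotient_class r ` topspace X"
    using openin_quotient_topology openin_topspace by blast
  have "{x \<in> topspace X. quotient_class r x \<in> quotient_class r ` topspace X} = topspace X"
    by blast
  then have "openin (quotient_topology X r) (quotient_class r ` topspace X)"
    by (simp add: openin_quotient_topology)
  then show "quotient_class r ` topspace X \<subseteq> topspace (quotient_topology X r)"
    by (rule openin_subset)
qed

lemma quotient_map_quotient_class:
  "quotient_map X (quotient_topology X r) (quotient_class r)"
  by (auto simp: quotient_map_def openin_quotient_topology topspace_quotient_topology)

definition fibre_product ::
    "'a topology \<Rightarrow> 'b topology \<Rightarrow> ('a \<Rightarrow> 'c) \<Rightarrow> ('b \<Rightarrow> 'c) \<Rightarrow> ('a \<times> 'b) topology" where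
  "fibre_product X Y f g = subtopology (prod_topology X Y) {(x, y). f x = g y}"

definition wedge_sum ::
    "('i \<Rightarrow> 'a topology) \<Rightarrow> ('i \<Rightarrow> 'a) \<Rightarrow> 'i set \<Rightarrow> ('i \<times> 'a) set topology" where
  "wedge_sum X p I =
     quotient_topology (sum_topology X I) (\<lambda>x y. \<exists>i\<in>I. \<exists>j\<in>I. x = (i, p i) \<and> y = (j, p j))"

definition wedge_of_circles :: "(nat \<times> complex) set topology" where
  "wedge_of_circles = wedge_sum (\<lambda>_. top_of_set (sphere 0 1)) (\<lambda>_. 1) UNIV"


section \<open>Simplicial sets and geometric realization\<close>

text \<open>\<open>face S n i\<close> and \<open>degen S n i\<close> are the operators \<open>d\<^sub>i\<close> and \<open>s\<^sub>i\<close> on \<open>simplices S n\<close>,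
  for \<open>i \<le> n\<close>.\<close>

record 'a simplicial_set =
  simplices :: "nat \<Rightarrow> 'a set"
  face :: "nat \<Rightarrow> nat \<Rightarrow> 'a \<Rightarrow> 'a"
  degen :: "nat \<Rightarrow> nat \<Rightarrow> 'a \<Rightarrow> 'a"

text \<open>The \<open>i\<close>-th codegeneracy of standard simplices.  The \<open>i\<close>-th coface is the library's
  \<^const>\<open>simplical_face\<close>, which inserts a zero at position \<open>i\<close>.\<close>

definition simplex_codegen :: "nat \<Rightarrow> (nat \<Rightarrow> real) \<Rightarrow> nat \<Rightarrow> real" where
  "simplex_codegen i t = (\<lambda>j. if j < i then t j else if j = i then t i + t (Suc i) else t (Suc j))"

lemma simplex_codegen_standard_simplex:
  "t \<in> standard_simplex (Suc n) \<Longrightarrow> i \<le> n \<Longrightarrow> simplex_codegen i t \<in> standard_simplex n"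
proof -
  assume a: "t \<in> standard_simplex (Suc n)" "i \<le> n"
  have 1: "(\<Sum>j\<le>n. simplex_codegen i t j) = (\<Sum>j\<le>Suc n. t j)"
    using a(2)
  proof (induction n)
    case 0 then show ?case by (simp add: simplex_codegen_def)
  next
    case (Suc n)
    show ?case
    proof (cases "i \<le> n")
      case True then show ?thesis using Suc by (simp add: simplex_codegen_def)
    next
      case False then have "i = Suc n" using Suc by simp
      then show ?thesis by (simp add: simplex_codegen_def add.assoc)
    qed
  qed
  have nn: "\<forall>j. 0 \<le> simplex_codegen i t j" and z: "\<forall>j>n. simplex_codegen i t j = 0"
    using a by (auto simp: standard_simplex_def simplex_codegen_def)
  have "simplex_codegen i t j \<le> 1" for j
  proof (cases "j \<le> n")
    case True
    then have "simplex_codegen i t j \<le> (\<Sum>j\<le>n. simplex_codegen i t j)" using nn by (intro member_le_sum) auto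
    then show ?thesis using 1 a by (simp add: standard_simplex_def)
  next
    case False then show ?thesis using z by simp
  qed
  then show ?thesis using nn z 1 a by (simp add: standard_simplex_def)
qed

inductive realization_rel ::
    "'a simplicial_set \<Rightarrow> nat \<times> 'a \<times> (nat \<Rightarrow> real) \<Rightarrow> nat \<times> 'a \<times> (nat \<Rightarrow> real) \<Rightarrow> bool"
  for S where
  face: "\<lbrakk>x \<in> simplices S (Suc n); i \<le> Suc n; t \<in> standard_simplex n\<rbrakk>
     \<Longrightarrow> realization_rel S (Suc n, x, simplical_face i t) (n, face S (Suc n) i x, t)"
| degen: "\<lbrakk>x \<in> simplices S n; i \<le> n; t \<in> standard_simplex (Suc n)\<rbrakk>
     \<Longrightarrow> realization_rel S (n, x, simplex_codegen i t) (Suc n, degen S n i x, t)"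

definition realization ::
    "'a simplicial_set \<Rightarrow> (nat \<times> 'a \<times> (nat \<Rightarrow> real)) set topology" where
  "realization S =
     quotient_topology
       (sum_topology
          (\<lambda>n. prod_topology (discrete_topology (simplices S n))
                 (subtopology (powertop_real UNIV) (standard_simplex n)))
          UNIV)
       (realization_rel S)"

text \<open>The map of realizations induced by a simplicial map \<open>f\<close> into \<open>T\<close>: the class of \<open>(n, x, t)\<close>
  goes to the class of \<open>(n, f x, t)\<close>.\<close>

definition realization_map ::
    "'b simplicial_set \<Rightarrow> ('a \<Rightarrow> 'b) \<Rightarrow>
     (nat \<times> 'a \<times> (nat \<Rightarrow> real)) set \<Rightarrow> (nat \<times> 'b \<times> (nat \<Rightarrow> real)) set" where
  "realization_map T f c = (\<Union>(n, x, t)\<in>c. quotient_class (realization_rel T) (n, f x, t))"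


section \<open>\<open>BG\<close>, \<open>EG\<close>, \<open>B\<^sub>c\<^sub>o\<^sub>m(G)\<close> and \<open>E\<^sub>c\<^sub>o\<^sub>m(G)\<close>\<close>

text \<open>The list \<open>[g\<^sub>1, \<dots>, g\<^sub>n]\<close> is the simplex of \<open>BG\<close> given by a string of \<open>n\<close> composable
  arrows, composed as \<open>g\<^sub>1 \<otimes> g\<^sub>2\<close>.  The element \<open>g\<^sub>i\<close> has list index \<open>i - 1\<close>.\<close>

definition nerve_BG :: "('g, 'm) monoid_scheme \<Rightarrow> 'g list simplicial_set" where
  "nerve_BG G =
    \<lparr>simplices = (\<lambda>n. {g. length g = n \<and> set g \<subseteq> carrier G}),
     face = (\<lambda>n i g. if i = 0 then tl g
                     else if i = n then butlast g
                     else take (i - 1) g @ [g ! (i - 1) \<otimes>\<^bsub>G\<^esub> g ! i] @ drop (i + 1) g),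
     degen = (\<lambda>n i g. take i g @ [\<one>\<^bsub>G\<^esub>] @ drop i g)\<rparr>"

definition nerve_B_com :: "('g, 'm) monoid_scheme \<Rightarrow> 'g list simplicial_set" where
  "nerve_B_com G =
     (nerve_BG G)\<lparr>simplices := (\<lambda>n. {g \<in> simplices (nerve_BG G) n.
                      \<forall>x\<in>set g. \<forall>y\<in>set g. x \<otimes>\<^bsub>G\<^esub> y = y \<otimes>\<^bsub>G\<^esub> x})\<rparr>"

text \<open>The homogeneous model of \<open>EG\<close>: an \<open>n\<close>-simplex is a list \<open>[g\<^sub>0, \<dots>, g\<^sub>n]\<close>, and it lies over
  the simplex \<open>[g\<^sub>0\<inverse>g\<^sub>1, \<dots>, g\<^sub>n\<^sub>-\<^sub>1\<inverse>g\<^sub>n]\<close> of \<open>BG\<close>.\<close>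

definition nerve_EG :: "('g, 'm) monoid_scheme \<Rightarrow> 'g list simplicial_set" where
  "nerve_EG G =
    \<lparr>simplices = (\<lambda>n. {g. length g = Suc n \<and> set g \<subseteq> carrier G}),
     face = (\<lambda>n i g. take i g @ drop (Suc i) g),
     degen = (\<lambda>n i g. take (Suc i) g @ drop i g)\<rparr>"

definition bundle_map :: "('g, 'm) monoid_scheme \<Rightarrow> 'g list \<Rightarrow> 'g list" where
  "bundle_map G g = map (\<lambda>i. inv\<^bsub>G\<^esub> (g ! i) \<otimes>\<^bsub>G\<^esub> g ! Suc i) [0..<length g - 1]"

lemma bundle_face:
  assumes "group G" "g \<in> simplices (nerve_EG G) (Suc n)" "i \<le> Suc n"
  shows "bundle_map G (face (nerve_EG G) (Suc n) i g) = face (nerve_BG G) (Suc n) i (bundle_map G g)"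
proof -
  interpret group G by fact
  have c: "g ! j \<in> carrier G" if "j < Suc (Suc n)" for j
    using assms(2) that by (auto simp: nerve_EG_def)
  have tel: "inv\<^bsub>G\<^esub> a \<otimes>\<^bsub>G\<^esub> b \<otimes>\<^bsub>G\<^esub> (inv\<^bsub>G\<^esub> b \<otimes>\<^bsub>G\<^esub> d) = inv\<^bsub>G\<^esub> a \<otimes>\<^bsub>G\<^esub> d" if "a \<in> carrier G" "b \<in> carrier G" "d \<in> carrier G" for a b d
    using that by (metis inv_closed m_assoc m_closed r_inv r_one)
  have L: "length g = Suc (Suc n)" using assms(2) by (auto simp: nerve_EG_def)
  consider "i = 0" | "i = Suc n" | k where "i = Suc k" "k < n" using assms(3) by (cases i) (auto simp: le_less)
  then show ?thesis
  proof cases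
    case 1 then show ?thesis using L by (auto intro!: nth_equalityI simp: bundle_map_def nerve_EG_def nerve_BG_def nth_tl simp del: upt_Suc)
  next
    case 2 then show ?thesis using L by (auto intro!: nth_equalityI simp: bundle_map_def nerve_EG_def nerve_BG_def nth_butlast)
  next
    case 3
    show ?thesis
    proof (rule nth_equalityI)
      show "length (bundle_map G (face (nerve_EG G) (Suc n) i g)) = length (face (nerve_BG G) (Suc n) i (bundle_map G g))"
        using L 3 by (simp add: bundle_map_def nerve_EG_def nerve_BG_def min_def)
      fix j assume "j < length (bundle_map G (face (nerve_EG G) (Suc n) i g))"
      then have j: "j < n" using L 3 by (simp add: bundle_map_def nerve_EG_def nerve_BG_def min_def)
      show "bundle_map G (face (nerve_EG G) (Suc n) i g) ! j = face (nerve_BG G) (Suc n) i (bundle_map G g) ! j"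
        using L 3 j by (cases "j < k"; cases "j = k") (auto simp: bundle_map_def nerve_EG_def nerve_BG_def min_def nth_append tel c simp del: upt_Suc)
    qed
  qed
qed

lemma bundle_degen:
  assumes "group G" "g \<in> simplices (nerve_EG G) n" "i \<le> n"
  shows "bundle_map G (degen (nerve_EG G) n i g) = degen (nerve_BG G) n i (bundle_map G g)"
proof -
  interpret group G by fact
  have c: "g ! j \<in> carrier G" if "j < Suc n" for j
    using assms(2) that by (auto simp: nerve_EG_def)
  have L: "length g = Suc n" using assms(2) by (auto simp: nerve_EG_def)
    show ?thesis
    proof (rule nth_equalityI)
      show "length (bundle_map G (degen (nerve_EG G) n i g)) = length (degen (nerve_BG G) n i (bundle_map G g))"
        using L assms(3) by (simp add: bundle_map_def nerve_EG_def nerve_BG_def min_def)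
      fix j assume "j < length (bundle_map G (degen (nerve_EG G) n i g))"
      then have j: "j < Suc n" using L assms(3) by (simp add: bundle_map_def nerve_EG_def nerve_BG_def min_def split: if_splits)
      consider "j < i" | "j = i" | k where "j = Suc k" "i \<le> k" by (cases j) (auto simp: not_less_eq_eq, linarith)
      then show "bundle_map G (degen (nerve_EG G) n i g) ! j = degen (nerve_BG G) n i (bundle_map G g) ! j"
        using L assms(3) j by cases (auto simp: bundle_map_def nerve_EG_def nerve_BG_def min_def nth_append c Suc_diff_le le_antisym less_Suc_eq split: if_splits)
    qed
qed

definition B_com :: "('g, 'm) monoid_scheme \<Rightarrow> (nat \<times> 'g list \<times> (nat \<Rightarrow> real)) set topology" where
  "B_com G = realization (nerve_B_com G)"

definition E_com ::
    "('g, 'm) monoid_scheme \<Rightarrow>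
     ((nat \<times> 'g list \<times> (nat \<Rightarrow> real)) set \<times> (nat \<times> 'g list \<times> (nat \<Rightarrow> real)) set) topology" where
  "E_com G =
     fibre_product (B_com G) (realization (nerve_EG G))
       (realization_map (nerve_BG G) id) (realization_map (nerve_BG G) (bundle_map G))"


section \<open>The wallpaper groups\<close>

definition semidirect_product ::
    "('a, 'm) monoid_scheme \<Rightarrow> ('b, 'n) monoid_scheme \<Rightarrow> ('b \<Rightarrow> 'a \<Rightarrow> 'a) \<Rightarrow> ('a \<times> 'b) monoid" where
  "semidirect_product N H \<phi> =
    \<lparr>carrier = carrier N \<times> carrier H,
     monoid.mult = (\<lambda>(a, h) (b, k). (a \<otimes>\<^bsub>N\<^esub> \<phi> h b, h \<otimes>\<^bsub>H\<^esub> k)),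
     one = (\<one>\<^bsub>N\<^esub>, \<one>\<^bsub>H\<^esub>)\<rparr>"

text \<open>The action of a cyclic group (\<^const>\<open>integer_group\<close> or \<^const>\<open>integer_mod_group\<close>) on \<open>N\<close>
  in which the generator \<open>1\<close> acts by the automorphism \<open>\<alpha>\<close>.\<close>

definition cyclic_action :: "('a, 'm) monoid_scheme \<Rightarrow> ('a \<Rightarrow> 'a) \<Rightarrow> int \<Rightarrow> 'a \<Rightarrow> 'a" where
  "cyclic_action N \<alpha> k = \<alpha> [^]\<^bsub>AutoGroup N\<^esub> k"

definition klein_bottle_group :: "(int \<times> int) monoid" where
  "klein_bottle_group =
     semidirect_product integer_group integer_group (cyclic_action integer_group uminus)"

definition Z2_group :: "(int ^ 2) monoid" where
  "Z2_group = \<lparr>carrier = UNIV, monoid.mult = (+), one = 0\<rparr>"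

text \<open>Only the orders \<open>n = 2, 3, 4, 6\<close> are meaningful; elsewhere the value is a dummy.\<close>

definition wallpaper_matrix :: "nat \<Rightarrow> int ^ 2 ^ 2" where
  "wallpaper_matrix n =
    (if n = 2 then vector [vector [-1, 0], vector [0, -1]]
     else if n = 3 then vector [vector [0, -1], vector [1, -1]]
     else if n = 4 then vector [vector [0, -1], vector [1, 0]]
     else if n = 6 then vector [vector [1, -1], vector [1, 0]]
     else mat 1)"

definition wallpaper_group :: "nat \<Rightarrow> ((int ^ 2) \<times> int) monoid" where
  "wallpaper_group n =
     semidirect_product Z2_group (integer_mod_group n)
       (cyclic_action Z2_group ((*v) (wallpaper_matrix n)))"

lemma mult_AutoGroup:
  "f \<in> carrier (AutoGroup N) \<Longrightarrow> g \<in> carrier (AutoGroup N) \<Longrightarrow>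
    f \<otimes>\<^bsub>AutoGroup N\<^esub> g = compose (carrier N) f g"
  by (auto simp: AutoGroup_def BijGroup_def auto_def)

lemma group_semidirect_product:
  assumes N: "group N" and H: "group H" and \<phi>: "\<phi> \<in> hom H (AutoGroup N)"
  shows "group (semidirect_product N H \<phi>)"
proof -
  interpret N: group N by fact
  interpret H: group H by fact
  interpret A: group "AutoGroup N" by (rule N.AutoGroup)
  interpret \<phi>: group_hom H "AutoGroup N" \<phi>
    using \<phi> by unfold_locales
  have aut: "\<phi> h \<in> hom N N" if "h \<in> carrier H" for h
    using \<phi>.hom_closed[OF that] by (auto simp: AutoGroup_def auto_def)
  have cl: "\<phi> h a \<in> carrier N" if "h \<in> carrier H" "a \<in> carrier N" for h a
    using aut[OF that(1)] that(2) by (auto simp: hom_def)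
  have mul: "\<phi> h (a \<otimes>\<^bsub>N\<^esub> b) = \<phi> h a \<otimes>\<^bsub>N\<^esub> \<phi> h b"
    if "h \<in> carrier H" "a \<in> carrier N" "b \<in> carrier N" for h a b
    using aut[OF that(1)] that(2-) by (auto simp: hom_def)
  have act: "\<phi> (h \<otimes>\<^bsub>H\<^esub> k) a = \<phi> h (\<phi> k a)"
    if "h \<in> carrier H" "k \<in> carrier H" "a \<in> carrier N" for h k a
    using that by (simp add: mult_AutoGroup compose_def)
  have one: "\<phi> \<one>\<^bsub>H\<^esub> a = a" if "a \<in> carrier N" for a
    using that \<phi>.hom_one by (simp add: AutoGroup_def BijGroup_def)
  have o2: "\<phi> h \<one>\<^bsub>N\<^esub> = \<one>\<^bsub>N\<^esub>" if "h \<in> carrier H" for h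
    using mul[OF that, of "\<one>\<^bsub>N\<^esub>" "\<one>\<^bsub>N\<^esub>"] cl[OF that] by (metis N.one_closed N.r_one N.l_cancel_one')
  show ?thesis
  proof (rule groupI)
    fix x assume "x \<in> carrier (semidirect_product N H \<phi>)"
    then obtain a h where x: "x = (a, h)" "a \<in> carrier N" "h \<in> carrier H"
      by (auto simp: semidirect_product_def)
    let ?b = "\<phi> (inv\<^bsub>H\<^esub> h) (inv\<^bsub>N\<^esub> a)"
    have hi: "inv\<^bsub>H\<^esub> h \<in> carrier H" and ai: "inv\<^bsub>N\<^esub> a \<in> carrier N" using x by auto
    have "?b \<otimes>\<^bsub>N\<^esub> \<phi> (inv\<^bsub>H\<^esub> h) a = \<one>\<^bsub>N\<^esub>"
      using mul[OF hi ai x(2)] o2[OF hi] x(2) by simp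
    then show "\<exists>y\<in>carrier (semidirect_product N H \<phi>). y \<otimes>\<^bsub>semidirect_product N H \<phi>\<^esub> x = \<one>\<^bsub>semidirect_product N H \<phi>\<^esub>"
      using x hi cl[OF hi ai]
      by (intro bexI[of _ "(?b, inv\<^bsub>H\<^esub> h)"]) (simp_all add: semidirect_product_def del: \<phi>.hom_inv)
  qed (auto simp: semidirect_product_def cl mul act one N.m_assoc H.m_assoc simp del: \<phi>.hom_mult \<phi>.hom_one)
qed

lemma (in group) int_pow_hom_integer_mod_group:
  assumes x: "x \<in> carrier G" and n: "x [^] n = \<one>"
  shows "(\<lambda>k::int. x [^] k) \<in> hom (integer_mod_group n) G"
proof -
  have "x [^] (k mod int n) = x [^] k" for k :: int
  proof -
    have "x [^] k = x [^] (int n * (k div int n) + k mod int n)" by simp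
    also have "\<dots> = (x [^] int n) [^] (k div int n) \<otimes> x [^] (k mod int n)"
      using x by (subst int_pow_mult) (simp_all add: int_pow_pow)
    also have "\<dots> = x [^] (k mod int n)" using x n by (simp add: int_pow_int)
    finally show ?thesis by simp
  qed
  then show ?thesis using x by (auto simp: hom_def int_pow_mult)
qed

lemma group_Z2_group: "group Z2_group"
  unfolding Z2_group_def
  by (rule groupI) (auto simp: add.assoc intro: exI[of _ "- x" for x])

lemma pow_AutoGroup_UNIV:
  assumes "group N" "carrier N = UNIV" "\<alpha> \<in> carrier (AutoGroup N)"
  shows "\<alpha> [^]\<^bsub>AutoGroup N\<^esub> (k::nat) = \<alpha> ^^ k"
proof -
  interpret A: group "AutoGroup N" using assms group.AutoGroup by blast
  show ?thesis
  proof (induction k)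
    case 0 then show ?case using assms(2) by (simp add: AutoGroup_def BijGroup_def id_def)
  next
    case (Suc k)
    have "\<alpha> [^]\<^bsub>AutoGroup N\<^esub> k \<in> carrier (AutoGroup N)" using assms by simp
    then show ?case using Suc assms by (simp add: mult_AutoGroup compose_def funpow_swap1 fun_eq_iff)
  qed
qed

lemma uminus_AutoGroup: "uminus \<in> carrier (AutoGroup integer_group)"
  by (auto simp: AutoGroup_def auto_def hom_def Bij_def integer_group_def intro: bij_betw_byWitness[where f' = uminus])

lemma group_klein_bottle_group: "group klein_bottle_group"
  unfolding klein_bottle_group_def
proof (rule group_semidirect_product)
  interpret A: group "AutoGroup integer_group" by (simp add: group.AutoGroup)
  show "cyclic_action integer_group uminus \<in> hom integer_group (AutoGroup integer_group)"
    using uminus_AutoGroup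
    by (auto simp: cyclic_action_def hom_def A.int_pow_mult)
qed auto

lemma wallpaper_matrix_funpow:
  assumes "n \<in> {2, 3, 4, 6}"
  shows "(((*v) (wallpaper_matrix n)) ^^ n) v = v"
  using assms
  by (auto simp: wallpaper_matrix_def eval_nat_numeral vec_eq_iff forall_2 matrix_vector_mult_def sum_2)

lemma wallpaper_matrix_AutoGroup:
  assumes n: "n \<in> {2, 3, 4, 6}"
  shows "(*v) (wallpaper_matrix n) \<in> carrier (AutoGroup Z2_group)"
proof -
  let ?f = "(*v) (wallpaper_matrix n)"
  obtain m where m: "n = Suc m" using n by (cases n) auto
  have "bij ?f"
  proof (rule o_bij)
    show "(?f ^^ m) \<circ> ?f = id"
      using wallpaper_matrix_funpow[OF n] by (auto simp: fun_eq_iff m funpow_swap1)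
    show "?f \<circ> (?f ^^ m) = id"
      using wallpaper_matrix_funpow[OF n] by (auto simp: fun_eq_iff m)
  qed
  then show ?thesis
    by (auto simp: AutoGroup_def auto_def hom_def Bij_def Z2_group_def matrix_vector_right_distrib)
qed

lemma group_wallpaper_group:
  assumes n: "n \<in> {2, 3, 4, 6}"
  shows "group (wallpaper_group n)"
  unfolding wallpaper_group_def
proof (rule group_semidirect_product[OF group_Z2_group])
  interpret A: group "AutoGroup Z2_group" by (simp add: group.AutoGroup group_Z2_group)
  have "(*v) (wallpaper_matrix n) [^]\<^bsub>AutoGroup Z2_group\<^esub> n = ((*v) (wallpaper_matrix n)) ^^ n"
    by (rule pow_AutoGroup_UNIV[OF group_Z2_group _ wallpaper_matrix_AutoGroup[OF n]]) (simp add: Z2_group_def)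
  also have "\<dots> = \<one>\<^bsub>AutoGroup Z2_group\<^esub>"
    using wallpaper_matrix_funpow[OF n]
    by (simp add: AutoGroup_def BijGroup_def Z2_group_def fun_eq_iff)
  finally have "(*v) (wallpaper_matrix n) [^]\<^bsub>AutoGroup Z2_group\<^esub> n = \<one>\<^bsub>AutoGroup Z2_group\<^esub>" .
  then show "cyclic_action Z2_group ((*v) (wallpaper_matrix n)) \<in> hom (integer_mod_group n) (AutoGroup Z2_group)"
    using A.int_pow_hom_integer_mod_group[OF wallpaper_matrix_AutoGroup[OF n]]
    by (simp add: cyclic_action_def[abs_def])
qed simp

end

theory Submission
  imports Defs "HOL-Analysis.Analysis"
begin

text \<open>
  A point of \<open>EG\<close> is a list of group elements with weights of sum one, up to dropping entries of
  weight zero and merging neighbours with the same element; in other words, a step function from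
  \<open>[0, 1)\<close> to \<open>G\<close>.  The part of \<open>EG\<close> lying over \<open>B\<^sub>c\<^sub>o\<^sub>m(G)\<close> consists of the lists whose elements
  belong to one coset of an abelian subgroup.  It is a closed subcomplex, and by unique lifting along
  \<open>EG \<rightarrow> BG\<close> it is homeomorphic to the fibre product \<open>E\<^sub>c\<^sub>o\<^sub>m(G)\<close> (\<open>E_com_homeomorphic\<close>).

  In the groups at hand, commuting is transitive on elements outside the centre \<open>Z\<close>.  Hence the
  maximal abelian subgroups are the centralizers \<open>C(a)\<close> of noncentral elements, two different ones
  meet exactly in \<open>Z\<close>, and the cosets \<open>x C(a)\<close> are the lines of a linear space whose points are the
  cosets of \<open>Z\<close>: any two points lie on exactly one line.  So \<open>E\<^sub>c\<^sub>o\<^sub>m(G)\<close> is the complex of all lists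
  contained in a line.

  The lists in one line \<open>L\<close> form a contractible space, which can be deformed to the star
  that joins a chosen point \<open>base L\<close> to the other points of \<open>L\<close>, in such a way that a list with a
  single element stays within the point of that element (\<open>homotopic_id_star\<close>).  This leaves a graph
  on the points.  If \<open>origin\<close> is a point and every line through it has base \<open>origin\<close>, then the edges
  in these lines are a spanning tree, since every other point lies on exactly one of them.
  Contracting this tree leaves one circle for each pair of a line \<open>L\<close> that misses \<open>origin\<close> and a
  point of \<open>L\<close> other than \<open>base L\<close>.  The contraction is carried out explicitly: the edge from
  \<open>base L\<close> to \<open>p\<close> is stretched to the loop from \<open>origin\<close> over \<open>base L\<close> and \<open>p\<close> back to \<open>origin\<close>
  (\<open>homotopic_star_slide\<close>), and this loop is compared with a circle of the wedge
  (\<open>cliques_homotopy_equivalent_wedge\<close>).  There are infinitely many circles because the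
  translations form an infinite line and some point lies outside it.

  All maps are defined on weighted lists.  Such maps are continuous as soon as they are continuous
  in the weights of each fixed sequence of elements, and the same holds for homotopies
  (\<open>final_for_continuous_map_homotopy\<close>).
\<close>

section \<open>Spaces with the final topology of a family of maps\<close>

definition final_for :: "'z topology \<Rightarrow> 'a set \<Rightarrow> ('a \<Rightarrow> 'd topology) \<Rightarrow> ('a \<Rightarrow> 'd \<Rightarrow> 'z) \<Rightarrow> bool" where
  "final_for Z A D q \<longleftrightarrow>
     (\<forall>a\<in>A. continuous_map (D a) Z (q a)) \<and>
     (\<Union>a\<in>A. q a ` topspace (D a)) = topspace Z \<and>
     (\<forall>V. V \<subseteq> topspace Z \<longrightarrow> (\<forall>a\<in>A. openin (D a) {t \<in> topspace (D a). q a t \<in> V}) \<longrightarrow> openin Z V)"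

lemma final_for_openin:
  assumes "final_for Z A D q" "V \<subseteq> topspace Z"
    and "\<And>a. a \<in> A \<Longrightarrow> openin (D a) {t \<in> topspace (D a). q a t \<in> V}"
  shows "openin Z V"
  using assms by (simp add: final_for_def)

lemma final_for_continuous_map:
  assumes Z: "final_for Z A D q"
    and h: "\<And>a. a \<in> A \<Longrightarrow> continuous_map (D a) Y (\<lambda>t. h (q a t))"
  shows "continuous_map Z Y h"
  unfolding continuous_map_def
proof (intro conjI allI impI)
  have top: "topspace Z = (\<Union>a\<in>A. q a ` topspace (D a))"
    using Z by (simp add: final_for_def)
  show "h \<in> topspace Z \<rightarrow> topspace Y"
  proof
    fix x assume "x \<in> topspace Z"
    then obtain a t where "x = q a t" "a \<in> A" "t \<in> topspace (D a)"
      unfolding top by auto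
    then show "h x \<in> topspace Y"
      using continuous_map_funspace[OF h[of a]] by fastforce
  qed
  fix U assume U: "openin Y U"
  have "openin (D a) {t \<in> topspace (D a). q a t \<in> {x \<in> topspace Z. h x \<in> U}}" if "a \<in> A" for a
  proof -
    have "{t \<in> topspace (D a). q a t \<in> {x \<in> topspace Z. h x \<in> U}} = {t \<in> topspace (D a). h (q a t) \<in> U}"
      using that top by blast
    then show ?thesis
      using openin_continuous_map_preimage[OF h[OF that] U] by simp
  qed
  then show "openin Z {x \<in> topspace Z. h x \<in> U}"
    using final_for_openin[OF Z] by simp
qed

text \<open>A product with the unit interval need not be compared with a product of quotients: an open
  set around \<open>(s, z)\<close> contains \<open>N \<times> {z}\<close> for a compact interval \<open>N\<close> around \<open>s\<close>, and by the tube
  lemma the set of all \<open>z'\<close> with \<open>N \<times> {z'}\<close> inside is open, which may be tested in each \<open>D a\<close>.\<close>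

lemma final_for_continuous_map_homotopy:
  assumes Z: "final_for Z A D q"
    and h: "\<And>a. a \<in> A \<Longrightarrow>
      continuous_map (prod_topology (top_of_set {0..1}) (D a)) Y (\<lambda>(s::real, t). h (s, q a t))"
  shows "continuous_map (prod_topology (top_of_set {0..1}) Z) Y h"
  unfolding continuous_map_def
proof (intro conjI allI impI)
  let ?I = "top_of_set {0..1::real}"
  have top: "topspace Z = (\<Union>a\<in>A. q a ` topspace (D a))"
    using Z by (simp add: final_for_def)
  show "h \<in> topspace (prod_topology ?I Z) \<rightarrow> topspace Y"
  proof
    fix x assume "x \<in> topspace (prod_topology ?I Z)"
    then obtain s a t where "x = (s, q a t)" "s \<in> {0..1}" "a \<in> A" "t \<in> topspace (D a)"
      unfolding topspace_prod_topology top by auto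
    then show "h x \<in> topspace Y"
      using continuous_map_image_subset_topspace[OF h[of a]] by (auto simp: image_subset_iff)
  qed
  fix U assume U: "openin Y U"
  show "openin (prod_topology ?I Z) {x \<in> topspace (prod_topology ?I Z). h x \<in> U}"
    unfolding openin_prod_topology_alt
  proof (intro allI impI)
    fix s z assume "(s, z) \<in> {x \<in> topspace (prod_topology ?I Z). h x \<in> U}"
    then have s: "s \<in> {0..1}" and z: "z \<in> topspace Z" and sz: "h (s, z) \<in> U" by auto
    obtain a t where a: "a \<in> A" "t \<in> topspace (D a)" "z = q a t" using z top by blast
    have oa: "openin (prod_topology ?I (D a)) {x \<in> topspace (prod_topology ?I (D a)). h (fst x, q a (snd x)) \<in> U}"
      if "a \<in> A" for a
      using openin_continuous_map_preimage[OF h[OF that] U] by (simp add: case_prod_beta)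
    obtain S W where SW: "openin ?I S" "s \<in> S" "t \<in> W" 
        "S \<times> W \<subseteq> {x \<in> topspace (prod_topology ?I (D a)). h (fst x, q a (snd x)) \<in> U}"
    proof -
      have "(s, t) \<in> {x \<in> topspace (prod_topology ?I (D a)). h (fst x, q a (snd x)) \<in> U}"
        using s a sz by simp
      then show ?thesis
        using oa[OF a(1)] that unfolding openin_prod_topology_alt by blast
    qed
    obtain e where e: "e > 0" "cball s e \<inter> {0..1} \<subseteq> S"
      using SW(1,2) unfolding openin_contains_cball by blast
    define N where "N = cball s e \<inter> {0..1}"
    have N: "compact N" "N \<subseteq> {0..1}" "N \<subseteq> S" "s \<in> N"
      using e s by (auto simp: N_def compact_Int)
    define V where "V = {z \<in> topspace Z. \<forall>s'\<in>N. h (s', z) \<in> U}"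
    have "openin (D b) {t \<in> topspace (D b). q b t \<in> V}" if b: "b \<in> A" for b
    proof -
      let ?C = "{x \<in> topspace (prod_topology (top_of_set N) (D b)). h (fst x, q b (snd x)) \<notin> U}"
      have "closedin (prod_topology (top_of_set N) (D b)) ?C"
      proof -
        have "continuous_map (prod_topology (top_of_set N) (D b)) Y (\<lambda>(s, t). h (s, q b t))"
          using h[OF b] N(2) unfolding prod_topology_subtopology
          by (elim continuous_map_from_subtopology_mono) auto
        then have "openin (prod_topology (top_of_set N) (D b)) {x \<in> topspace (prod_topology (top_of_set N) (D b)). h (fst x, q b (snd x)) \<in> U}"
          using openin_continuous_map_preimage[OF _ U] by (fastforce simp: case_prod_beta)
        moreover have "topspace (prod_topology (top_of_set N) (D b)) - ?C = {x \<in> topspace (prod_topology (top_of_set N) (D b)). h (fst x, q b (snd x)) \<in> U}"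
          by auto
        ultimately show ?thesis unfolding closedin_def by auto
      qed
      moreover have "closed_map (prod_topology (top_of_set N) (D b)) (D b) snd"
        using N(1) by (intro Abstract_Topological_Spaces.closed_map_snd) (simp add: compact_space_subtopology)
      ultimately have "closedin (D b) (snd ` ?C)"
        by (simp add: closed_map_def)
      then have "openin (D b) (topspace (D b) - snd ` ?C)" by blast
      moreover have "topspace (D b) - snd ` ?C = {t \<in> topspace (D b). q b t \<in> V}"
      proof -
        have "q b t \<in> topspace Z" if "t \<in> topspace (D b)" for t using that b top by blast
        then show ?thesis by (force simp: V_def image_iff)
      qed
      ultimately show ?thesis by simp
    qed
    then have "openin Z V"
      using final_for_openin[OF Z, of V] by (auto simp: V_def)
    moreover have "z \<in> V"
    proof -
      have "h (s', q a t) \<in> U" if "s' \<in> N" for s'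
      proof -
        have "(s', t) \<in> S \<times> W" using that N(3) SW(3) by (simp add: subset_iff)
        from subsetD[OF SW(4) this] show ?thesis by simp
      qed
      then show ?thesis using z a by (simp add: V_def)
    qed
    moreover have "openin ?I (ball s e \<inter> {0..1})"
      by (auto simp: openin_open)
    moreover have "(ball s e \<inter> {0..1}) \<times> V \<subseteq> {x \<in> topspace (prod_topology ?I Z). h x \<in> U}"
      by (auto simp: V_def N_def)
    ultimately show "\<exists>Ua Va. openin ?I Ua \<and> openin Z Va \<and> s \<in> Ua \<and> z \<in> Va \<and>
        Ua \<times> Va \<subseteq> {x \<in> topspace (prod_topology ?I Z). h x \<in> U}"
      using s e(1) by (intro exI[of _ "ball s e \<inter> {0..1}"] exI[of _ V]) simp
  qed
qed

lemma final_for_homotopic: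
  assumes Z: "final_for Z A D q"
    and h: "\<And>a. a \<in> A \<Longrightarrow>
      continuous_map (prod_topology (top_of_set {0..1}) (D a)) Y (\<lambda>(s::real, t). h s (q a t))"
    and f: "\<And>z. z \<in> topspace Z \<Longrightarrow> h 0 z = f z"
    and g: "\<And>z. z \<in> topspace Z \<Longrightarrow> h 1 z = g z"
  shows "homotopic_with (\<lambda>_. True) Z Y f g"
proof -
  have "continuous_map (prod_topology (top_of_set {0..1}) Z) Y (\<lambda>(s, z). h s z)"
    by (rule final_for_continuous_map_homotopy[OF Z]) (use h in auto)
  then show ?thesis
    by (subst homotopic_with) (auto intro!: exI[of _ "\<lambda>(s, z). h s z"] simp: f g)
qed

section \<open>Simplicial sets of vertex sequences and weighted lists\<close>

definition sequence_complex :: "('v set \<Rightarrow> bool) \<Rightarrow> 'v list simplicial_set" where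
  "sequence_complex K =
    \<lparr>simplices = (\<lambda>n. {g. length g = Suc n \<and> K (set g)}),
     face = (\<lambda>n i g. take i g @ drop (Suc i) g),
     degen = (\<lambda>n i g. take (Suc i) g @ drop i g)\<rparr>"

lemma sequence_complex_simps [simp]:
  "g \<in> simplices (sequence_complex K) n \<longleftrightarrow> length g = Suc n \<and> K (set g)"
  "face (sequence_complex K) n i g = take i g @ drop (Suc i) g"
  "degen (sequence_complex K) n i g = take (Suc i) g @ drop i g"
  by (auto simp: sequence_complex_def)

lemma nerve_EG_eq: "nerve_EG G = sequence_complex (\<lambda>S. S \<subseteq> carrier G)"
  by (simp add: nerve_EG_def sequence_complex_def)

text \<open>A triple \<open>(n, g, t)\<close> representing a point of the realization is the same as the list of the
  vertices \<open>g\<close> paired with their barycentric coordinates.  In this form the face identifications drop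
  an entry of weight zero, and the degeneracy identifications merge two neighbours with the same vertex.\<close>

definition weighted :: "nat \<times> 'v list \<times> (nat \<Rightarrow> real) \<Rightarrow> ('v \<times> real) list" where
  "weighted = (\<lambda>(n, g, t). zip g (map t [0..<Suc n]))"

definition triple :: "('v \<times> real) list \<Rightarrow> nat \<times> 'v list \<times> (nat \<Rightarrow> real)" where
  "triple l = (length l - 1, map fst l, \<lambda>i. if i < length l then snd (l ! i) else 0)"

definition valid :: "('v set \<Rightarrow> bool) \<Rightarrow> ('v \<times> real) list \<Rightarrow> bool" where
  "valid K l \<longleftrightarrow> l \<noteq> [] \<and> K (fst ` set l) \<and> (\<forall>x\<in>set l. 0 \<le> snd x) \<and> sum_list (map snd l) = 1"

lemma standard_simplex_iff:
  "t \<in> standard_simplex n \<longleftrightarrow> (\<forall>i. 0 \<le> t i) \<and> (\<forall>i>n. t i = 0) \<and> sum_list (map t [0..<Suc n]) = 1"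
proof -
  have s: "sum_list (map t [0..<Suc n]) = sum t {..n}"
    by (simp only: interv_sum_list_conv_sum_set_nat set_upt atLeastLessThanSuc_atLeastAtMost atLeast0AtMost)
  have "t i \<le> 1" if "\<forall>i. 0 \<le> t i" "\<forall>i>n. t i = 0" "sum t {..n} = 1" for i
  proof (cases "i \<le> n")
    case True
    have "t i \<le> sum t {..n}" using True that(1) by (intro member_le_sum) auto
    then show ?thesis using that(3) by simp
  qed (use that in auto)
  then show ?thesis unfolding s standard_simplex_def by (simp add: conj_ac, metis)
qed

lemma weighted_valid:
  assumes "g \<in> simplices (sequence_complex K) n" "t \<in> standard_simplex n"
  shows "valid K (weighted (n, g, t))" "triple (weighted (n, g, t)) = (n, g, t)"
proof -
  have "fst ` set (weighted (n, g, t)) = set g"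
    using assms by (simp add: weighted_def flip: set_map)
  moreover have "map snd (weighted (n, g, t)) = map t [0..<Suc n]"
    using assms(1) by (simp add: weighted_def del: upt_Suc)
  moreover have "0 \<le> snd x" if "x \<in> set (weighted (n, g, t))" for x
    using that assms(2) by (auto simp: weighted_def standard_simplex_iff in_set_zip simp del: upt_Suc) metis
  moreover have "weighted (n, g, t) \<noteq> []"
    using assms(1) by (auto simp: weighted_def simp del: upt_Suc)
  ultimately show "valid K (weighted (n, g, t))"
    using assms unfolding valid_def standard_simplex_iff by simp
  show "triple (weighted (n, g, t)) = (n, g, t)"
    using assms by (auto simp: triple_def weighted_def standard_simplex_iff fun_eq_iff not_less simp del: upt_Suc)
qed

lemma triple_weighted:
  assumes "valid K l"
  obtains n g t where "triple l = (n, g, t)" "g \<in> simplices (sequence_complex K) n"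
    "t \<in> standard_simplex n" "weighted (n, g, t) = l"
proof -
  let ?t = "\<lambda>i. if i < length l then snd (l ! i) else 0"
  have L: "Suc (length l - 1) = length l" using assms by (simp add: valid_def)
  have m: "map ?t [0..<length l] = map snd l"
    by (rule nth_equalityI) auto
  show ?thesis
  proof
    show "triple l = (length l - 1, map fst l, ?t)" by (simp add: triple_def)
    show "map fst l \<in> simplices (sequence_complex K) (length l - 1)"
      using assms L by (simp add: valid_def)
    show "?t \<in> standard_simplex (length l - 1)"
      unfolding standard_simplex_iff L m using assms by (auto simp: valid_def)
    show "weighted (length l - 1, map fst l, ?t) = l"
      unfolding weighted_def prod.case L m by (rule zip_map_fst_snd)
  qed
qed

lemma map_simplical_face: 
  "map (simplical_face (length xs) t) [0..<Suc (length xs + length ys)] =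
     map t [0..<length xs] @ 0 # map t [length xs..<length xs + length ys]"
proof (rule nth_equalityI)
  fix i assume "i < length (map (simplical_face (length xs) t) [0..<Suc (length xs + length ys)])"
  then consider "i < length xs" | "i = length xs" | k where "i = Suc (length xs + k)" "k < length ys"
    using that(3)[of "i - Suc (length xs)"] by (cases i "length xs" rule: linorder_cases) auto
  then show "map (simplical_face (length xs) t) [0..<Suc (length xs + length ys)] ! i =
      (map t [0..<length xs] @ 0 # map t [length xs..<length xs + length ys]) ! i"
    by cases (auto simp: simplical_face_def nth_append simp del: upt_Suc)
qed simp

lemma weighted_face:
  assumes "length x = Suc (Suc n)" "i \<le> Suc n"
  obtains xs a ys where "weighted (Suc n, x, simplical_face i t) = xs @ (a, 0) # ys"
    "weighted (n, take i x @ drop (Suc i) x, t) = xs @ ys"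
proof
  define A B where "A = take i x" and "B = drop (Suc i) x"
  have x: "x = A @ x ! i # B" using assms by (simp add: A_def B_def id_take_nth_drop)
  have i: "length A = i" "Suc (length A + length B) = Suc (Suc n)"
    using assms by (auto simp: A_def B_def)
  have "weighted (Suc n, x, simplical_face i t) =
      zip (A @ x ! i # B) (map t [0..<length A] @ 0 # map t [length A..<length A + length B])"
    unfolding weighted_def prod.case using map_simplical_face[of A t B] i x by simp
  then show "weighted (Suc n, x, simplical_face i t) = zip A (map t [0..<length A]) @ (x ! i, 0) # zip B (map t [length A..<length A + length B])"
    by simp
  have u: "[0..<Suc n] = [0..<length A] @ [length A..<length A + length B]"
    using i by (metis Suc_inject add.left_neutral le_add1 upt_add_eq_append zero_le)
  show "weighted (n, take i x @ drop (Suc i) x, t) = zip A (map t [0..<length A]) @ zip B (map t [length A..<length A + length B])"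
    unfolding weighted_def prod.case u A_def[symmetric] B_def[symmetric] by simp
qed

lemma map_simplex_codegen:
  assumes "i \<le> n"
  shows "map (simplex_codegen i t) [0..<Suc n] = map t [0..<i] @ (t i + t (Suc i)) # map t [Suc (Suc i)..<Suc (Suc n)]"
proof (rule nth_equalityI)
  fix j assume "j < length (map (simplex_codegen i t) [0..<Suc n])"
  then have "j \<le> n" by simp
  then consider "j < i" | "j = i" | k where "j = Suc (i + k)" "i + k < n"
    using that(3)[of "j - Suc i"] by (cases j i rule: linorder_cases) auto
  then show "map (simplex_codegen i t) [0..<Suc n] ! j =
      (map t [0..<i] @ (t i + t (Suc i)) # map t [Suc (Suc i)..<Suc (Suc n)]) ! j"
    using assms by cases (auto simp: simplex_codegen_def nth_append simp del: upt_Suc)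
qed (use assms in \<open>simp del: upt_Suc\<close>)

lemma weighted_degen:
  assumes "length x = Suc n" "i \<le> n"
  obtains xs a ys where "weighted (n, x, simplex_codegen i t) = xs @ (a, t i + t (Suc i)) # ys"
    "weighted (Suc n, take (Suc i) x @ drop i x, t) = xs @ (a, t i) # (a, t (Suc i)) # ys"
proof
  define A B where "A = take i x" and "B = drop (Suc i) x"
  have x: "x = A @ x ! i # B" using assms by (simp add: A_def B_def id_take_nth_drop)
  have i: "length A = i" using assms by (simp add: A_def)
  have "weighted (n, x, simplex_codegen i t) = zip (A @ x ! i # B) (map t [0..<i] @ (t i + t (Suc i)) # map t [Suc (Suc i)..<Suc (Suc n)])"
    unfolding weighted_def prod.case using map_simplex_codegen[OF assms(2)] x by metis
  then show "weighted (n, x, simplex_codegen i t) = zip A (map t [0..<i]) @ (x ! i, t i + t (Suc i)) # zip B (map t [Suc (Suc i)..<Suc (Suc n)])"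
    using i by simp
  have u: "[0..<Suc (Suc n)] = [0..<i] @ i # Suc i # [Suc (Suc i)..<Suc (Suc n)]"
  proof -
    have "[0..<Suc (Suc n)] = [0..<i] @ [i..<Suc (Suc n)]"
      using assms(2) upt_add_eq_append[of 0 i "Suc (Suc n) - i"] by simp
    then show ?thesis using assms(2) by (simp add: upt_conv_Cons del: upt_Suc)
  qed
  have "take (Suc i) x @ drop i x = A @ x ! i # x ! i # B"
    using assms by (simp add: A_def B_def take_Suc_conv_app_nth Cons_nth_drop_Suc)
  then show "weighted (Suc n, take (Suc i) x @ drop i x, t) = zip A (map t [0..<i]) @ (x ! i, t i) # (x ! i, t (Suc i)) # zip B (map t [Suc (Suc i)..<Suc (Suc n)])"
    unfolding weighted_def prod.case u using i by simp
qed

section \<open>Normal forms of points and maps out of a realization\<close>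

text \<open>Repeated pushing leads to the shortest weighted list that describes the same point, that is, the
  same step function with values in the vertices.\<close>

fun push :: "'v \<times> real \<Rightarrow> ('v \<times> real) list \<Rightarrow> ('v \<times> real) list" where
  "push (x, a) [] = (if a = 0 then [] else [(x, a)])"
| "push (x, a) ((y, b) # l) =
     (if a = 0 then (y, b) # l else if x = y then (x, a + b) # l else (x, a) # (y, b) # l)"

definition reduce :: "('v \<times> real) list \<Rightarrow> ('v \<times> real) list" where
  "reduce l = foldr push l []"

lemma push_zero [simp]: "push (x, 0) l = l"
  by (cases l) auto

lemma push_push: "0 \<le> a \<Longrightarrow> 0 \<le> b \<Longrightarrow> push (x, a) (push (x, b) l) = push (x, a + b) l"
  by (cases l) auto

lemma reduce_Nil [simp]: "reduce [] = []"
  and reduce_Cons [simp]: "reduce (p # l) = push p (reduce l)"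
  by (simp_all add: reduce_def)

lemma reduce_append: "reduce (xs @ ys) = foldr push xs (reduce ys)"
  by (simp add: reduce_def)

lemma reduce_drop_zero: "reduce (xs @ (x, 0) # ys) = reduce (xs @ ys)"
  by (simp add: reduce_append)

lemma reduce_merge: "0 \<le> a \<Longrightarrow> 0 \<le> b \<Longrightarrow> reduce (xs @ (x, a) # (x, b) # ys) = reduce (xs @ (x, a + b) # ys)"
  by (simp add: reduce_append push_push)

lemma set_push: "0 \<le> snd p \<Longrightarrow> \<forall>q\<in>set l. 0 < snd q \<Longrightarrow>
    fst ` set (push p l) = (if snd p = 0 then {} else {fst p}) \<union> fst ` set l \<and> (\<forall>q\<in>set (push p l). 0 < snd q)"
  by (induction p l rule: push.induct) auto

lemma set_reduce:
  assumes "\<forall>p\<in>set l. 0 \<le> snd p"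
  shows "fst ` set (reduce l) = fst ` {p \<in> set l. 0 < snd p} \<and> (\<forall>q\<in>set (reduce l). 0 < snd q)"
  using assms
proof (induction l)
  case (Cons p l)
  then have IH: "fst ` set (reduce l) = fst ` {p \<in> set l. 0 < snd p}" "\<forall>q\<in>set (reduce l). 0 < snd q"
    by auto
  have "0 \<le> snd p" using Cons.prems by simp
  from set_push[OF this IH(2)] show ?case
    using IH(1) \<open>0 \<le> snd p\<close> by (auto simp: image_iff)
qed simp

lemma foldr_push_zero: "\<forall>x\<in>set ms. snd x = 0 \<Longrightarrow> foldr push ms r = r"
  by (induction ms) auto

lemma foldr_push_same:
  "\<forall>x\<in>set ms. 0 \<le> snd x \<and> (snd x \<noteq> 0 \<longrightarrow> fst x = p) \<Longrightarrow> foldr push ms [] = push (p, sum_list (map snd ms)) []"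
proof (induction ms)
  case (Cons x ms)
  obtain a w where x: "x = (a, w)" by (cases x)
  have "0 \<le> sum_list (map snd ms)" using Cons.prems by (intro sum_list_nonneg) auto
  moreover have "foldr push ms [] = push (p, sum_list (map snd ms)) []" using Cons by simp
  ultimately show ?case using Cons.prems x by (cases "w = 0") (simp_all add: push_push del: push.simps)
qed simp

text \<open>The identifications of the realization, in the language of lists.\<close>

definition move_invariant :: "('v set \<Rightarrow> bool) \<Rightarrow> (('v \<times> real) list \<Rightarrow> 'y) \<Rightarrow> bool" where
  "move_invariant K h \<longleftrightarrow>
     (\<forall>xs x ys. valid K (xs @ (x, 0) # ys) \<longrightarrow> h (xs @ (x, 0) # ys) = h (xs @ ys)) \<and>
     (\<forall>xs x a b ys. valid K (xs @ (x, a) # (x, b) # ys) \<longrightarrow>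
        h (xs @ (x, a) # (x, b) # ys) = h (xs @ (x, a + b) # ys))"

definition pt :: "('v set \<Rightarrow> bool) \<Rightarrow> ('v \<times> real) list \<Rightarrow> (nat \<times> 'v list \<times> (nat \<Rightarrow> real)) set" where
  "pt K l = quotient_class (realization_rel (sequence_complex K)) (triple l)"

text \<open>For a move invariant \<open>h\<close> the chosen list is immaterial (\<open>realization_lift_pt\<close> below).\<close>

definition realization_lift ::
    "('v set \<Rightarrow> bool) \<Rightarrow> (('v \<times> real) list \<Rightarrow> 'y) \<Rightarrow> (nat \<times> 'v list \<times> (nat \<Rightarrow> real)) set \<Rightarrow> 'y" where
  "realization_lift K h z = h (SOME l. valid K l \<and> z = pt K l)"

abbreviation simplex_space :: "nat \<Rightarrow> (nat \<Rightarrow> real) topology" where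
  "simplex_space n \<equiv> subtopology (powertop_real UNIV) (standard_simplex n)"

definition weigh :: "'v list \<Rightarrow> (nat \<Rightarrow> real) \<Rightarrow> ('v \<times> real) list" where
  "weigh g t = zip g (map t [0..<length g])"

lemma weigh_Cons: "weigh (a # l) t = (a, t 0) # weigh l (\<lambda>i. t (Suc i))"
  by (simp add: weigh_def map_upt_Suc del: upt_Suc)

lemma reduce_weigh_overwrite:
  assumes "length g = length g'" "\<And>i. i < length g \<Longrightarrow> t i \<noteq> 0 \<Longrightarrow> g ! i = g' ! i"
  shows "reduce (weigh g t) = reduce (weigh g' t)"
  using assms
proof (induction g g' arbitrary: t rule: list_induct2)
  case (Cons x g y g')
  have "reduce (weigh g (\<lambda>i. t (Suc i))) = reduce (weigh g' (\<lambda>i. t (Suc i)))"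
    using Cons.prems by (intro Cons.IH) fastforce
  moreover have "t 0 \<noteq> 0 \<Longrightarrow> x = y" using Cons.prems[of 0] by simp
  ultimately show ?case unfolding weigh_Cons by (cases "t 0 = 0") auto
qed (simp add: weigh_def)

lemma quotient_class_eq_iff: "quotient_class r x = quotient_class r y \<longleftrightarrow> equivclp r x y"
proof
  assume "quotient_class r x = quotient_class r y"
  then have "y \<in> quotient_class r x" by (simp add: quotient_class_def)
  then show "equivclp r x y" by (simp add: quotient_class_def)
next
  assume a: "equivclp r x y"
  then have "equivclp r x z \<longleftrightarrow> equivclp r y z" for z
    using equivclp_trans equivclp_sym by metis
  then show "quotient_class r x = quotient_class r y" by (simp add: quotient_class_def)
qed

lemma equivclp_invariant:
  assumes "equivclp r x y" "\<And>u v. r u v \<Longrightarrow> f u = f v"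
  shows "f x = f y"
  using assms(1) by (induction rule: equivclp_induct) (metis assms(2))+

lemma openin_prod_discrete:
  "openin (prod_topology (discrete_topology A) Y) U \<longleftrightarrow>
     U \<subseteq> A \<times> topspace Y \<and> (\<forall>a\<in>A. openin Y {y. (a, y) \<in> U})" (is "?L \<longleftrightarrow> ?R")
proof
  assume L: ?L
  have "openin Y {y. (a, y) \<in> U}" if a: "a \<in> A" for a
  proof -
    have "continuous_map Y (prod_topology (discrete_topology A) Y) (\<lambda>y. (a, y))"
      using a by (simp add: continuous_map_pairwise o_def)
    from openin_continuous_map_preimage[OF this L]
    have "openin Y {y \<in> topspace Y. (a, y) \<in> U}" .
    moreover have "{y \<in> topspace Y. (a, y) \<in> U} = {y. (a, y) \<in> U}"
      using openin_subset[OF L] by auto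
    ultimately show ?thesis by simp
  qed
  then show ?R using openin_subset[OF L] by simp
next
  assume R: ?R
  show ?L unfolding openin_prod_topology_alt
  proof (intro allI impI)
    fix a y assume "(a, y) \<in> U"
    then show "\<exists>V W. openin (discrete_topology A) V \<and> openin Y W \<and> a \<in> V \<and> y \<in> W \<and> V \<times> W \<subseteq> U"
      using R by (intro exI[of _ "{a}"] exI[of _ "{y. (a, y) \<in> U}"]) auto
  qed
qed

lemma openin_realization:
  "openin (realization S) V \<longleftrightarrow> V \<subseteq> topspace (realization S) \<and>
     (\<forall>n. \<forall>g\<in>simplices S n. openin (simplex_space n)
        {t \<in> standard_simplex n. quotient_class (realization_rel S) (n, g, t) \<in> V})"
proof -
  have 1: "openin (realization S) V \<longleftrightarrow> V \<subseteq> topspace (realization S) \<and>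
     (\<forall>n. openin (prod_topology (discrete_topology (simplices S n)) (simplex_space n))
        {p. fst p \<in> simplices S n \<and> snd p \<in> standard_simplex n \<and> quotient_class (realization_rel S) (n, p) \<in> V})"
    unfolding realization_def openin_quotient_topology topspace_quotient_topology openin_sum_topology
    by (auto simp: mem_Times_iff subset_iff)
  show ?thesis
    unfolding 1 openin_prod_discrete
    by (intro conj_cong refl all_cong) auto
qed

lemma topspace_realization:
  "topspace (realization S) =
    {quotient_class (realization_rel S) (n, g, t) | n g t. g \<in> simplices S n \<and> t \<in> standard_simplex n}"
proof -
  have "topspace (realization S) = quotient_class (realization_rel S) `
      (SIGMA n:UNIV. simplices S n \<times> standard_simplex n)"
    unfolding realization_def topspace_quotient_topology by (simp add: o_def)
  then show ?thesis by blast
qed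

lemma weighted_eq_weigh: "length g = Suc n \<Longrightarrow> weighted (n, g, t) = weigh g t"
  by (simp add: weighted_def weigh_def)

lemma pt_weigh:
  assumes "g \<in> simplices (sequence_complex K) n" "t \<in> standard_simplex n"
  shows "pt K (weigh g t) = quotient_class (realization_rel (sequence_complex K)) (n, g, t)"
  using weighted_valid(2)[OF assms] weighted_eq_weigh[of g n t] assms(1) by (simp add: pt_def)

lemma valid_weigh:
  assumes "g \<noteq> []" "K (set g)" "t \<in> standard_simplex (length g - 1)"
  shows "valid K (weigh g t)"
  using weighted_valid(1)[of g K "length g - 1" t] weighted_eq_weigh[of g "length g - 1" t] assms by simp

lemma weights_simplex:
  assumes "valid K l"
  shows "(\<lambda>i. if i < length l then snd (l ! i) else 0) \<in> standard_simplex (length l - 1)"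
proof -
  obtain n g t where "triple l = (n, g, t)" "t \<in> standard_simplex n"
    using triple_weighted[OF assms] by metis
  then show ?thesis by (auto simp: triple_def)
qed

lemma topspace_realization_pt: "topspace (realization (sequence_complex K)) = {pt K l | l. valid K l}"
proof (intro subset_antisym subsetI)
  fix z assume "z \<in> topspace (realization (sequence_complex K))"
  then obtain n g t where *: "z = quotient_class (realization_rel (sequence_complex K)) (n, g, t)"
     "g \<in> simplices (sequence_complex K) n" "t \<in> standard_simplex n"
    unfolding topspace_realization by blast
  then have "z = pt K (weighted (n, g, t))" by (simp add: pt_def weighted_valid(2))
  then show "z \<in> {pt K l | l. valid K l}" using weighted_valid(1) * by blast
next
  fix z assume "z \<in> {pt K l | l. valid K l}"
  then obtain l where l: "valid K l" "z = pt K l" by blast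
  obtain n g t where "triple l = (n, g, t)" "g \<in> simplices (sequence_complex K) n" "t \<in> standard_simplex n"
    using triple_weighted[OF l(1)] by metis
  then show "z \<in> topspace (realization (sequence_complex K))"
    unfolding topspace_realization l(2) pt_def by auto
qed

lemma topspace_simplex_space [simp]: "topspace (simplex_space n) = standard_simplex n"
  by simp

lemma final_for_realization:
  "final_for (realization (sequence_complex K)) {g. g \<noteq> [] \<and> K (set g)}
     (\<lambda>g. simplex_space (length g - 1)) (\<lambda>g t. pt K (weigh g t))"
proof -
  let ?R = "realization (sequence_complex K)"
  have sets: "{t \<in> standard_simplex (length g - 1). pt K (weigh g t) \<in> V} =
     {t \<in> standard_simplex (length g - 1). quotient_class (realization_rel (sequence_complex K)) (length g - 1, g, t) \<in> V}"
    if "g \<noteq> []" "K (set g)" for g V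
    using that pt_weigh[of g K "length g - 1"] by (intro Collect_cong conj_cong refl) simp
  have ptin: "pt K (weigh g t) \<in> topspace ?R"
    if "g \<noteq> []" "K (set g)" "t \<in> standard_simplex (length g - 1)" for g t
    using valid_weigh[of g K t] that unfolding topspace_realization_pt by auto
  show ?thesis
    unfolding final_for_def
  proof (intro conjI ballI allI impI)
    fix g assume "g \<in> {g. g \<noteq> [] \<and> K (set g)}"
    then have g: "g \<noteq> []" "K (set g)" by auto
    show "continuous_map (simplex_space (length g - 1)) ?R (\<lambda>t. pt K (weigh g t))"
      unfolding continuous_map_def
    proof (intro conjI allI impI)
      fix U assume "openin ?R U"
      then have "openin (simplex_space (length g - 1)) {t \<in> standard_simplex (length g - 1).
          quotient_class (realization_rel (sequence_complex K)) (length g - 1, g, t) \<in> U}"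
        using g unfolding openin_realization by simp
      then show "openin (simplex_space (length g - 1)) {t \<in> topspace (simplex_space (length g - 1)). pt K (weigh g t) \<in> U}"
        unfolding topspace_simplex_space sets[OF g] .
    qed (use ptin[OF g] in auto)
  next
    show "(\<Union>g\<in>{g. g \<noteq> [] \<and> K (set g)}. (\<lambda>t. pt K (weigh g t)) ` topspace (simplex_space (length g - 1))) = topspace ?R"
    proof (intro equalityI subsetI)
      fix z assume "z \<in> topspace ?R"
      then obtain n g t where *: "z = quotient_class (realization_rel (sequence_complex K)) (n, g, t)"
         "g \<in> simplices (sequence_complex K) n" "t \<in> standard_simplex n"
        unfolding topspace_realization by blast
      then have "z = pt K (weigh g t)" "g \<noteq> []" "K (set g)" "n = length g - 1"
        using pt_weigh[OF *(2,3)] by auto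
      then show "z \<in> (\<Union>g\<in>{g. g \<noteq> [] \<and> K (set g)}. (\<lambda>t. pt K (weigh g t)) ` topspace (simplex_space (length g - 1)))"
        using *(3) by auto
    qed (use ptin in auto)
  next
    fix V assume V: "V \<subseteq> topspace ?R"
      and o: "\<forall>g\<in>{g. g \<noteq> [] \<and> K (set g)}. openin (simplex_space (length g - 1))
         {t \<in> topspace (simplex_space (length g - 1)). pt K (weigh g t) \<in> V}"
    show "openin ?R V"
      unfolding openin_realization
    proof (intro conjI allI ballI)
      fix n g assume g: "g \<in> simplices (sequence_complex K) n"
      then have g': "g \<noteq> []" "K (set g)" "n = length g - 1" by auto
      show "openin (simplex_space n) {t \<in> standard_simplex n. quotient_class (realization_rel (sequence_complex K)) (n, g, t) \<in> V}"
        using bspec[OF o, of g] g'(1,2)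
        unfolding topspace_simplex_space sets[OF g'(1,2)] g'(3) by blast
    qed (use V in simp)
  qed
qed

text \<open>With a fixed sequence of vertices, \<open>L d\<close> is a point of one simplex, whose coordinates vary
  continuously.  The family may run through degenerate points and boundary points of that simplex.\<close>

lemma continuous_map_pt:
  assumes L: "\<And>d. d \<in> topspace D \<Longrightarrow> valid K (L d) \<and> map fst (L d) = g"
    and c: "\<And>i. i < length g \<Longrightarrow> continuous_map D euclideanreal (\<lambda>d. snd (L d ! i))"
  shows "continuous_map D (realization (sequence_complex K)) (\<lambda>d. pt K (L d))"
proof (cases "topspace D = {}")
  case True
  then show ?thesis by (simp add: continuous_map_on_empty)
next
  case False
  then obtain d0 where "d0 \<in> topspace D" by blast
  from L[OF this] have g: "g \<noteq> []" "K (set g)" by (auto simp: valid_def)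
  define w where "w d = (\<lambda>i. if i < length g then snd (L d ! i) else 0)" for d
  have w: "w d \<in> standard_simplex (length g - 1) \<and> weigh g (w d) = L d" if d: "d \<in> topspace D" for d
  proof -
    have len: "length (L d) = length g" using L[OF d] by (metis length_map)
    obtain n g' t where *: "triple (L d) = (n, g', t)" "g' \<in> simplices (sequence_complex K) n"
      "t \<in> standard_simplex n" "weighted (n, g', t) = L d"
      using triple_weighted conjunct1[OF L[OF d]] by blast
    have "n = length g - 1 \<and> map fst (L d) = g' \<and> t = w d"
      using *(1) by (auto simp: triple_def w_def len)
    then have "n = length g - 1" "g' = g" "t = w d" using conjunct2[OF L[OF d]] by simp_all
    then show ?thesis using * weighted_eq_weigh[of g n t] by simp
  qed
  have "continuous_map D (simplex_space (length g - 1)) w"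
    unfolding continuous_map_in_subtopology continuous_map_componentwise_UNIV
  proof (intro conjI allI)
    fix i show "continuous_map D euclideanreal (\<lambda>d. w d i)"
      by (cases "i < length g") (auto simp: w_def c)
  qed (use w in auto)
  moreover have "continuous_map (simplex_space (length g - 1)) (realization (sequence_complex K)) (\<lambda>t. pt K (weigh g t))"
    using final_for_realization[of K] g by (simp add: final_for_def)
  ultimately have "continuous_map D (realization (sequence_complex K)) ((\<lambda>t. pt K (weigh g t)) \<circ> w)"
    by (rule continuous_map_compose)
  then show ?thesis
    by (rule continuous_map_eq) (use w in auto)
qed

locale hereditary =
  fixes K :: "'v set \<Rightarrow> bool"
  assumes hereditary: "K S \<Longrightarrow> T \<subseteq> S \<Longrightarrow> T \<noteq> {} \<Longrightarrow> K T"
begin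

lemma valid_drop_zero:
  assumes "valid K (xs @ (x, 0) # ys)"
  shows "valid K (xs @ ys)"
proof -
  have "xs @ ys \<noteq> []" using assms by (auto simp: valid_def)
  then show ?thesis
    using assms hereditary[of "fst ` set (xs @ (x, 0) # ys)" "fst ` set (xs @ ys)"] by (auto simp: valid_def)
qed

lemma valid_merge:
  assumes "valid K (xs @ (x, a) # (x, b) # ys)"
  shows "valid K (xs @ (x, a + b) # ys)"
  using assms by (simp add: valid_def)

text \<open>\<open>reduce\<close> works from the right end of a list; the prefix \<open>xs\<close> stands for the entries that it
  has not reached yet.\<close>

lemma move_invariant_reduce_append:
  assumes h: "move_invariant K h" and v: "valid K (xs @ ys)"
  shows "valid K (xs @ reduce ys) \<and> h (xs @ ys) = h (xs @ reduce ys)"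
  using v
proof (induction ys arbitrary: xs)
  case (Cons p ys)
  obtain x a where p: "p = (x, a)" by (cases p)
  have IH: "valid K (xs @ (x, a) # reduce ys)" "h (xs @ p # ys) = h (xs @ (x, a) # reduce ys)"
    using Cons.IH[of "xs @ [p]"] Cons.prems p by simp_all
  consider "a = 0" | b zs where "a \<noteq> 0" "reduce ys = (x, b) # zs" | "reduce (p # ys) = (x, a) # reduce ys"
    by (cases "reduce ys") (force simp: p)+
  then have "valid K (xs @ reduce (p # ys)) \<and> h (xs @ (x, a) # reduce ys) = h (xs @ reduce (p # ys))"
  proof cases
    case 1
    then show ?thesis using IH(1) h valid_drop_zero[of xs x "reduce ys"] by (auto simp: p move_invariant_def)
  next
    case 2
    then show ?thesis using IH(1) h valid_merge[of xs x a b zs] by (auto simp: p move_invariant_def)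
  next
    case 3
    then show ?thesis using IH(1) by metis
  qed
  then show ?case using IH(2) by simp
qed simp

lemma move_invariant_reduce:
  assumes "move_invariant K h" "valid K l"
  shows "valid K (reduce l)" "h l = h (reduce l)"
  using move_invariant_reduce_append[OF assms(1), of "[]" l] assms(2) by auto

lemma move_invariant_pt: "move_invariant K (pt K)"
  unfolding move_invariant_def
proof (intro conjI allI impI)
  fix xs x ys assume v: "valid K (xs @ (x, 0) # ys)"
  let ?l = "xs @ ys" and ?g = "map fst (xs @ (x, 0) # ys)"
  let ?t = "\<lambda>i. if i < length ?l then snd (?l ! i) else 0"
  have ne: "?l \<noteq> []" using valid_drop_zero[OF v] by (simp add: valid_def)
  have t: "?t \<in> standard_simplex (length ?l - 1)"
    by (rule weights_simplex[OF valid_drop_zero[OF v]])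
  have "realization_rel (sequence_complex K) (Suc (length ?l - 1), ?g, simplical_face (length xs) ?t)
     (length ?l - 1, face (sequence_complex K) (Suc (length ?l - 1)) (length xs) ?g, ?t)"
    using v t ne by (intro realization_rel.face) (auto simp: valid_def image_Un)
  moreover have "(Suc (length ?l - 1), ?g, simplical_face (length xs) ?t) = triple (xs @ (x, 0) # ys)"
    using ne by (auto simp: triple_def fun_eq_iff simplical_face_def nth_append nth_Cons' not_less)
  moreover have "(length ?l - 1, face (sequence_complex K) (Suc (length ?l - 1)) (length xs) ?g, ?t) = triple ?l"
    by (auto simp: triple_def)
  ultimately show "pt K (xs @ (x, 0) # ys) = pt K (xs @ ys)"
    unfolding pt_def quotient_class_eq_iff by auto
next
  fix xs x a b ys assume v: "valid K (xs @ (x, a) # (x, b) # ys)"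
  let ?l = "xs @ (x, a) # (x, b) # ys" and ?g = "map fst (xs @ (x, a + b) # ys)"
  let ?n = "length (xs @ ys)"
  let ?t = "\<lambda>i. if i < length ?l then snd (?l ! i) else 0"
  have t: "?t \<in> standard_simplex (Suc ?n)"
    using weights_simplex[OF v] by simp
  have "realization_rel (sequence_complex K) (?n, ?g, simplex_codegen (length xs) ?t)
     (Suc ?n, degen (sequence_complex K) ?n (length xs) ?g, ?t)"
    using v t by (intro realization_rel.degen) (auto simp: valid_def image_Un)
  moreover have "(?n, ?g, simplex_codegen (length xs) ?t) = triple (xs @ (x, a + b) # ys)"
    by (auto simp: triple_def fun_eq_iff simplex_codegen_def nth_append nth_Cons' not_less Suc_diff_le)
  moreover have "(Suc ?n, degen (sequence_complex K) ?n (length xs) ?g, ?t) = triple ?l"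
    by (auto simp: triple_def)
  ultimately show "pt K ?l = pt K (xs @ (x, a + b) # ys)"
    unfolding pt_def quotient_class_eq_iff by (metis converse_r_into_equivclp)
qed

lemma realization_rel_reduce:
  assumes "realization_rel (sequence_complex K) p q"
  shows "reduce (weighted p) = reduce (weighted q)"
  using assms
proof cases
  case (face x n i t)
  then obtain xs a ys where "weighted p = xs @ (a, 0) # ys" "weighted q = xs @ ys"
    using weighted_face[of x n i t] by auto
  then show ?thesis by (simp add: reduce_drop_zero)
next
  case (degen x n i t)
  then obtain xs a ys where "weighted p = xs @ (a, t i + t (Suc i)) # ys"
      "weighted q = xs @ (a, t i) # (a, t (Suc i)) # ys"
    using weighted_degen[of x n i t] by auto
  moreover have "0 \<le> t i" "0 \<le> t (Suc i)" using degen by (auto simp: standard_simplex_def)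
  ultimately show ?thesis by (simp add: reduce_merge)
qed

text \<open>Both moves preserve the reduced list, and moves lead from every list to its reduced list, so
  reduced lists are a normal form for the points of the realization.\<close>

lemma pt_eq_iff:
  assumes "valid K l" "valid K l'"
  shows "pt K l = pt K l' \<longleftrightarrow> reduce l = reduce l'"
proof
  assume "pt K l = pt K l'"
  then have "equivclp (realization_rel (sequence_complex K)) (triple l) (triple l')"
    by (simp add: pt_def quotient_class_eq_iff)
  then have "reduce (weighted (triple l)) = reduce (weighted (triple l'))"
    by (rule equivclp_invariant) (rule realization_rel_reduce)
  then show "reduce l = reduce l'"
    using triple_weighted[OF assms(1)] triple_weighted[OF assms(2)] by metis
next
  assume "reduce l = reduce l'"
  then show "pt K l = pt K l'"
    using move_invariant_reduce(2)[OF move_invariant_pt] assms by metis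
qed

lemma realization_lift_pt:
  assumes h: "move_invariant K h" and l: "valid K l"
  shows "realization_lift K h (pt K l) = h l"
proof -
  define l' where "l' = (SOME l'. valid K l' \<and> pt K l = pt K l')"
  have l': "valid K l' \<and> pt K l = pt K l'"
    unfolding l'_def by (rule someI[of _ l]) (simp add: l)
  then have "reduce l = reduce l'" using pt_eq_iff l by blast
  then have "h l = h l'" using move_invariant_reduce(2)[OF h] l l' by metis
  then show ?thesis by (simp add: realization_lift_def l'_def)
qed

lemma continuous_map_realization_lift:
  assumes h: "move_invariant K h"
    and c: "\<And>g. g \<noteq> [] \<Longrightarrow> K (set g) \<Longrightarrow>
       continuous_map (simplex_space (length g - 1)) Y (\<lambda>t. h (weigh g t))"
  shows "continuous_map (realization (sequence_complex K)) Y (realization_lift K h)"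
proof (rule final_for_continuous_map[OF final_for_realization])
  fix g assume "g \<in> {g. g \<noteq> [] \<and> K (set g)}"
  then have g: "g \<noteq> []" "K (set g)" by auto
  show "continuous_map (simplex_space (length g - 1)) Y (\<lambda>t. realization_lift K h (pt K (weigh g t)))"
    using c[OF g] by (rule continuous_map_eq) (simp add: realization_lift_pt[OF h] valid_weigh g)
qed

lemma homotopic_realization_lift:
  assumes h: "\<And>s. s \<in> {0..1} \<Longrightarrow> move_invariant K (h s)"
    and c: "\<And>g. g \<noteq> [] \<Longrightarrow> K (set g) \<Longrightarrow>
       continuous_map (prod_topology (top_of_set {0..1}) (simplex_space (length g - 1))) Y (\<lambda>(s::real, t). h s (weigh g t))"
  shows "homotopic_with (\<lambda>_. True) (realization (sequence_complex K)) Y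
           (realization_lift K (h 0)) (realization_lift K (h 1))"
proof (rule final_for_homotopic[OF final_for_realization, where h = "\<lambda>s. realization_lift K (h s)"])
  fix g assume "g \<in> {g. g \<noteq> [] \<and> K (set g)}"
  then have g: "g \<noteq> []" "K (set g)" by auto
  show "continuous_map (prod_topology (top_of_set {0..1}) (simplex_space (length g - 1))) Y
      (\<lambda>(s, t). realization_lift K (h s) (pt K (weigh g t)))"
    using c[OF g] by (rule continuous_map_eq) (auto simp: realization_lift_pt[OF h] valid_weigh g)
qed auto

end

section \<open>\<open>E\<^sub>c\<^sub>o\<^sub>m(G)\<close> as a complex of vertex sequences\<close>

lemma closedin_realization:
  "closedin (realization S) C \<longleftrightarrow> C \<subseteq> topspace (realization S) \<and>
     (\<forall>n. \<forall>g\<in>simplices S n. closedin (simplex_space n)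
        {t \<in> standard_simplex n. quotient_class (realization_rel S) (n, g, t) \<in> C})"
proof -
  let ?q = "quotient_class (realization_rel S)"
  have "openin (simplex_space n) {t \<in> standard_simplex n. ?q (n, g, t) \<in> topspace (realization S) - C} \<longleftrightarrow>
      closedin (simplex_space n) {t \<in> standard_simplex n. ?q (n, g, t) \<in> C}"
    if "g \<in> simplices S n" for n g
  proof -
    have "{t \<in> standard_simplex n. ?q (n, g, t) \<in> topspace (realization S) - C} =
        topspace (simplex_space n) - {t \<in> standard_simplex n. ?q (n, g, t) \<in> C}"
      using that unfolding topspace_realization by auto
    then show ?thesis unfolding closedin_def by auto
  qed
  then show ?thesis
    unfolding closedin_def[of "realization S"] openin_realization[of S] by auto
qed

lemma class_in_realization:
  "x \<in> simplices S n \<Longrightarrow> t \<in> standard_simplex n \<Longrightarrow>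
     quotient_class (realization_rel S) (n, x, t) \<in> topspace (realization S)"
  unfolding topspace_realization by blast

definition simplicial_map :: "'a simplicial_set \<Rightarrow> 'b simplicial_set \<Rightarrow> ('a \<Rightarrow> 'b) \<Rightarrow> bool" where
  "simplicial_map S T f \<longleftrightarrow>
     (\<forall>n. \<forall>x\<in>simplices S n. f x \<in> simplices T n) \<and>
     (\<forall>n i. \<forall>x\<in>simplices S (Suc n). i \<le> Suc n \<longrightarrow> f (face S (Suc n) i x) = face T (Suc n) i (f x)) \<and>
     (\<forall>n i. \<forall>x\<in>simplices S n. i \<le> n \<longrightarrow> f (degen S n i x) = degen T n i (f x))"

lemma realization_map_class:
  assumes f: "simplicial_map S T f"
  shows "realization_map T f (quotient_class (realization_rel S) (n, x, t)) =
    quotient_class (realization_rel T) (n, f x, t)"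
proof -
  let ?F = "\<lambda>(n, x, t). quotient_class (realization_rel T) (n, f x, t)"
  have rel: "?F p = ?F q" if "realization_rel S p q" for p q
    using that
  proof cases
    case (face x n i t)
    then have "realization_rel T (Suc n, f x, simplical_face i t) (n, face T (Suc n) i (f x), t)"
      using f by (intro realization_rel.face) (auto simp: simplicial_map_def)
    then show ?thesis using face f by (auto simp: quotient_class_eq_iff simplicial_map_def)
  next
    case (degen x n i t)
    then have "realization_rel T (n, f x, simplex_codegen i t) (Suc n, degen T n i (f x), t)"
      using f by (intro realization_rel.degen) (auto simp: simplicial_map_def)
    then show ?thesis using degen f by (auto simp: quotient_class_eq_iff simplicial_map_def)
  qed
  have "?F p = ?F (n, x, t)" if "p \<in> quotient_class (realization_rel S) (n, x, t)" for p
    using equivclp_invariant[of "realization_rel S" "(n, x, t)" p ?F] that rel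
    by (simp add: quotient_class_def)
  moreover have "(n, x, t) \<in> quotient_class (realization_rel S) (n, x, t)"
    by (simp add: quotient_class_def)
  ultimately have "(\<Union>p\<in>quotient_class (realization_rel S) (n, x, t). ?F p) = ?F (n, x, t)"
    by blast
  then show ?thesis by (simp add: realization_map_def)
qed

lemma continuous_map_realization_map:
  assumes f: "simplicial_map S T f"
  shows "continuous_map (realization S) (realization T) (realization_map T f)"
  unfolding continuous_map_def
proof (intro conjI allI impI)
  have fx: "f x \<in> simplices T n" if "x \<in> simplices S n" for x n
    using f that by (simp add: simplicial_map_def)
  show maps: "realization_map T f \<in> topspace (realization S) \<rightarrow> topspace (realization T)"
  proof
    fix z assume "z \<in> topspace (realization S)"
    then obtain n x t where "z = quotient_class (realization_rel S) (n, x, t)" "x \<in> simplices S n" "t \<in> standard_simplex n"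
      unfolding topspace_realization by blast
    then show "realization_map T f z \<in> topspace (realization T)"
      by (simp add: realization_map_class[OF f] class_in_realization fx)
  qed
  fix U assume U: "openin (realization T) U"
  show "openin (realization S) {z \<in> topspace (realization S). realization_map T f z \<in> U}"
    unfolding openin_realization
  proof (intro conjI allI ballI)
    fix n x assume x: "x \<in> simplices S n"
    have "{t \<in> standard_simplex n. quotient_class (realization_rel S) (n, x, t)
           \<in> {z \<in> topspace (realization S). realization_map T f z \<in> U}} =
        {t \<in> standard_simplex n. quotient_class (realization_rel T) (n, f x, t) \<in> U}"
      using x unfolding topspace_realization by (auto simp: realization_map_class[OF f])
    then show "openin (simplex_space n) {t \<in> standard_simplex n. quotient_class (realization_rel S) (n, x, t)
           \<in> {z \<in> topspace (realization S). realization_map T f z \<in> U}}"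
      using U fx[OF x] unfolding openin_realization by simp
  qed auto
qed

text \<open>The subsets of cosets \<open>x A\<close> of abelian subgroups \<open>A\<close>.\<close>

definition commuting_differences :: "('g, 'm) monoid_scheme \<Rightarrow> 'g set \<Rightarrow> bool" where
  "commuting_differences G S \<longleftrightarrow> S \<subseteq> carrier G \<and>
     (\<forall>x\<in>S. \<forall>y\<in>S. \<forall>z\<in>S. (inv\<^bsub>G\<^esub> x \<otimes>\<^bsub>G\<^esub> y) \<otimes>\<^bsub>G\<^esub> (inv\<^bsub>G\<^esub> x \<otimes>\<^bsub>G\<^esub> z) = (inv\<^bsub>G\<^esub> x \<otimes>\<^bsub>G\<^esub> z) \<otimes>\<^bsub>G\<^esub> (inv\<^bsub>G\<^esub> x \<otimes>\<^bsub>G\<^esub> y))"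

lemma hereditary_commuting_differences: "hereditary (commuting_differences G)"
  by unfold_locales (auto simp: commuting_differences_def subset_iff)

lemma hereditary_carrier: "hereditary (\<lambda>S. S \<subseteq> carrier G)"
  by unfold_locales auto

lemma bundle_map_Cons:
  "bundle_map G (x # y # l) = (inv\<^bsub>G\<^esub> x \<otimes>\<^bsub>G\<^esub> y) # bundle_map G (y # l)"
  by (simp add: bundle_map_def map_upt_Suc del: upt_Suc)

lemma bundle_map_single [simp]: "bundle_map G [x] = []"
  by (simp add: bundle_map_def)

context group
begin

lemma commute_mult:
  assumes "c \<in> carrier G" "x \<in> carrier G" "y \<in> carrier G" "c \<otimes> x = x \<otimes> c" "c \<otimes> y = y \<otimes> c"
  shows "c \<otimes> (x \<otimes> y) = (x \<otimes> y) \<otimes> c"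
  using assms by (metis m_assoc)

lemma commute_inv:
  assumes "c \<in> carrier G" "x \<in> carrier G" "c \<otimes> x = x \<otimes> c"
  shows "c \<otimes> inv x = inv x \<otimes> c"
proof -
  have "inv x \<otimes> (c \<otimes> x) \<otimes> inv x = inv x \<otimes> (x \<otimes> c) \<otimes> inv x" using assms(3) by simp
  moreover have "inv x \<otimes> (c \<otimes> x) \<otimes> inv x = inv x \<otimes> c"
    using assms(1,2) by (simp add: m_assoc)
  moreover have "inv x \<otimes> (x \<otimes> c) \<otimes> inv x = c \<otimes> inv x"
    using assms(1,2) by (simp flip: m_assoc)
  ultimately show ?thesis by simp
qed

lemma inv_mult_cancel:
  assumes "x \<in> carrier G" "y \<in> carrier G" "z \<in> carrier G"
  shows "(inv x \<otimes> y) \<otimes> (inv y \<otimes> z) = inv x \<otimes> z"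
  using assms by (metis inv_closed m_assoc m_closed r_inv r_one)

lemma inv_differences:
  assumes "x \<in> carrier G" "y \<in> carrier G" "z \<in> carrier G"
  shows "inv (inv x \<otimes> y) \<otimes> (inv x \<otimes> z) = inv y \<otimes> z"
  using assms by (simp add: inv_mult_group inv_mult_cancel m_assoc[symmetric]) (simp add: m_assoc)

text \<open>With \<open>d\<^sub>i = g\<^sub>0\<inverse> g\<^sub>i\<close>, the differences of neighbours, with \<open>j = i + 1\<close>, are \<open>d\<^sub>i\<inverse> d\<^sub>j\<close> and \<open>d\<^sub>i\<close> is a product of
  such differences, so these commute with each other if and only if the \<open>d\<^sub>i\<close> do.\<close>

lemma commuting_differences_bundle:
  assumes g: "g \<noteq> []" "set g \<subseteq> carrier G"
  shows "commuting_differences G (set g) \<longleftrightarrow>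
    (\<forall>x\<in>set (bundle_map G g). \<forall>y\<in>set (bundle_map G g). x \<otimes> y = y \<otimes> x)" (is "?L \<longleftrightarrow> ?R")
proof -
  define d where "d i = inv (g ! 0) \<otimes> g ! i" for i
  have gc: "g ! i \<in> carrier G" if "i < length g" for i using g that by (meson nth_mem subsetD)
  have g0: "g ! 0 \<in> carrier G" using gc g by simp
  have dc: "d i \<in> carrier G" if "i < length g" for i using gc[OF that] g0 by (simp add: d_def)
  have diff: "inv (g ! i) \<otimes> g ! j = inv (d i) \<otimes> d j" if "i < length g" "j < length g" for i j
    unfolding d_def using inv_differences[of "g ! 0" "g ! i" "g ! j"] g0 gc that by simp
  have B: "set (bundle_map G g) = {inv (g ! i) \<otimes> g ! Suc i | i. Suc i < length g}"
    by (auto simp: bundle_map_def image_iff less_diff_conv)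
  have comm: "(inv a \<otimes> b) \<otimes> (inv c \<otimes> e) = (inv c \<otimes> e) \<otimes> (inv a \<otimes> b)"
    if "a \<in> D" "b \<in> D" "c \<in> D" "e \<in> D" "D \<subseteq> carrier G" "\<And>x y. x \<in> D \<Longrightarrow> y \<in> D \<Longrightarrow> x \<otimes> y = y \<otimes> x"
    for a b c e D
  proof -
    have 1: "u \<otimes> (inv c \<otimes> e) = (inv c \<otimes> e) \<otimes> u" if "u \<in> D" for u
      using that \<open>c \<in> D\<close> \<open>e \<in> D\<close> \<open>D \<subseteq> carrier G\<close> \<open>\<And>x y. x \<in> D \<Longrightarrow> y \<in> D \<Longrightarrow> x \<otimes> y = y \<otimes> x\<close>
      by (intro commute_mult commute_inv) auto
    let ?w = "inv c \<otimes> e"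
    have c: "a \<in> carrier G" "b \<in> carrier G" "?w \<in> carrier G" using that by auto
    have "?w \<otimes> (inv a \<otimes> b) = (inv a \<otimes> b) \<otimes> ?w"
      using c commute_inv[of ?w a] 1[OF \<open>a \<in> D\<close>] 1[OF \<open>b \<in> D\<close>] by (intro commute_mult) auto
    then show ?thesis by simp
  qed
  show ?thesis
  proof
    assume L: ?L
    have "x \<otimes> y = y \<otimes> x" if "x \<in> d ` {..<length g}" "y \<in> d ` {..<length g}" for x y
      using L that g unfolding commuting_differences_def d_def by auto
    note dd = this
    show ?R
    proof (intro ballI)
      fix x y assume "x \<in> set (bundle_map G g)" "y \<in> set (bundle_map G g)"
      then obtain i j where "x = inv (g ! i) \<otimes> g ! Suc i" "y = inv (g ! j) \<otimes> g ! Suc j" "Suc i < length g" "Suc j < length g"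
        unfolding B by blast
      then show "x \<otimes> y = y \<otimes> x"
        using comm[of "d i" "d ` {..<length g}" "d (Suc i)" "d j" "d (Suc j)"] dd dc by (simp add: diff image_subset_iff)
    qed
  next
    assume R: ?R
    have c: "c \<otimes> d j = d j \<otimes> c"
      if "c \<in> carrier G" "\<And>b. b \<in> set (bundle_map G g) \<Longrightarrow> c \<otimes> b = b \<otimes> c" "j < length g" for c j
      using that(3)
    proof (induction j)
      case 0
      then show ?case using that(1) g0 by (simp add: d_def)
    next
      case (Suc j)
      have "d (Suc j) = d j \<otimes> (inv (g ! j) \<otimes> g ! Suc j)"
        unfolding d_def using inv_mult_cancel[of "g ! 0" "g ! j" "g ! Suc j"] g0 gc Suc.prems by simp
      moreover have "inv (g ! j) \<otimes> g ! Suc j \<in> set (bundle_map G g)" unfolding B using Suc.prems by blast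
      ultimately show ?case
        using Suc that dc gc by (simp add: commute_mult)
    qed
    have Bc: "set (bundle_map G g) \<subseteq> carrier G" unfolding B using gc by auto
    have "d i \<otimes> d j = d j \<otimes> d i" if "i < length g" "j < length g" for i j
    proof (rule c[OF dc[OF that(1)] _ that(2)])
      fix b assume b: "b \<in> set (bundle_map G g)"
      then show "d i \<otimes> b = b \<otimes> d i" using c[of b i] R Bc that(1) by auto
    qed
    then have dd: "x \<otimes> y = y \<otimes> x" if "x \<in> d ` {..<length g}" "y \<in> d ` {..<length g}" for x y
      using that by auto
    show ?L
      unfolding commuting_differences_def
    proof (intro conjI ballI)
      fix x y z assume "x \<in> set g" "y \<in> set g" "z \<in> set g"
      then obtain i j k where "x = g ! i" "y = g ! j" "z = g ! k" "i < length g" "j < length g" "k < length g"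
        by (metis in_set_conv_nth)
      then show "(inv x \<otimes> y) \<otimes> (inv x \<otimes> z) = (inv x \<otimes> z) \<otimes> (inv x \<otimes> y)"
        using comm[of "d i" "d ` {..<length g}" "d j" "d i" "d k"] dd dc by (simp add: diff image_subset_iff)
    qed (use g in simp)
  qed
qed

abbreviation X_com :: "'a list simplicial_set" where
  "X_com \<equiv> sequence_complex (commuting_differences G)"

lemma X_com_simplices:
  "g \<in> simplices X_com n \<longleftrightarrow> g \<in> simplices (nerve_EG G) n \<and> bundle_map G g \<in> simplices (nerve_B_com G) n"
proof -
  have "set (bundle_map G g) \<subseteq> carrier G" if "set g \<subseteq> carrier G"
    using that by (auto simp: bundle_map_def subset_iff)
  moreover have "length (bundle_map G g) = n" if "length g = Suc n"
    using that by (simp add: bundle_map_def)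
  moreover have "commuting_differences G (set g) \<Longrightarrow> set g \<subseteq> carrier G"
    by (simp add: commuting_differences_def)
  ultimately show ?thesis
    using commuting_differences_bundle[of g]
    by (cases "g = []") (auto simp: nerve_EG_def nerve_B_com_def nerve_BG_def)
qed

lemma nerve_B_com_simps:
  "face (nerve_B_com G) = face (nerve_BG G)" "degen (nerve_B_com G) = degen (nerve_BG G)"
  by (simp_all add: nerve_B_com_def)

lemma simplicial_bundle_map: "simplicial_map (nerve_EG G) (nerve_BG G) (bundle_map G)"
  unfolding simplicial_map_def
proof (intro conjI allI ballI impI)
  fix n x assume "x \<in> simplices (nerve_EG G) n"
  then show "bundle_map G x \<in> simplices (nerve_BG G) n"
    by (auto simp: nerve_EG_def nerve_BG_def bundle_map_def subset_iff)
qed (use bundle_face[OF is_group] bundle_degen[OF is_group] in auto)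

lemma simplicial_bundle_map_com: "simplicial_map X_com (nerve_B_com G) (bundle_map G)"
  using simplicial_bundle_map unfolding simplicial_map_def nerve_B_com_simps
  by (auto simp: X_com_simplices nerve_EG_def simp del: sequence_complex_simps(1))

lemma simplicial_inclusion_com: "simplicial_map X_com (nerve_EG G) id"
  unfolding simplicial_map_def
  by (auto simp: nerve_EG_eq commuting_differences_def)

lemma simplicial_inclusion_BG: "simplicial_map (nerve_B_com G) (nerve_BG G) id"
  unfolding simplicial_map_def nerve_B_com_simps by (auto simp: nerve_B_com_def)

text \<open>A lift of a simplex of \<open>BG\<close> to \<open>EG\<close> with prescribed first vertex.\<close>

fun partial_products :: "'a \<Rightarrow> 'a list \<Rightarrow> 'a list" where
  "partial_products a [] = [a]"
| "partial_products a (x # xs) = a # partial_products (a \<otimes> x) xs"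

lemma partial_products:
  assumes "a \<in> carrier G" "set h \<subseteq> carrier G"
  shows "length (partial_products a h) = Suc (length h)" "set (partial_products a h) \<subseteq> carrier G"
    "bundle_map G (partial_products a h) = h"
proof -
  have "length (partial_products a h) = Suc (length h) \<and> set (partial_products a h) \<subseteq> carrier G \<and>
      bundle_map G (partial_products a h) = h"
    using assms
  proof (induction h arbitrary: a)
    case (Cons x h)
    have "partial_products (a \<otimes> x) h = (a \<otimes> x) # tl (partial_products (a \<otimes> x) h)"
      by (cases h) auto
    then have "bundle_map G (partial_products a (x # h)) = (inv a \<otimes> (a \<otimes> x)) # bundle_map G (partial_products (a \<otimes> x) h)"
      using bundle_map_Cons by (metis partial_products.simps(2))
    then show ?case using Cons by (simp flip: m_assoc)
  qed simp
  then show "length (partial_products a h) = Suc (length h)" "set (partial_products a h) \<subseteq> carrier G"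
    "bundle_map G (partial_products a h) = h" by auto
qed

lemma bundle_map_eq_imp_translate:
  assumes "length l = length l'" "set (x # l) \<subseteq> carrier G" "set (x' # l') \<subseteq> carrier G"
    "bundle_map G (x # l) = bundle_map G (x' # l')"
  shows "x' # l' = map (\<lambda>y. x' \<otimes> inv x \<otimes> y) (x # l)"
  using assms
proof (induction l l' arbitrary: x x' rule: list_induct2)
  case Nil
  then show ?case by (simp add: m_assoc)
next
  case (Cons y l y' l')
  have c: "x \<in> carrier G" "y \<in> carrier G" "x' \<in> carrier G" "y' \<in> carrier G" using Cons.prems by auto
  have e: "inv x \<otimes> y = inv x' \<otimes> y'" and b: "bundle_map G (y # l) = bundle_map G (y' # l')"
    using Cons.prems(3) by (simp_all add: bundle_map_Cons)
  have y': "y' = x' \<otimes> inv x \<otimes> y"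
    using c e by (metis inv_closed inv_solve_left m_assoc m_closed)
  then have "y' \<otimes> inv y = x' \<otimes> inv x" using c by (simp add: m_assoc)
  moreover have "y' # l' = map (\<lambda>z. y' \<otimes> inv y \<otimes> z) (y # l)"
    using Cons.IH[of y y'] Cons.prems b by simp
  moreover have "x' = x' \<otimes> inv x \<otimes> x" using c by (simp add: m_assoc)
  ultimately show ?case by simp
qed

lemma bundle_map_translate:
  assumes "a \<in> carrier G" "set g \<subseteq> carrier G"
  shows "bundle_map G (map (\<lambda>y. a \<otimes> y) g) = bundle_map G g"
  unfolding bundle_map_def
proof (intro map_cong)
  fix i assume "i \<in> set [0..<length g - 1]"
  then have "g ! i \<in> carrier G" "g ! Suc i \<in> carrier G" "i < length g" "Suc i < length g"
    using assms(2) by (auto simp: subset_iff)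
  then show "inv (map ((\<otimes>) a) g ! i) \<otimes> map ((\<otimes>) a) g ! Suc i = inv (g ! i) \<otimes> g ! Suc i"
    using assms(1) by (simp add: inv_mult_group m_assoc) (simp flip: m_assoc)
qed simp

text \<open>Unique path lifting along \<open>EG \<rightarrow> BG\<close>: the lifts of a simplex form one orbit of left
  translations, so a lift of one end of an identification can be moved to the other end.\<close>

definition lift_of :: "nat \<times> 'a list \<times> (nat \<Rightarrow> real) \<Rightarrow> 'a list \<Rightarrow> bool" where
  "lift_of p g \<longleftrightarrow> g \<in> simplices (nerve_EG G) (fst p) \<and> bundle_map G g = fst (snd p)"

definition lift_weighted :: "nat \<times> 'a list \<times> (nat \<Rightarrow> real) \<Rightarrow> 'a list \<Rightarrow> ('a \<times> real) list" where
  "lift_weighted p g = reduce (weighted (fst p, g, snd (snd p)))"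

text \<open>Here \<open>F\<close> and \<open>H\<close> are corresponding face or degeneracy operators of \<open>EG\<close> and \<open>BG\<close>.  Any lift of
  \<open>h\<close> is mapped by \<open>F\<close> to a lift of \<open>H h\<close>, and a left translation moves that lift to \<open>g'\<close>.\<close>

lemma lift_operation:
  assumes h: "h \<in> simplices (nerve_BG G) n"
    and op: "\<And>g f. F (map f g) = map f (F g)"
    and opS: "\<And>g. g \<in> simplices (nerve_EG G) n \<Longrightarrow> F g \<in> simplices (nerve_EG G) m"
    and opB: "\<And>g. g \<in> simplices (nerve_EG G) n \<Longrightarrow> bundle_map G (F g) = H (bundle_map G g)"
    and g': "g' \<in> simplices (nerve_EG G) m" "bundle_map G g' = H h"
  obtains g where "g \<in> simplices (nerve_EG G) n" "bundle_map G g = h" "F g = g'"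
proof -
  define g0 where "g0 = partial_products \<one> h"
  have g0: "g0 \<in> simplices (nerve_EG G) n" "bundle_map G g0 = h"
    using h partial_products[of \<one> h] by (auto simp: g0_def nerve_BG_def nerve_EG_def)
  have F: "F g0 \<in> simplices (nerve_EG G) m" "bundle_map G (F g0) = bundle_map G g'"
    using opS[OF g0(1)] opB[OF g0(1)] g0(2) g'(2) by simp_all
  obtain x l x' l' where xl: "F g0 = x # l" "g' = x' # l'"
    using F(1) g'(1) by (cases "F g0"; cases g') (auto simp: nerve_EG_def)
  define a where "a = x' \<otimes> inv x"
  have a: "a \<in> carrier G" "g' = map (\<lambda>y. a \<otimes> y) (F g0)"
    using bundle_map_eq_imp_translate[of l l' x x'] F g'(1) unfolding xl a_def
    by (auto simp: nerve_EG_def)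
  show ?thesis
  proof
    show "map (\<lambda>y. a \<otimes> y) g0 \<in> simplices (nerve_EG G) n"
      using g0(1) a(1) by (auto simp: nerve_EG_def subset_iff)
    show "bundle_map G (map (\<lambda>y. a \<otimes> y) g0) = h"
      using g0 a(1) by (subst bundle_map_translate) (auto simp: nerve_EG_def)
    show "F (map (\<lambda>y. a \<otimes> y) g0) = g'" using op a(2) by simp
  qed
qed

lemma EG_face: "g \<in> simplices (nerve_EG G) (Suc n) \<Longrightarrow> i \<le> Suc n \<Longrightarrow> face (nerve_EG G) (Suc n) i g \<in> simplices (nerve_EG G) n"
  by (auto simp: nerve_EG_def dest: in_set_takeD in_set_dropD)

lemma EG_degen: "g \<in> simplices (nerve_EG G) n \<Longrightarrow> i \<le> n \<Longrightarrow> degen (nerve_EG G) n i g \<in> simplices (nerve_EG G) (Suc n)"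
  by (auto simp: nerve_EG_def dest: in_set_takeD in_set_dropD)

lemma EG_rel_reduce: "realization_rel (nerve_EG G) p q \<Longrightarrow> reduce (weighted p) = reduce (weighted q)"
  using hereditary.realization_rel_reduce[OF hereditary_carrier] unfolding nerve_EG_eq by blast

lemma lift_step:
  assumes "realization_rel (nerve_BG G) p q"
  shows "lift_of p g \<Longrightarrow> \<exists>g'. lift_of q g' \<and> lift_weighted q g' = lift_weighted p g"
    and "lift_of q g' \<Longrightarrow> \<exists>g. lift_of p g \<and> lift_weighted p g = lift_weighted q g'"
proof -
  have "(lift_of p g \<longrightarrow> (\<exists>g'. lift_of q g' \<and> lift_weighted q g' = lift_weighted p g)) \<and>
     (lift_of q g' \<longrightarrow> (\<exists>g. lift_of p g \<and> lift_weighted p g = lift_weighted q g'))"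
    using assms
  proof cases
    case (face x n i t)
    have red: "lift_weighted p g = lift_weighted q (face (nerve_EG G) (Suc n) i g)"
      if "lift_of p g" for g
      unfolding lift_weighted_def using that face
      by (auto simp: lift_of_def intro!: EG_rel_reduce realization_rel.face)
    show ?thesis
    proof (intro conjI impI)
      assume "lift_of p g"
      then show "\<exists>g'. lift_of q g' \<and> lift_weighted q g' = lift_weighted p g"
        using red face EG_face bundle_face[OF is_group]
        by (intro exI[of _ "face (nerve_EG G) (Suc n) i g"]) (auto simp: lift_of_def)
    next
      assume q: "lift_of q g'"
      obtain g where "g \<in> simplices (nerve_EG G) (Suc n)" "bundle_map G g = x" "face (nerve_EG G) (Suc n) i g = g'"
        by (rule lift_operation[of x "Suc n" "face (nerve_EG G) (Suc n) i" n "face (nerve_BG G) (Suc n) i" g'])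
          (use face q EG_face bundle_face[OF is_group] in \<open>auto simp: lift_of_def nerve_EG_eq take_map drop_map\<close>)
      then show "\<exists>g. lift_of p g \<and> lift_weighted p g = lift_weighted q g'"
        using red face by (auto simp: lift_of_def)
    qed
  next
    case (degen x n i t)
    have red: "lift_weighted p g = lift_weighted q (degen (nerve_EG G) n i g)"
      if "lift_of p g" for g
      unfolding lift_weighted_def using that degen
      by (auto simp: lift_of_def intro!: EG_rel_reduce realization_rel.degen)
    show ?thesis
    proof (intro conjI impI)
      assume "lift_of p g"
      then show "\<exists>g'. lift_of q g' \<and> lift_weighted q g' = lift_weighted p g"
        using red degen EG_degen bundle_degen[OF is_group]
        by (intro exI[of _ "degen (nerve_EG G) n i g"]) (auto simp: lift_of_def)
    next
      assume q: "lift_of q g'"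
      obtain g where "g \<in> simplices (nerve_EG G) n" "bundle_map G g = x" "degen (nerve_EG G) n i g = g'"
        by (rule lift_operation[of x n "degen (nerve_EG G) n i" "Suc n" "degen (nerve_BG G) n i" g'])
          (use degen q EG_degen bundle_degen[OF is_group] in \<open>auto simp: lift_of_def nerve_EG_eq take_map drop_map\<close>)
      then show "\<exists>g. lift_of p g \<and> lift_weighted p g = lift_weighted q g'"
        using red degen by (auto simp: lift_of_def)
    qed
  qed
  then show "lift_of p g \<Longrightarrow> \<exists>g'. lift_of q g' \<and> lift_weighted q g' = lift_weighted p g"
    and "lift_of q g' \<Longrightarrow> \<exists>g. lift_of p g \<and> lift_weighted p g = lift_weighted q g'" by auto
qed

lemma lift_equivclp:
  assumes "equivclp (realization_rel (nerve_BG G)) p q" "lift_of p g"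
  shows "\<exists>g'. lift_of q g' \<and> lift_weighted q g' = lift_weighted p g"
  using assms(1)
proof (induction rule: equivclp_induct)
  case base
  then show ?case using assms(2) by blast
next
  case (step y z)
  then obtain gy where gy: "lift_of y gy" "lift_weighted y gy = lift_weighted p g" by blast
  from step(2) show ?case
    using lift_step[of y z] lift_step[of z y] gy by metis
qed

lemma pt_inclusion:
  assumes "valid (commuting_differences G) l"
  shows "realization_map (nerve_EG G) id (pt (commuting_differences G) l) = pt (\<lambda>S. S \<subseteq> carrier G) l"
  using realization_map_class[OF simplicial_inclusion_com, of "fst (triple l)" "fst (snd (triple l))" "snd (snd (triple l))"]
  by (simp add: pt_def nerve_EG_eq)

lemma valid_com_carrier: "valid (commuting_differences G) l \<Longrightarrow> valid (\<lambda>S. S \<subseteq> carrier G) l"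
  by (auto simp: valid_def commuting_differences_def)

lemma inj_on_inclusion_com:
  "inj_on (realization_map (nerve_EG G) id) (topspace (realization X_com))"
proof (rule inj_onI)
  fix z z' assume "z \<in> topspace (realization X_com)" "z' \<in> topspace (realization X_com)"
    and e: "realization_map (nerve_EG G) id z = realization_map (nerve_EG G) id z'"
  then obtain l l' where l: "valid (commuting_differences G) l" "z = pt (commuting_differences G) l"
      "valid (commuting_differences G) l'" "z' = pt (commuting_differences G) l'"
    unfolding topspace_realization_pt by blast
  then have "reduce l = reduce l'"
    using e hereditary.pt_eq_iff[OF hereditary_carrier valid_com_carrier valid_com_carrier, of l l']
    by (simp add: pt_inclusion)
  then show "z = z'"
    using l hereditary.pt_eq_iff[OF hereditary_commuting_differences] by metis
qed

text \<open>Inside a simplex \<open>g\<close> of \<open>EG\<close> one tests finitely many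
  faces, and a face with vertex positions \<open>S\<close> is recovered in the same dimension by overwriting
  the vertices outside \<open>S\<close>, whose weight is zero, with a vertex from \<open>S\<close>.\<close>

lemma closed_map_inclusion_com:
  "closed_map (realization X_com) (realization (nerve_EG G)) (realization_map (nerve_EG G) id)"
  unfolding closed_map_def
proof (intro allI impI)
  fix C assume C: "closedin (realization X_com) C"
  let ?K = "commuting_differences G" and ?E = "\<lambda>S. S \<subseteq> carrier G"
  let ?j = "realization_map (nerve_EG G) id"
  have Ct: "C \<subseteq> topspace (realization X_com)" using C by (rule closedin_subset)
  show "closedin (realization (nerve_EG G)) (?j ` C)"
    unfolding closedin_realization
  proof (intro conjI allI ballI)
    show "?j ` C \<subseteq> topspace (realization (nerve_EG G))"
      using Ct continuous_map_image_subset_topspace[OF continuous_map_realization_map[OF simplicial_inclusion_com]]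
      by blast
    fix n g assume g: "g \<in> simplices (nerve_EG G) n"
    then have gl: "length g = Suc n" "set g \<subseteq> carrier G" by (auto simp: nerve_EG_def)
    define over where "over S = map (\<lambda>i. if i \<in> S then g ! i else g ! (SOME i. i \<in> S)) [0..<Suc n]" for S
    define FS where "FS = {S. S \<subseteq> {..n} \<and> S \<noteq> {} \<and> ?K (set (over S))}"
    define A where "A S = {t \<in> standard_simplex n. \<forall>i\<in>{..n} - S. t i = 0} \<inter>
       {t \<in> standard_simplex n. quotient_class (realization_rel X_com) (n, over S, t) \<in> C}" for S
    have lo: "length (over S) = Suc n" for S by (simp add: over_def)
    have red: "reduce (weigh g t) = reduce (weigh (over S) t)" if "\<forall>i\<in>{..n} - S. t i = 0" for S t
    proof (rule reduce_weigh_overwrite)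
      fix i assume "i < length g" "t i \<noteq> 0"
      then have "i \<in> S" "i < Suc n" using that gl by auto
      then show "g ! i = over S ! i" by (simp add: over_def del: upt_Suc)
    qed (simp add: gl lo)
    have vg: "valid ?E (weigh g t)" "quotient_class (realization_rel (nerve_EG G)) (n, g, t) = pt ?E (weigh g t)"
      if "t \<in> standard_simplex n" for t
    proof -
      have "g \<noteq> []" using gl by auto
      then show "valid ?E (weigh g t)" using that gl by (intro valid_weigh) auto
      show "quotient_class (realization_rel (nerve_EG G)) (n, g, t) = pt ?E (weigh g t)"
        using that gl unfolding nerve_EG_eq by (intro pt_weigh[symmetric]) auto
    qed
    have vo: "valid ?K (weigh (over S) t)" "quotient_class (realization_rel X_com) (n, over S, t) = pt ?K (weigh (over S) t)"
      if "t \<in> standard_simplex n" "S \<in> FS" for S t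
    proof -
      have "over S \<noteq> []" using lo[of S] by auto
      then show "valid ?K (weigh (over S) t)"
        using that lo[of S] by (intro valid_weigh) (auto simp: FS_def)
      show "quotient_class (realization_rel X_com) (n, over S, t) = pt ?K (weigh (over S) t)"
        using that lo[of S] by (intro pt_weigh[symmetric]) (auto simp: FS_def)
    qed
    have eq: "?j (pt ?K (weigh (over S) t)) = pt ?E (weigh g t)"
      if "t \<in> standard_simplex n" "S \<in> FS" "\<forall>i\<in>{..n} - S. t i = 0" for S t
      using pt_inclusion[OF vo(1)[OF that(1,2)]] red[OF that(3)]
        hereditary.pt_eq_iff[OF hereditary_carrier valid_com_carrier[OF vo(1)[OF that(1,2)]] vg(1)[OF that(1)]] by simp
    have "{t \<in> standard_simplex n. quotient_class (realization_rel (nerve_EG G)) (n, g, t) \<in> ?j ` C} = (\<Union>S\<in>FS. A S)"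
    proof (intro subset_antisym subsetI)
      fix t assume "t \<in> {t \<in> standard_simplex n. quotient_class (realization_rel (nerve_EG G)) (n, g, t) \<in> ?j ` C}"
      then obtain c where t: "t \<in> standard_simplex n" and c: "c \<in> C" "pt ?E (weigh g t) = ?j c"
        using vg by auto
      then obtain l where l: "valid ?K l" "c = pt ?K l"
        using Ct unfolding topspace_realization_pt by blast
      have r: "reduce (weigh g t) = reduce l"
        using hereditary.pt_eq_iff[OF hereditary_carrier vg(1)[OF t] valid_com_carrier[OF l(1)]] c l pt_inclusion by simp
      define S where "S = {i \<in> {..n}. t i \<noteq> 0}"
      have tpos: "0 \<le> t i" for i using t by (simp add: standard_simplex_def)
      have supp: "g ! i \<in> fst ` set l" if "i \<in> S" for i
      proof -
        have "(g ! i, t i) \<in> {p \<in> set (weigh g t). 0 < snd p}"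
          using that gl tpos[of i] by (auto simp: S_def weigh_def in_set_zip intro!: exI[of _ i] simp del: upt_Suc)
        then have "g ! i \<in> fst ` {p \<in> set (weigh g t). 0 < snd p}"
          by (metis (no_types, lifting) fst_conv image_eqI)
        also have "\<dots> = fst ` set (reduce l)"
          using set_reduce[of "weigh g t"] vg(1)[OF t] r by (simp add: valid_def)
        also have "\<dots> \<subseteq> fst ` set l"
          using set_reduce[of l] l(1) by (auto simp: valid_def)
        finally show ?thesis .
      qed
      have "S \<noteq> {}"
      proof
        assume "S = {}"
        then have "sum t {..n} = 0" by (intro sum.neutral) (auto simp: S_def)
        then show False using t by (simp add: standard_simplex_def)
      qed
      then have "(SOME i. i \<in> S) \<in> S" by (rule some_in_eq[THEN iffD2])
      then have "set (over S) \<subseteq> fst ` set l" using supp by (auto simp: over_def simp del: upt_Suc)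
      moreover have "set (over S) \<noteq> {}" by (simp add: over_def)
      moreover have "?K (fst ` set l)" using l by (simp add: valid_def)
      ultimately have "?K (set (over S))"
        using hereditary.hereditary[OF hereditary_commuting_differences] by metis
      then have S: "S \<in> FS" using \<open>S \<noteq> {}\<close> by (auto simp: FS_def S_def)
      have z: "\<forall>i\<in>{..n} - S. t i = 0" by (auto simp: S_def)
      have "reduce (weigh (over S) t) = reduce l" using red[OF z] r by simp
      then have "pt ?K (weigh (over S) t) = c"
        using hereditary.pt_eq_iff[OF hereditary_commuting_differences vo(1)[OF t S] l(1)] l(2) by simp
      then show "t \<in> (\<Union>S\<in>FS. A S)" using S t z vo(2)[OF t S] c(1) by (auto simp: A_def)
    next
      fix t assume "t \<in> (\<Union>S\<in>FS. A S)"
      then obtain S where "S \<in> FS" "t \<in> standard_simplex n" "\<forall>i\<in>{..n} - S. t i = 0" "pt ?K (weigh (over S) t) \<in> C"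
        using vo by (auto simp: A_def)
      then show "t \<in> {t \<in> standard_simplex n. quotient_class (realization_rel (nerve_EG G)) (n, g, t) \<in> ?j ` C}"
        using eq[of t S] vg(2)[of t] by (metis (mono_tags, lifting) image_eqI mem_Collect_eq)
    qed
    moreover have "closedin (simplex_space n) (A S)" if "S \<in> FS" for S
      unfolding A_def
    proof (rule closedin_Int)
      have "{t \<in> standard_simplex n. \<forall>i\<in>{..n} - S. t i = 0} =
          \<Inter> (insert (topspace (simplex_space n)) ((\<lambda>i. {t \<in> topspace (simplex_space n). t i \<in> {0}}) ` ({..n} - S)))"
        by auto
      moreover have c: "closedin (simplex_space n) {t \<in> topspace (simplex_space n). t i \<in> {0}}" for i
        by (rule closedin_continuous_map_preimage[where Y = euclideanreal])
          (auto intro: continuous_map_from_subtopology continuous_map_product_projection)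
      ultimately show "closedin (simplex_space n) {t \<in> standard_simplex n. \<forall>i\<in>{..n} - S. t i = 0}"
        by (simp only:) (rule closedin_Inter, use c in blast, use c in blast)
      show "closedin (simplex_space n) {t \<in> standard_simplex n. quotient_class (realization_rel X_com) (n, over S, t) \<in> C}"
        using C that lo[of S] unfolding closedin_realization by (simp add: FS_def)
    qed
    moreover have "finite FS" by (rule finite_subset[of _ "Pow {..n}"]) (auto simp: FS_def)
    ultimately show "closedin (simplex_space n) {t \<in> standard_simplex n. quotient_class (realization_rel (nerve_EG G)) (n, g, t) \<in> ?j ` C}"
      by (auto intro!: closedin_Union)
  qed
qed

text \<open>The inclusion into \<open>EG\<close> is injective because points of both spaces have the same normal forms,
  and it is closed; hence so is the map to the fibre product.  It is onto: if \<open>b\<close> and \<open>e\<close> have the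
  same image in \<open>BG\<close>, then lifting the identifications between representatives of these images turns
  the representative of \<open>e\<close> into one that lies over the representative of \<open>b\<close>.\<close>

theorem E_com_homeomorphic: "realization X_com homeomorphic_space E_com G"
proof -
  let ?X = "realization X_com" and ?B = "realization (nerve_B_com G)" and ?E = "realization (nerve_EG G)"
  let ?K = "commuting_differences G" and ?C = "\<lambda>S. S \<subseteq> carrier G"
  let ?b = "realization_map (nerve_B_com G) (bundle_map G)" and ?j = "realization_map (nerve_EG G) id"
  let ?P = "{(x, y). realization_map (nerve_BG G) id x = realization_map (nerve_BG G) (bundle_map G) y}"
  define F where "F z = (?b z, ?j z)" for z
  have E: "E_com G = subtopology (prod_topology ?B ?E) ?P"
    by (simp add: E_com_def fibre_product_def B_com_def)
  have topE: "topspace (E_com G) = (topspace ?B \<times> topspace ?E) \<inter> ?P"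
    by (simp add: E)
  have Fcl: "F (quotient_class (realization_rel X_com) (n, g, t)) =
     (quotient_class (realization_rel (nerve_B_com G)) (n, bundle_map G g, t), quotient_class (realization_rel (nerve_EG G)) (n, g, t))"
    for n g t
    unfolding F_def by (simp add: realization_map_class[OF simplicial_bundle_map_com] realization_map_class[OF simplicial_inclusion_com])
  have FP: "F z \<in> ?P" if z: "z \<in> topspace ?X" for z
  proof -
    obtain n g t where "z = quotient_class (realization_rel X_com) (n, g, t)"
      using z unfolding topspace_realization by blast
    then show ?thesis
      by (simp add: Fcl realization_map_class[OF simplicial_inclusion_BG] realization_map_class[OF simplicial_bundle_map])
  qed
  have cont: "continuous_map ?X (E_com G) F"
    unfolding E continuous_map_in_subtopology
    using FP continuous_map_realization_map[OF simplicial_bundle_map_com] continuous_map_realization_map[OF simplicial_inclusion_com]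
    by (auto simp: continuous_map_pairwise o_def F_def)
  have inj: "inj_on F (topspace ?X)"
    using inj_on_inclusion_com by (auto simp: inj_on_def F_def)
  have surj: "F ` topspace ?X = topspace (E_com G)"
  proof
    show "F ` topspace ?X \<subseteq> topspace (E_com G)" using continuous_map_image_subset_topspace[OF cont] .
    show "topspace (E_com G) \<subseteq> F ` topspace ?X"
    proof
      fix y assume y: "y \<in> topspace (E_com G)"
      obtain b e where be: "y = (b, e)" "b \<in> topspace ?B" "e \<in> topspace ?E" "(b, e) \<in> ?P"
        using y unfolding topE by (cases y) blast
      obtain m h s where b: "b = quotient_class (realization_rel (nerve_B_com G)) (m, h, s)"
          "h \<in> simplices (nerve_B_com G) m" "s \<in> standard_simplex m"
        using be(2) unfolding topspace_realization by blast
      obtain n g t where e: "e = quotient_class (realization_rel (nerve_EG G)) (n, g, t)"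
          "g \<in> simplices (nerve_EG G) n" "t \<in> standard_simplex n"
        using be(3) unfolding topspace_realization by blast
      have "equivclp (realization_rel (nerve_BG G)) (n, bundle_map G g, t) (m, h, s)"
        using be(4) unfolding b(1) e(1)
        by (simp add: realization_map_class[OF simplicial_inclusion_BG] realization_map_class[OF simplicial_bundle_map]
            quotient_class_eq_iff equivclp_sym)
      moreover have "lift_of (n, bundle_map G g, t) g" using e by (simp add: lift_of_def)
      ultimately obtain g' where "lift_of (m, h, s) g'" "lift_weighted (m, h, s) g' = lift_weighted (n, bundle_map G g, t) g"
        using lift_equivclp by blast
      then have g': "g' \<in> simplices (nerve_EG G) m" "bundle_map G g' = h" "reduce (weighted (m, g', s)) = reduce (weighted (n, g, t))"
        by (auto simp: lift_of_def lift_weighted_def)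
      have X: "g' \<in> simplices X_com m" unfolding X_com_simplices using g' b by simp
      have "pt ?C (weighted (m, g', s)) = pt ?C (weighted (n, g, t))"
        using g' e b hereditary.pt_eq_iff[OF hereditary_carrier] weighted_valid(1)[of g' ?C m s] weighted_valid(1)[of g ?C n t]
        unfolding nerve_EG_eq by blast
      then have "quotient_class (realization_rel (nerve_EG G)) (m, g', s) = e"
        using g' e b weighted_valid(2)[of g' ?C m s] weighted_valid(2)[of g ?C n t]
        unfolding nerve_EG_eq pt_def by simp
      then have "F (quotient_class (realization_rel X_com) (m, g', s)) = y"
        unfolding Fcl g'(2) be(1) b(1) by simp
      moreover have "quotient_class (realization_rel X_com) (m, g', s) \<in> topspace ?X"
        using X b(3) by (rule class_in_realization)
      ultimately show "y \<in> F ` topspace ?X" by blast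
    qed
  qed
  have closed: "closed_map ?X (E_com G) F"
    unfolding closed_map_def
  proof (intro allI impI)
    fix C assume C: "closedin ?X C"
    have jC: "closedin ?E (?j ` C)" using closed_map_inclusion_com C by (simp add: closed_map_def)
    have Ct: "C \<subseteq> topspace ?X" using C by (rule closedin_subset)
    have "F ` C = {y \<in> topspace (E_com G). snd y \<in> ?j ` C}"
    proof (intro subset_antisym subsetI)
      fix y assume "y \<in> F ` C"
      then show "y \<in> {y \<in> topspace (E_com G). snd y \<in> ?j ` C}"
        using Ct surj by (auto simp: F_def)
    next
      fix y assume "y \<in> {y \<in> topspace (E_com G). snd y \<in> ?j ` C}"
      then have "y \<in> F ` topspace ?X" "snd y \<in> ?j ` C" using surj by auto
      then obtain z c where z: "z \<in> topspace ?X" "y = F z" "c \<in> C" "?j z = ?j c" by (auto simp: F_def)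
      then have "z = c" using inj_on_inclusion_com Ct by (meson inj_onD subsetD)
      then show "y \<in> F ` C" using z by blast
    qed
    moreover have "continuous_map (E_com G) ?E snd"
      unfolding E by (intro continuous_map_from_subtopology continuous_map_snd)
    ultimately show "closedin (E_com G) (F ` C)"
      using closedin_continuous_map_preimage jC by fastforce
  qed
  show ?thesis
    using bijective_closed_imp_homeomorphic_map[OF cont closed surj inj] by (rule homeomorphic_map_imp_homeomorphic_space)
qed

end

section \<open>Linear spaces and their clique complexes\<close>

text \<open>The points are the fibres of \<open>rep\<close>, with \<open>rep x\<close> as the chosen representative of the point of
  \<open>x\<close>, and any two different points lie on exactly one line.  Keeping all vertices \<open>x\<close>, instead of
  passing to the points, allows a complex on a group to be treated without first dividing by the centre.\<close>

locale linear_space =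
  fixes lines :: "'v set set" and rep :: "'v \<Rightarrow> 'v" and origin :: 'v
  assumes rep_line: "L \<in> lines \<Longrightarrow> x \<in> L \<Longrightarrow> rep x \<in> L"
    and rep_rep: "rep (rep x) = rep x"
    and line_through: "x \<in> \<Union>lines \<Longrightarrow> y \<in> \<Union>lines \<Longrightarrow> \<exists>L\<in>lines. x \<in> L \<and> y \<in> L"
    and lines_meet: "L \<in> lines \<Longrightarrow> L' \<in> lines \<Longrightarrow> x \<in> L \<Longrightarrow> y \<in> L \<Longrightarrow> x \<in> L' \<Longrightarrow> y \<in> L' \<Longrightarrow> rep x \<noteq> rep y \<Longrightarrow> L = L'"
    and origin: "origin \<in> \<Union>lines" "rep origin = origin"
begin

definition collinear :: "'v set \<Rightarrow> bool" where
  "collinear S \<longleftrightarrow> (\<exists>L\<in>lines. S \<subseteq> L)"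

sublocale hereditary collinear
  by unfold_locales (meson collinear_def subset_trans)

abbreviation cliques :: "'v list simplicial_set" where
  "cliques \<equiv> sequence_complex collinear"

text \<open>By \<open>lines_meet\<close>, a choice only if all elements of \<open>S\<close> represent the same point.\<close>

definition line_of :: "'v set \<Rightarrow> 'v set" where
  "line_of S = (SOME L. L \<in> lines \<and> S \<subseteq> L)"

lemma line_of: "collinear S \<Longrightarrow> line_of S \<in> lines" "collinear S \<Longrightarrow> S \<subseteq> line_of S"
proof -
  assume "collinear S"
  then have "\<exists>L. L \<in> lines \<and> S \<subseteq> L" by (auto simp: collinear_def)
  from someI_ex[OF this] show "line_of S \<in> lines" "S \<subseteq> line_of S" by (auto simp: line_of_def)
qed

lemma line_of_eq:
  assumes "L \<in> lines" "S \<subseteq> L" "x \<in> S" "y \<in> S" "rep x \<noteq> rep y"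
  shows "line_of S = L"
proof -
  have "collinear S" using assms by (auto simp: collinear_def)
  then show ?thesis using line_of[of S] lines_meet[of "line_of S" L x y] assms by blast
qed

text \<open>The centre of the star that replaces the line.  Since lines through \<open>origin\<close> have centre
  \<open>origin\<close>, their stars together form one star, a spanning tree of the resulting graph.\<close>

definition base :: "'v set \<Rightarrow> 'v" where
  "base L = (if origin \<in> L then origin else SOME p. p \<in> rep ` L)"

lemma base:
  assumes "L \<in> lines" "x \<in> L"
  shows "base L \<in> L" "rep (base L) = base L" "base L \<in> rep ` L"
proof -
  have "(SOME p. p \<in> rep ` L) \<in> rep ` L" using assms(2) by (intro someI_ex[of "\<lambda>p. p \<in> rep ` L"]) blast
  then have "base L \<in> rep ` L"
  proof (cases "origin \<in> L")
    case True
    then show ?thesis using origin(2) by (simp add: base_def image_iff) metis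
  qed (simp add: base_def)
  then show "base L \<in> L" "rep (base L) = base L" "base L \<in> rep ` L"
    using rep_line[OF assms(1)] rep_rep by auto
qed

lemma rep_image: "L \<in> lines \<Longrightarrow> p \<in> rep ` L \<Longrightarrow> p \<in> L \<and> rep p = p"
  using rep_line rep_rep by auto

definition mass :: "('v \<times> real) list \<Rightarrow> 'v \<Rightarrow> real" where
  "mass l p = (\<Sum>x\<leftarrow>l. if rep (fst x) = p then snd x else 0)"

lemma mass_simps [simp]:
  "mass [] p = 0"
  "mass (x # l) p = (if rep (fst x) = p then snd x else 0) + mass l p"
  "mass (l @ l') p = mass l p + mass l' p"
  by (simp_all add: mass_def)

lemma mass_bounds:
  assumes "\<forall>x\<in>set l. 0 \<le> snd x"
  shows "0 \<le> mass l p" "mass l p \<le> sum_list (map snd l)"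
    "p \<noteq> p' \<Longrightarrow> mass l p + mass l p' \<le> sum_list (map snd l)"
    "\<forall>x\<in>set l. rep (fst x) = p \<Longrightarrow> mass l p = sum_list (map snd l)"
    "p \<notin> rep ` fst ` set l \<Longrightarrow> mass l p = 0"
  using assms by (induction l) auto

lemma valid_mass:
  assumes "valid collinear l"
  shows "0 \<le> mass l p" "mass l p \<le> 1" "p \<noteq> p' \<Longrightarrow> mass l p + mass l p' \<le> 1"
    "\<forall>x\<in>set l. rep (fst x) = p \<Longrightarrow> mass l p = 1"
    "p \<notin> rep ` fst ` set l \<Longrightarrow> mass l p = 0"
  using assms mass_bounds[of l] unfolding valid_def by auto

text \<open>Up to homotopy, a line \<open>L\<close> is a star with a ray \<open>(L, p)\<close> for each of its points \<open>p\<close>, and these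
  stars are glued to a graph along their tips.  A list with more than half of its mass at \<open>p\<close> lies on the
  ray to the tip \<open>p\<close>, any other list at the centre; so a function on the rays \<open>(L, p)\<close>, with
  parameter in \<open>[0, 1]\<close>, that fits together at the ends induces a function on lists.\<close>

definition compatible :: "('v set \<Rightarrow> 'v \<Rightarrow> real \<Rightarrow> 'y) \<Rightarrow> bool" where
  "compatible \<Phi> \<longleftrightarrow> (\<forall>L\<in>lines. \<forall>p\<in>rep ` L. \<Phi> L p 0 = \<Phi> L (base L) 0 \<and>
     (\<forall>L'\<in>lines. p \<in> rep ` L' \<longrightarrow> \<Phi> L p 1 = \<Phi> L' p 1))"

definition spread :: "('v set \<Rightarrow> 'v \<Rightarrow> real \<Rightarrow> 'y) \<Rightarrow> ('v \<times> real) list \<Rightarrow> 'y" where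
  "spread \<Phi> l = (let L = line_of (fst ` set l) in
     if \<exists>p. mass l p > 1/2 then (let p = THE p. mass l p > 1/2 in \<Phi> L p (2 * mass l p - 1))
     else \<Phi> L (base L) 0)"

lemma spread_centre:
  "(\<And>p. mass l p \<le> 1/2) \<Longrightarrow> spread \<Phi> l = \<Phi> (line_of (fst ` set l)) (base (line_of (fst ` set l))) 0"
proof -
  assume "\<And>p. mass l p \<le> 1/2"
  then have "\<not> (\<exists>p. mass l p > 1/2)" by (simp add: not_less)
  then show ?thesis unfolding spread_def Let_def by (rule if_not_P)
qed

lemma spread_ray:
  assumes "compatible \<Phi>" "valid collinear l" "mass l p \<ge> 1/2"
  shows "spread \<Phi> l = \<Phi> (line_of (fst ` set l)) p (2 * mass l p - 1)"
proof -
  let ?L = "line_of (fst ` set l)"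
  have other: "mass l p' \<le> 1/2" if "p' \<noteq> p" for p'
    using valid_mass(3)[OF assms(2) that] assms(3) by simp
  show ?thesis
  proof (cases "mass l p = 1/2")
    case True
    then have "\<And>p'. mass l p' \<le> 1/2" using other by (metis order_refl)
    then have "spread \<Phi> l = \<Phi> ?L (base ?L) 0" by (rule spread_centre)
    moreover have "p \<in> rep ` ?L"
      using valid_mass(5)[OF assms(2), of p] True line_of(2)[of "fst ` set l"] assms(2)
      by (auto simp: valid_def)
    then have "\<Phi> ?L p 0 = \<Phi> ?L (base ?L) 0"
      using assms(1,2) line_of(1)[of "fst ` set l"] unfolding compatible_def valid_def by blast
    moreover have "2 * mass l p - 1 = 0" using True by simp
    ultimately show ?thesis by simp
  next
    case False
    then have "mass l p > 1/2" using assms(3) by simp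
    moreover from this have "(THE p. mass l p > 1/2) = p"
      using other by (intro the_equality) (auto simp: not_less[symmetric])
    ultimately show ?thesis by (auto simp: spread_def Let_def)
  qed
qed

lemma lines_differ:
  assumes "collinear S'" "S \<subseteq> S'" "line_of S \<noteq> line_of S'" "x \<in> S" "y \<in> S"
  shows "rep x = rep y"
  using line_of_eq[of "line_of S'" S x y] line_of[OF assms(1)] assms by blast

text \<open>Dropping an entry of weight zero affects \<open>line_of\<close> only if all remaining entries represent the same
  point \<open>p\<close>.  Then all mass is at \<open>p\<close>, and at the tip \<open>p\<close> the value does not depend on the line.\<close>

lemma move_invariant_spread:
  assumes "compatible \<Phi>"
  shows "move_invariant collinear (spread \<Phi>)"
  unfolding move_invariant_def
proof (intro conjI allI impI)
  fix xs x ys assume v: "valid collinear (xs @ (x, 0) # ys)"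
  let ?l = "xs @ (x, 0) # ys" and ?l' = "xs @ ys"
  have m: "mass ?l p = mass ?l' p" for p by simp
  have v': "valid collinear ?l'" by (rule valid_drop_zero[OF v])
  show "spread \<Phi> ?l = spread \<Phi> ?l'"
  proof (cases "line_of (fst ` set ?l) = line_of (fst ` set ?l')")
    case True
    then show ?thesis unfolding spread_def m by simp
  next
    case False
    obtain p where p: "\<forall>x\<in>set ?l'. rep (fst x) = p"
    proof -
      obtain y where y: "y \<in> set ?l'" using v' by (metis last_in_set valid_def)
      have "rep (fst z) = rep (fst y)" if "z \<in> set ?l'" for z
        using lines_differ[of "fst ` set ?l" "fst ` set ?l'" "fst z" "fst y"] False v y that by (auto simp: valid_def)
      then show ?thesis using that by blast
    qed
    then have m1: "mass ?l' p = 1" using valid_mass(4)[OF v'] by blast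
    have "last ?l' \<in> set ?l'" using v' by (intro last_in_set) (simp add: valid_def)
    then have "p \<in> rep ` fst ` set ?l'" using p by (intro image_eqI[of _ _ "fst (last ?l')"]) auto
    then have "p \<in> rep ` line_of (fst ` set ?l')" "p \<in> rep ` line_of (fst ` set ?l)"
    proof -
      have "fst ` set ?l' \<subseteq> line_of (fst ` set ?l')" "fst ` set ?l \<subseteq> line_of (fst ` set ?l)"
        using line_of(2) v v' unfolding valid_def by blast+
      moreover have "fst ` set ?l' \<subseteq> fst ` set ?l" by auto
      ultimately show "p \<in> rep ` line_of (fst ` set ?l')" "p \<in> rep ` line_of (fst ` set ?l)"
        using \<open>p \<in> rep ` fst ` set ?l'\<close> by (meson image_mono subsetD subset_trans)+
    qed
    then have "\<Phi> (line_of (fst ` set ?l)) p 1 = \<Phi> (line_of (fst ` set ?l')) p 1"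
      using assms line_of(1)[of "fst ` set ?l'"] line_of(1)[of "fst ` set ?l"] v v' unfolding compatible_def valid_def by blast
    moreover have ml: "mass ?l p = 1" using m m1 by (simp only:)
    have "spread \<Phi> ?l = \<Phi> (line_of (fst ` set ?l)) p 1"
      using spread_ray[OF assms v, of p] unfolding ml by simp
    moreover have "spread \<Phi> ?l' = \<Phi> (line_of (fst ` set ?l')) p 1"
      using spread_ray[OF assms v', of p] unfolding m1 by simp
    ultimately show ?thesis by (simp only:)
  qed
next
  fix xs x a b ys assume "valid collinear (xs @ (x, a) # (x, b) # ys)"
  have "mass (xs @ (x, a) # (x, b) # ys) p = mass (xs @ (x, a + b) # ys) p" for p by simp
  moreover have "fst ` set (xs @ (x, a) # (x, b) # ys) = fst ` set (xs @ (x, a + b) # ys)" by auto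
  ultimately show "spread \<Phi> (xs @ (x, a) # (x, b) # ys) = spread \<Phi> (xs @ (x, a + b) # ys)"
    unfolding spread_def by (simp only:)
qed

lemma mass_weigh: "mass (weigh g t) p = (\<Sum>i<length g. if rep (g ! i) = p then t i else 0)"
proof (induction g arbitrary: t)
  case (Cons x g)
  show ?case unfolding weigh_Cons mass_simps Cons.IH by (simp add: sum.lessThan_Suc_shift del: sum.lessThan_Suc)
qed (simp add: weigh_def)

lemma fst_weigh: "fst ` set (weigh g t) = set g"
  by (simp add: weigh_def flip: set_map)

lemma continuous_coordinate:
  "continuous_map (prod_topology (top_of_set {0..1::real}) (simplex_space n)) euclideanreal (\<lambda>z. snd z i)"
proof -
  have "continuous_map (simplex_space n) euclideanreal (\<lambda>t. t i)"
    by (intro continuous_map_from_subtopology continuous_map_product_projection) auto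
  from continuous_map_compose[OF continuous_map_snd this] show ?thesis by (simp add: o_def)
qed

lemma continuous_time:
  "continuous_map (prod_topology (top_of_set {0..1::real}) Y) euclideanreal fst"
  by (rule continuous_map_into_fulltopology[OF continuous_map_fst])

lemma continuous_mass:
  "continuous_map (prod_topology (top_of_set {0..1::real}) (simplex_space n)) euclideanreal (\<lambda>z. mass (weigh g (snd z)) p)"
  unfolding mass_weigh
  by (intro continuous_map_sum finite_lessThan) (auto intro: continuous_coordinate)

text \<open>A simplex is covered by finitely many closed sets: for each point \<open>p\<close> of \<open>g\<close> the lists with mass at
  least \<open>1/2\<close> at \<open>p\<close>, and the lists with mass at most \<open>1/2\<close> at every point.\<close>

lemma continuous_spread:
  assumes \<Phi>: "\<And>s. s \<in> {0..1} \<Longrightarrow> compatible (\<Phi> s)"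
    and cont: "\<And>L p. L \<in> lines \<Longrightarrow> p \<in> rep ` L \<Longrightarrow>
      continuous_map (prod_topology (top_of_set {0..1}) (top_of_set {0..1})) Y (\<lambda>z. \<Phi> (fst z) L p (snd z))"
    and g: "g \<noteq> []" "collinear (set g)"
  shows "continuous_map (prod_topology (top_of_set {0..1::real}) (simplex_space (length g - 1))) Y
     (\<lambda>(s, t). spread (\<Phi> s) (weigh g t))"
proof -
  let ?D = "prod_topology (top_of_set {0..1::real}) (simplex_space (length g - 1))"
  define L where "L = line_of (set g)"
  have L: "L \<in> lines" "set g \<subseteq> L" using line_of[OF g(2)] by (auto simp: L_def)
  have b: "base L \<in> rep ` L" using base(3)[OF L(1), of "hd g"] hd_in_set[OF g(1)] L(2) by blast
  let ?I = "insert None (Some ` rep ` set g)"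
  define T where "T i = (case i of None \<Rightarrow> {z \<in> topspace ?D. \<forall>p\<in>rep ` set g. mass (weigh g (snd z)) p \<in> {..1/2}}
      | Some p \<Rightarrow> {z \<in> topspace ?D. mass (weigh g (snd z)) p \<in> {1/2..}})" for i
  define f where "f i z = (case i of None \<Rightarrow> \<Phi> (fst z) L (base L) 0
      | Some p \<Rightarrow> \<Phi> (fst z) L p (max 0 (2 * mass (weigh g (snd z)) p - 1)))" for i z
  have v: "valid collinear (weigh g (snd z))" if "z \<in> topspace ?D" for z
    using that g by (intro valid_weigh) auto
  have line: "line_of (fst ` set (weigh g t)) = L" for t by (simp add: fst_weigh L_def)
  have eq: "spread (\<Phi> (fst z)) (weigh g (snd z)) = f i z" if "i \<in> ?I" "z \<in> topspace ?D" "z \<in> T i" for i z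
  proof (cases i)
    case None
    have "mass (weigh g (snd z)) p \<le> 1/2" for p
    proof (cases "p \<in> rep ` set g")
      case True
      then show ?thesis using that(3) unfolding T_def None by auto
    next
      case False
      then show ?thesis using valid_mass(5)[OF v[OF that(2)], of p] by (simp add: fst_weigh)
    qed
    then have "spread (\<Phi> (fst z)) (weigh g (snd z)) = \<Phi> (fst z) L (base L) 0"
      using spread_centre[of "weigh g (snd z)" "\<Phi> (fst z)"] unfolding line by blast
    then show ?thesis by (simp add: None f_def)
  next
    case (Some p)
    then have "mass (weigh g (snd z)) p \<ge> 1/2" using that by (simp add: T_def)
    moreover have "compatible (\<Phi> (fst z))" using that(2) by (intro \<Phi>) auto
    ultimately show ?thesis
      using spread_ray[OF _ v[OF that(2)], of "\<Phi> (fst z)" p] unfolding line by (simp add: Some f_def)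
  qed
  have "continuous_map ?D Y (\<lambda>z. spread (\<Phi> (fst z)) (weigh g (snd z)))"
  proof (rule pasting_lemma_closed[where I = ?I and T = T and f = f])
    fix i assume i: "i \<in> ?I"
    have cl: "closedin ?D {z \<in> topspace ?D. mass (weigh g (snd z)) p \<in> C}" if "closed C" for C p
      using that by (intro closedin_continuous_map_preimage[OF continuous_mass]) simp
    show "closedin ?D (T i)"
    proof (cases i)
      case None
      have "T None = \<Inter> (insert (topspace ?D) ((\<lambda>p. {z \<in> topspace ?D. mass (weigh g (snd z)) p \<in> {..1/2}}) ` rep ` set g))"
        by (auto simp: T_def)
      moreover have "closedin ?D K"
        if "K \<in> insert (topspace ?D) ((\<lambda>p. {z \<in> topspace ?D. mass (weigh g (snd z)) p \<in> {..1/2}}) ` rep ` set g)" for K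
        using that by (elim insertE imageE) (simp_all only: closedin_topspace cl[OF closed_atMost])
      ultimately show ?thesis unfolding None by (simp only: closedin_Inter insert_not_empty not_False_eq_True)
    next
      case (Some p)
      then show ?thesis using cl[of "{1/2..}" p] by (simp add: T_def)
    qed
    have m: "max 0 (2 * mass (weigh g (snd z)) p - 1) \<in> {0..1}" if "z \<in> topspace ?D" for z p
      using valid_mass(2)[OF v[OF that], of p] by auto
    have "continuous_map ?D Y (f i)"
    proof (cases i)
      case None
      have "continuous_map ?D (prod_topology (top_of_set {0..1}) (top_of_set {0..1})) (\<lambda>z. (fst z, 0::real))"
        by (intro continuous_map_pairedI continuous_map_fst) simp
      from continuous_map_compose[OF this cont[OF L(1) b]] show ?thesis
        by (simp add: None f_def[abs_def] o_def)
    next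
      case (Some p)
      then have p: "p \<in> rep ` L" using i L(2) by auto
      have "continuous_map ?D (prod_topology (top_of_set {0..1}) (top_of_set {0..1}))
          (\<lambda>z. (fst z, max 0 (2 * mass (weigh g (snd z)) p - 1)))"
      proof -
        have "continuous_map ?D (top_of_set {0..1}) (\<lambda>z. max 0 (2 * mass (weigh g (snd z)) p - 1))"
          unfolding continuous_map_in_subtopology
        proof
          show "continuous_map ?D euclideanreal (\<lambda>z. max 0 (2 * mass (weigh g (snd z)) p - 1))"
            by (intro continuous_intros continuous_mass)
        qed (use m in blast)
        then show ?thesis by (intro continuous_map_pairedI continuous_map_fst)
      qed
      from continuous_map_compose[OF this cont[OF L(1) p]] show ?thesis
        by (simp add: Some f_def[abs_def] o_def)
    qed
    then show "continuous_map (subtopology ?D (T i)) Y (f i)" by (rule continuous_map_from_subtopology)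
  next
    fix i j z assume "i \<in> ?I" "j \<in> ?I" "z \<in> topspace ?D \<inter> T i \<inter> T j"
    then show "f i z = f j z" using eq[of i z] eq[of j z] by auto
  next
    fix z assume z: "z \<in> topspace ?D"
    show "\<exists>j. j \<in> ?I \<and> z \<in> T j \<and> spread (\<Phi> (fst z)) (weigh g (snd z)) = f j z"
    proof (cases "\<exists>p\<in>rep ` set g. mass (weigh g (snd z)) p \<ge> 1/2")
      case True
      then obtain p where "p \<in> rep ` set g" "mass (weigh g (snd z)) p \<ge> 1/2" by blast
      then have "Some p \<in> ?I" "z \<in> T (Some p)" using z by (auto simp: T_def)
      then show ?thesis using eq[of "Some p" z] z by blast
    next
      case False
      then have "None \<in> ?I" "z \<in> T None" using z by (auto simp: T_def)
      then show ?thesis using eq[of None z] z by blast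
    qed
  qed auto
  then show ?thesis by (simp only: case_prod_beta')
qed

section \<open>Retracting the lines to stars\<close>

abbreviation P :: "('v \<times> real) list \<Rightarrow> (nat \<times> 'v list \<times> (nat \<Rightarrow> real)) set" where
  "P \<equiv> pt collinear"

lemma P_eqI: "valid collinear l \<Longrightarrow> valid collinear l' \<Longrightarrow> reduce l = reduce l' \<Longrightarrow> P l = P l'"
  by (simp add: pt_eq_iff)

text \<open>A list of total weight one with mass \<open>m > 1/2\<close> at \<open>p\<close> is scaled at \<open>p\<close> by \<open>excess m\<close>, so that
  its mass there becomes \<open>2m - 1\<close>, and by zero everywhere else.  Bounding the denominator below makes
  the factor continuous in all of \<open>m\<close>.\<close>

definition excess :: "real \<Rightarrow> real" where
  "excess m = max 0 (2 * m - 1) / max m (1/2)"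

lemma excess: "0 \<le> excess m" "m \<le> 1/2 \<Longrightarrow> excess m = 0" "m \<ge> 1/2 \<Longrightarrow> m * excess m = 2 * m - 1"
  by (auto simp: excess_def max_def)

definition total :: "('v \<times> real) list \<Rightarrow> real" where
  "total l = (\<Sum>x\<leftarrow>l. snd x * excess (mass l (rep (fst x))))"

lemma total_centre: "(\<And>p. mass l p \<le> 1/2) \<Longrightarrow> total l = 0"
  by (simp add: total_def excess)

lemma total_ray:
  assumes "valid collinear l" "mass l p \<ge> 1/2"
  shows "total l = 2 * mass l p - 1"
proof -
  have "excess (mass l (rep (fst x))) = 0" if "rep (fst x) \<noteq> p" for x :: "'v \<times> real"
    using valid_mass(3)[OF assms(1) that] assms(2) by (intro excess(2)) simp
  then have "snd x * excess (mass l (rep (fst x))) = (if rep (fst x) = p then snd x else 0) * excess (mass l p)" for x :: "'v \<times> real"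
    by simp
  then have "total l = (\<Sum>x\<leftarrow>l. (if rep (fst x) = p then snd x else 0) * excess (mass l p))"
    unfolding total_def by (simp only:)
  also have "\<dots> = mass l p * excess (mass l p)"
    by (simp only: sum_list_mult_const mass_def)
  finally show ?thesis using excess(3)[OF assms(2)] by simp
qed

lemma total_bounds:
  assumes "valid collinear l"
  shows "0 \<le> total l" "total l \<le> 1"
proof -
  show "0 \<le> total l"
    unfolding total_def using assms excess(1) by (intro sum_list_nonneg) (auto simp: valid_def)
  show "total l \<le> 1"
  proof (cases "\<exists>p. mass l p \<ge> 1/2")
    case True
    then obtain p where "mass l p \<ge> 1/2" by blast
    then show ?thesis using total_ray[OF assms] valid_mass(2)[OF assms, of p] by simp
  next
    case False
    then have "\<And>p. mass l p \<le> 1/2" by (metis less_imp_le not_le)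
    then show ?thesis by (simp add: total_centre)
  qed
qed

text \<open>At time \<open>s\<close> the list is a concatenation of its image in the star, with weight \<open>s\<close>, and of the
  original list, with weight \<open>1 - s\<close>.  All entries lie in one line, and the vertices do not depend on
  the weights, so this is visibly continuous.\<close>

definition contract :: "real \<Rightarrow> ('v \<times> real) list \<Rightarrow> ('v \<times> real) list" where
  "contract s l = (base (line_of (fst ` set l)), s * (1 - total l)) #
     map (\<lambda>x. (rep (fst x), s * (snd x * excess (mass l (rep (fst x)))))) l @
     map (\<lambda>x. (fst x, (1 - s) * snd x)) l"

lemma valid_contract:
  assumes v: "valid collinear l" and s: "s \<in> {0..1}"
  shows "valid collinear (contract s l)"
proof -
  let ?L = "line_of (fst ` set l)"
  have L: "?L \<in> lines" "fst ` set l \<subseteq> ?L" using v line_of unfolding valid_def by blast+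
  have ne: "fst (hd l) \<in> ?L" using L(2) v by (auto simp: valid_def)
  have "fst ` set (contract s l) \<subseteq> ?L"
    using base(1)[OF L(1) ne] L rep_line[OF L(1)] by (auto simp: contract_def)
  then have "collinear (fst ` set (contract s l))" using L(1) by (auto simp: collinear_def)
  moreover have "\<forall>x\<in>set (contract s l). 0 \<le> snd x"
    using s v total_bounds[OF v] excess(1) by (auto simp: contract_def valid_def)
  moreover have "sum_list (map snd (contract s l)) = 1"
  proof -
    have "sum_list (map snd (contract s l)) = s * (1 - total l) + (s * total l + (1 - s) * sum_list (map snd l))"
      by (simp add: contract_def o_def total_def sum_list_const_mult)
    then show ?thesis using v by (simp add: valid_def algebra_simps)
  qed
  moreover have "contract s l \<noteq> []" by (simp add: contract_def)
  ultimately show ?thesis by (simp add: valid_def)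
qed

lemma reduce_contract_0: "reduce (contract 0 l) = reduce l"
proof -
  have "map (\<lambda>x. (fst x, (1 - 0) * snd x)) l = l" by (simp add: case_prod_beta' flip: id_def)
  then show ?thesis by (simp add: contract_def reduce_append foldr_push_zero)
qed

definition star_point :: "'v set \<Rightarrow> 'v \<Rightarrow> real \<Rightarrow> (nat \<times> 'v list \<times> (nat \<Rightarrow> real)) set" where
  "star_point L p u = P [(base L, 1 - u), (p, u)]"

lemma valid_line:
  assumes "L \<in> lines" "fst ` set l \<subseteq> L" "l \<noteq> []" "\<forall>x\<in>set l. 0 \<le> snd x" "sum_list (map snd l) = 1"
  shows "valid collinear l"
  using assms by (auto simp: valid_def collinear_def)

lemma valid_pair:
  assumes "x \<in> \<Union>lines" "y \<in> \<Union>lines" "0 \<le> a" "0 \<le> b" "a + b = 1"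
  shows "valid collinear [(x, a), (y, b)]"
proof -
  obtain L where "L \<in> lines" "x \<in> L" "y \<in> L" using line_through assms(1,2) by blast
  then show ?thesis using assms by (intro valid_line[of L]) auto
qed

lemma compatible_star_point: "compatible star_point"
  unfolding compatible_def
proof (intro ballI conjI impI)
  fix L p assume L: "L \<in> lines" and p: "p \<in> rep ` L"
  then have pL: "p \<in> L" using rep_image by blast
  have b: "base L \<in> L" by (rule base(1)[OF L pL])
  have U: "p \<in> \<Union>lines" "base L \<in> \<Union>lines" using L pL b by auto
  show "star_point L p 0 = star_point L (base L) 0"
    unfolding star_point_def using U by (intro P_eqI valid_pair) auto
  fix L' assume L': "L' \<in> lines" and "p \<in> rep ` L'"
  then have "base L' \<in> \<Union>lines" using base(1)[OF L'] rep_image by blast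
  then show "star_point L p 1 = star_point L' p 1"
    unfolding star_point_def using U by (intro P_eqI valid_pair) auto
qed

text \<open>At most one point has mass above \<open>1/2\<close>, so all entries of positive weight in the image of \<open>l\<close> other
  than the first represent that point and can be merged.\<close>

lemma P_contract_1:
  assumes v: "valid collinear l"
  shows "P (contract 1 l) = spread star_point l"
proof -
  let ?L = "line_of (fst ` set l)"
  let ?m = "map (\<lambda>x. (rep (fst x), 1 * (snd x * excess (mass l (rep (fst x)))))) l"
  have L: "?L \<in> lines" "fst ` set l \<subseteq> ?L" using v line_of unfolding valid_def by blast+
  have "fst (hd l) \<in> ?L" using L(2) v by (auto simp: valid_def)
  then have b: "base ?L \<in> \<Union>lines" using base(1)[OF L(1)] L(1) by blast
  have red: "reduce (contract 1 l) = push (base ?L, 1 - total l) (foldr push ?m [])"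
    by (simp add: contract_def reduce_append reduce_def foldr_push_zero)
  have vc: "valid collinear (contract 1 l)" using valid_contract[OF v] by simp
  show ?thesis
  proof (cases "\<exists>p. mass l p \<ge> 1/2")
    case True
    then obtain p where p: "mass l p \<ge> 1/2" by blast
    have "p \<in> rep ` fst ` set l" using valid_mass(5)[OF v, of p] p by auto
    then have pU: "p \<in> \<Union>lines" using L rep_line[OF L(1)] by blast
    have "foldr push ?m [] = push (p, sum_list (map snd ?m)) []"
    proof (rule foldr_push_same, intro ballI conjI impI)
      fix x assume "x \<in> set ?m"
      then obtain y where y: "y \<in> set l" "x = (rep (fst y), snd y * excess (mass l (rep (fst y))))" by auto
      then show "0 \<le> snd x" using v excess(1) by (simp add: valid_def)
      assume "snd x \<noteq> 0"
      then have "\<not> mass l (rep (fst y)) \<le> 1/2" using y excess(2) by auto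
      then show "fst x = p" using y valid_mass(3)[OF v, of "rep (fst y)" p] p by force
    qed
    also have "sum_list (map snd ?m) = total l" by (simp add: total_def o_def)
    finally have "reduce (contract 1 l) = reduce [(base ?L, 1 - total l), (p, total l)]"
      using red by simp
    then have "P (contract 1 l) = P [(base ?L, 1 - total l), (p, total l)]"
      using vc total_bounds[OF v] b pU by (intro P_eqI valid_pair) auto
    then show ?thesis
      using spread_ray[OF compatible_star_point v p] total_ray[OF v p] by (simp add: star_point_def)
  next
    case False
    then have m: "mass l p \<le> 1/2" for p by (metis less_imp_le not_le)
    have "foldr push ?m [] = []" using m excess(2) by (intro foldr_push_zero) auto
    then have "reduce (contract 1 l) = reduce [(base ?L, 1), (base ?L, 0)]"
      using red total_centre[OF m] by simp
    then have "P (contract 1 l) = P [(base ?L, 1), (base ?L, 0)]"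
      using vc b by (intro P_eqI valid_pair) auto
    then show ?thesis using spread_centre[of l star_point] m by (simp add: star_point_def)
  qed
qed

text \<open>As for \<open>spread\<close>, dropping an entry of weight zero changes the line only if all mass is at one
  point; then the weight of the base point is zero.\<close>

lemma move_invariant_contract:
  assumes s: "s \<in> {0..1}"
  shows "move_invariant collinear (\<lambda>l. P (contract s l))"
  unfolding move_invariant_def
proof (intro conjI allI impI)
  fix xs x ys assume v: "valid collinear (xs @ (x, 0) # ys)"
  let ?l = "xs @ (x, 0) # ys" and ?l' = "xs @ ys"
  have m: "mass ?l = mass ?l'" by (rule ext) simp
  have v': "valid collinear ?l'" by (rule valid_drop_zero[OF v])
  have t: "total ?l = total ?l'" unfolding total_def m by simp
  have "push (base (line_of (fst ` set ?l)), s * (1 - total ?l')) = push (base (line_of (fst ` set ?l')), s * (1 - total ?l'))"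
  proof (cases "line_of (fst ` set ?l) = line_of (fst ` set ?l')")
    case False
    have ne: "last ?l' \<in> set ?l'" using v' by (intro last_in_set) (simp add: valid_def)
    have "rep (fst z) = rep (fst (last ?l'))" if "z \<in> set ?l'" for z
      using lines_differ[of "fst ` set ?l" "fst ` set ?l'" "fst z" "fst (last ?l')"] False v that ne by (auto simp: valid_def)
    then have m1: "mass ?l' (rep (fst (last ?l'))) = 1" using valid_mass(4)[OF v'] by blast
    then have "total ?l' = 1" using total_ray[OF v', of "rep (fst (last ?l'))"] by (simp only:)
    then show ?thesis by (intro ext) simp
  qed (simp only:)
  then have "reduce (contract s ?l) = reduce (contract s ?l')"
    unfolding contract_def m t by (simp add: reduce_append)
  then show "P (contract s ?l) = P (contract s ?l')"
    by (intro P_eqI valid_contract v v' s)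
next
  fix xs x a b ys assume v: "valid collinear (xs @ (x, a) # (x, b) # ys)"
  let ?l = "xs @ (x, a) # (x, b) # ys" and ?l' = "xs @ (x, a + b) # ys"
  have m: "mass ?l = mass ?l'" by (rule ext) simp
  have t: "total ?l = total ?l'" unfolding total_def m by (simp add: algebra_simps)
  have L: "fst ` set ?l = fst ` set ?l'" by auto
  have ab: "0 \<le> a" "0 \<le> b" using v by (auto simp: valid_def)
  have e: "push (rep x, s * (a * c)) (push (rep x, s * (b * c)) r) = push (rep x, s * ((a + b) * c)) r" if "0 \<le> c" for c r
    using push_push[of "s * (a * c)" "s * (b * c)"] ab s that by (simp add: algebra_simps)
  have e': "push (x, (1 - s) * a) (push (x, (1 - s) * b) r) = push (x, (1 - s) * (a + b)) r" for r
    using push_push[of "(1 - s) * a" "(1 - s) * b"] ab s by (simp add: algebra_simps mult_left_le)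
  have "reduce (contract s ?l) = reduce (contract s ?l')"
    unfolding contract_def m t L by (simp add: reduce_append e[OF excess(1)] e' del: mass_simps)
  then show "P (contract s ?l) = P (contract s ?l')"
    by (intro P_eqI valid_contract v valid_merge s)
qed

lemma topspace_clique: "z \<in> topspace (realization cliques) \<Longrightarrow> \<exists>l. valid collinear l \<and> z = P l"
  unfolding topspace_realization_pt by blast

lemma homotopic_id_star:
  "homotopic_with (\<lambda>_. True) (realization cliques) (realization cliques) id (realization_lift collinear (spread star_point))"
proof -
  have "homotopic_with (\<lambda>_. True) (realization cliques) (realization cliques)
      (realization_lift collinear (\<lambda>l. P (contract 0 l))) (realization_lift collinear (\<lambda>l. P (contract 1 l)))"
  proof (rule homotopic_realization_lift)
    fix g :: "'v list" assume g: "g \<noteq> []" "collinear (set g)"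
    let ?D = "prod_topology (top_of_set {0..1::real}) (simplex_space (length g - 1))"
    let ?b = "base (line_of (set g))"
    have v: "valid collinear (weigh g (snd z))" if "z \<in> topspace ?D" for z
      using that g by (intro valid_weigh) auto
    have "continuous_map ?D (realization cliques) (\<lambda>z. P (contract (fst z) (weigh g (snd z))))"
    proof (rule continuous_map_pt)
      fix z assume z: "z \<in> topspace ?D"
      then have "fst z \<in> {0..1}" by auto
      then show "valid collinear (contract (fst z) (weigh g (snd z))) \<and>
          map fst (contract (fst z) (weigh g (snd z))) = ?b # map rep g @ g"
        using valid_contract[OF v[OF z]] fst_weigh[of g "snd z"]
        by (simp add: contract_def o_def) (simp add: weigh_def flip: map_map[unfolded o_def])
    next
      fix i assume i: "i < length (?b # map rep g @ g)"
      have ex: "continuous_map ?D euclideanreal (\<lambda>z. excess (mass (weigh g (snd z)) p))" for p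
        unfolding excess_def by (intro continuous_intros continuous_mass) auto
      have tot: "total (weigh g t) = (\<Sum>i<length g. t i * excess (mass (weigh g t) (rep (g ! i))))" for t
        unfolding total_def by (simp add: sum_list_sum_nth weigh_def atLeast0LessThan)
      have ct: "continuous_map ?D euclideanreal (\<lambda>z. total (weigh g (snd z)))"
        unfolding tot by (intro continuous_intros ex continuous_coordinate) auto
      have nth: "weigh g t ! k = (g ! k, t k)" if "k < length g" for t k
        using that by (simp add: weigh_def)
      have len: "length (weigh g t) = length g" for t by (simp add: weigh_def)
      consider "i = 0" | k where "i = Suc k" "k < length g" | k where "i = Suc (length g + k)" "k < length g"
      proof (cases i)
        case (Suc j)
        then show ?thesis using i that(2)[of j] that(3)[of "j - length g"] by (cases "j < length g") auto
      qed (use that in auto)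
      then show "continuous_map ?D euclideanreal (\<lambda>z. snd (contract (fst z) (weigh g (snd z)) ! i))"
      proof cases
        case 1
        then have eq: "(\<lambda>z. snd (contract (fst z) (weigh g (snd z)) ! i)) = (\<lambda>z. fst z * (1 - total (weigh g (snd z))))"
          by (simp add: contract_def fun_eq_iff)
        show ?thesis unfolding eq by (intro continuous_intros ct continuous_time) simp
      next
        case 2
        then have eq: "(\<lambda>z. snd (contract (fst z) (weigh g (snd z)) ! i)) =
            (\<lambda>z. fst z * (snd z k * excess (mass (weigh g (snd z)) (rep (g ! k)))))"
          by (simp add: contract_def fun_eq_iff nth_append len nth)
        show ?thesis unfolding eq by (intro continuous_intros ex continuous_coordinate continuous_time)
      next
        case 3
        then have eq: "(\<lambda>z. snd (contract (fst z) (weigh g (snd z)) ! i)) = (\<lambda>z. (1 - fst z) * snd z k)"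
          by (simp add: contract_def fun_eq_iff nth_append len nth)
        show ?thesis unfolding eq by (intro continuous_intros continuous_coordinate continuous_time) simp
      qed
    qed
    then show "continuous_map ?D (realization cliques) (\<lambda>(s, t). P (contract s (weigh g t)))"
      by (simp only: case_prod_beta')
  qed (rule move_invariant_contract)
  then show ?thesis
  proof (rule homotopic_with_eq)
    fix z assume "z \<in> topspace (realization cliques)"
    then obtain l where l: "valid collinear l" "z = P l" using topspace_clique by blast
    have "P (contract 0 l) = P l"
      using l valid_contract[of l 0] by (intro P_eqI reduce_contract_0) auto
    then show "id z = realization_lift collinear (\<lambda>l. P (contract 0 l)) z"
      using realization_lift_pt[OF move_invariant_contract l(1), of 0] l(2) by simp
    show "realization_lift collinear (spread star_point) z = realization_lift collinear (\<lambda>l. P (contract 1 l)) z"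
      using realization_lift_pt[OF move_invariant_contract l(1), of 1] l P_contract_1[OF l(1)]
        realization_lift_pt[OF move_invariant_spread[OF compatible_star_point] l(1)] by simp
  qed simp
qed

end

section \<open>The wedge of circles\<close>

abbreviation wedge_rel :: "nat \<times> complex \<Rightarrow> nat \<times> complex \<Rightarrow> bool" where
  "wedge_rel \<equiv> (\<lambda>x y. \<exists>i\<in>UNIV. \<exists>j\<in>UNIV. x = (i, 1) \<and> y = (j, 1))"

definition wedge_point :: "nat \<Rightarrow> real \<Rightarrow> (nat \<times> complex) set" where
  "wedge_point i x = quotient_class wedge_rel (i, cis (2 * pi * x))"

lemma wedge_of_circles_eq:
  "wedge_of_circles = quotient_topology (sum_topology (\<lambda>_. top_of_set (sphere 0 1)) UNIV) wedge_rel"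
  by (simp add: wedge_of_circles_def wedge_sum_def)

lemma wedge_class_eq_iff:
  "quotient_class wedge_rel (i, z) = quotient_class wedge_rel (j, w) \<longleftrightarrow> (i, z) = (j, w) \<or> (z = 1 \<and> w = 1)"
proof
  let ?f = "\<lambda>x :: nat \<times> complex. if snd x = 1 then None else Some x"
  assume "quotient_class wedge_rel (i, z) = quotient_class wedge_rel (j, w)"
  then have "equivclp wedge_rel (i, z) (j, w)" by (simp only: quotient_class_eq_iff)
  then have "?f (i, z) = ?f (j, w)" by (rule equivclp_invariant) auto
  then show "(i, z) = (j, w) \<or> (z = 1 \<and> w = 1)" by (auto split: if_splits)
next
  assume "(i, z) = (j, w) \<or> (z = 1 \<and> w = 1)"
  then show "quotient_class wedge_rel (i, z) = quotient_class wedge_rel (j, w)"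
    unfolding quotient_class_eq_iff by (auto intro: r_into_equivclp)
qed

lemma cis_eq_iff_unit:
  assumes "x \<in> {0..1}" "y \<in> {0..1}"
  shows "cis (2 * pi * x) = cis (2 * pi * y) \<longleftrightarrow> x = y \<or> (x \<in> {0, 1} \<and> y \<in> {0, 1})"
proof -
  have A: "Arg2pi (cis (2 * pi * x)) = 2 * pi * x" if "0 \<le> x" "x < 1" for x
    using that by (intro Arg2pi_unique[of 1]) (auto simp: cis_conv_exp mult_ac)
  have B: "cis (2 * pi * x) = 1 \<longleftrightarrow> x = 0" if "0 \<le> x" "x < 1" for x
    using A[OF that] A[of 0] by auto
  show ?thesis
  proof (cases "x = 1 \<or> y = 1")
    case True
    then show ?thesis using B[of x] B[of y] assms by (auto simp: less_le)
  next
    case False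
    then have "x < 1" "y < 1" using assms by auto
    then show ?thesis using A[of x] A[of y] assms by (metis (no_types, opaque_lifting) False atLeastAtMost_iff insert_iff mult_cancel_left mult_eq_0_iff pi_neq_zero singletonD zero_neq_numeral)
  qed
qed

lemma wedge_point_eq_iff:
  assumes "x \<in> {0..1}" "y \<in> {0..1}"
  shows "wedge_point i x = wedge_point j y \<longleftrightarrow> (i = j \<and> x = y) \<or> (x \<in> {0, 1} \<and> y \<in> {0, 1})"
proof -
  have "cis (2 * pi * x) = 1 \<longleftrightarrow> x \<in> {0, 1}" if "x \<in> {0..1}" for x
    using cis_eq_iff_unit[OF that, of 0] by auto
  then show ?thesis
    unfolding wedge_point_def wedge_class_eq_iff using cis_eq_iff_unit[OF assms] assms by auto
qed

lemma wedge_point_ends: "wedge_point i 0 = wedge_point j 0" "wedge_point i 1 = wedge_point j 0"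
  by (simp_all add: wedge_point_eq_iff)

lemma circle_cis: "(\<lambda>x. cis (2 * pi * x)) ` {0..1} = sphere 0 1"
proof (intro subset_antisym subsetI)
  fix z :: complex assume "z \<in> sphere 0 1"
  then have "exp (\<i> * of_real (Arg2pi z)) = z" using complex_norm_eq_1_exp[of z] by simp
  then have "z = cis (2 * pi * (Arg2pi z / (2 * pi)))" by (simp add: cis_conv_exp)
  moreover have "Arg2pi z / (2 * pi) \<in> {0..1}"
    using Arg2pi_ge_0[of z] Arg2pi_lt_2pi[of z] by (auto simp: field_simps)
  ultimately show "z \<in> (\<lambda>x. cis (2 * pi * x)) ` {0..1}" by blast
qed auto

lemma final_for_wedge: "final_for wedge_of_circles UNIV (\<lambda>_. top_of_set {0..1}) wedge_point"
proof -
  let ?S = "sum_topology (\<lambda>_::nat. top_of_set (sphere 0 1 :: complex set)) UNIV"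
  let ?q = "quotient_class wedge_rel"
  have q: "quotient_map ?S wedge_of_circles ?q"
    unfolding wedge_of_circles_eq by (rule quotient_map_quotient_class)
  have e: "continuous_map (top_of_set {0..1}) (top_of_set (sphere 0 1)) (\<lambda>x. cis (2 * pi * x))"
    using circle_cis by (auto simp: continuous_map_in_subtopology intro!: continuous_intros)
  show ?thesis
    unfolding final_for_def
  proof (intro conjI ballI allI impI)
    fix i
    have "continuous_map (top_of_set (sphere 0 1)) ?S (\<lambda>z. (i, z))"
      by (rule continuous_map_component_injection) simp
    from continuous_map_compose[OF e continuous_map_compose[OF this quotient_imp_continuous_map[OF q]]]
    show "continuous_map (top_of_set {0..1}) wedge_of_circles (wedge_point i)"
      by (simp add: o_def wedge_point_def[abs_def])
  next
    have "topspace wedge_of_circles = ?q ` (UNIV \<times> sphere 0 1)"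
      using quotient_imp_surjective_map[OF q] by (simp add: o_def)
    also have "\<dots> = (\<Union>i\<in>UNIV. wedge_point i ` {0..1})"
      unfolding circle_cis[symmetric] by (auto simp: wedge_point_def)
    finally show "(\<Union>i\<in>UNIV. wedge_point i ` topspace (top_of_set {0..1})) = topspace wedge_of_circles" by simp
  next
    fix V assume V: "V \<subseteq> topspace wedge_of_circles"
      and o: "\<forall>i\<in>UNIV. openin (top_of_set {0..1}) {x \<in> topspace (top_of_set {0..1}). wedge_point i x \<in> V}"
    have "openin (top_of_set (sphere 0 1)) {z \<in> sphere 0 1. ?q (i, z) \<in> V}" for i
    proof -
      let ?U = "{z \<in> sphere 0 1. ?q (i, z) \<in> V}"
      have "{x \<in> topspace (top_of_set {0..1}). cis (2 * pi * x) \<in> ?U} = {x \<in> topspace (top_of_set {0..1}). wedge_point i x \<in> V}"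
        by (auto simp: wedge_point_def)
      then have o': "openin (top_of_set {0..1}) {x \<in> topspace (top_of_set {0..1}). cis (2 * pi * x) \<in> ?U}" using o by simp
      have "quotient_map (top_of_set {0..1}) (top_of_set (sphere 0 1)) (\<lambda>x. cis (2 * pi * x))"
        by (rule continuous_imp_quotient_map[OF e])
          (use circle_cis in \<open>simp_all add: compact_space_subtopology Hausdorff_space_subtopology Hausdorff_space_euclidean\<close>)
      moreover have "?U \<subseteq> topspace (top_of_set (sphere 0 1))" by auto
      ultimately show ?thesis using o' unfolding quotient_map_def by blast
    qed
    then have "openin ?S {x \<in> topspace ?S. ?q x \<in> V}"
      unfolding openin_sum_topology by (auto simp: Collect_conj_eq conj_commute)
    then show "openin wedge_of_circles V"
      unfolding wedge_of_circles_eq openin_quotient_topology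
      using V unfolding wedge_of_circles_eq topspace_quotient_topology by blast
  qed
qed

definition wedge_lift :: "(nat \<Rightarrow> real \<Rightarrow> 'y) \<Rightarrow> (nat \<times> complex) set \<Rightarrow> 'y" where
  "wedge_lift f z = (let p = SOME p. snd p \<in> {0..1} \<and> z = wedge_point (fst p) (snd p) in f (fst p) (snd p))"

lemma wedge_lift:
  assumes f: "\<And>i. f i 0 = c" "\<And>i. f i 1 = c" and x: "x \<in> {0..1}"
  shows "wedge_lift f (wedge_point i x) = f i x"
proof -
  define p where "p = (SOME p. snd p \<in> {0..1} \<and> wedge_point i x = wedge_point (fst p) (snd p))"
  have "snd p \<in> {0..1} \<and> wedge_point i x = wedge_point (fst p) (snd p)"
    unfolding p_def by (rule someI[of _ "(i, x)"]) (use x in simp)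
  then have "f (fst p) (snd p) = f i x"
    using wedge_point_eq_iff[OF x, of "snd p" i "fst p"] f by auto
  then show ?thesis by (simp add: wedge_lift_def p_def Let_def)
qed

lemma continuous_map_wedge_lift:
  assumes f: "\<And>i. f i 0 = c" "\<And>i. f i 1 = c" and cont: "\<And>i. continuous_map (top_of_set {0..1}) Y (f i)"
  shows "continuous_map wedge_of_circles Y (wedge_lift f)"
proof (rule final_for_continuous_map[OF final_for_wedge])
  fix i show "continuous_map (top_of_set {0..1}) Y (\<lambda>x. wedge_lift f (wedge_point i x))"
    using cont[of i] by (rule continuous_map_eq) (simp add: wedge_lift[of f c] f)
qed

section \<open>Sliding the graph to a bouquet\<close>

context linear_space
begin

text \<open>The edges outside the spanning tree, each of which gives a circle.  The flag of \<open>base L\<close> itself is a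
  degenerate edge.\<close>

definition special :: "'v set \<Rightarrow> 'v \<Rightarrow> bool" where
  "special L p \<longleftrightarrow> origin \<notin> L \<and> p \<noteq> base L"

text \<open>The loop from \<open>origin\<close> to \<open>q\<close>, on to \<open>p\<close> and back, parametrized by \<open>[-1, 2]\<close>.\<close>

definition triangle :: "'v \<Rightarrow> 'v \<Rightarrow> real \<Rightarrow> (nat \<times> 'v list \<times> (nat \<Rightarrow> real)) set" where
  "triangle q p x = (if x \<le> 0 then P [(origin, - x), (q, 1 + x)]
     else if x \<le> 1 then P [(q, 1 - x), (p, x)] else P [(origin, x - 1), (p, 2 - x)])"

lemma continuous_pair:
  assumes "x \<in> \<Union>lines" "y \<in> \<Union>lines" "continuous_on T f" "\<And>t. t \<in> T \<Longrightarrow> f t \<in> {0..1}"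
  shows "continuous_map (top_of_set T) (realization cliques) (\<lambda>t. P [(x, 1 - f t), (y, f t)])"
proof (rule continuous_map_pt)
  fix i assume "i < length [x, y]"
  then have "i = 0 \<or> i = 1" by auto
  then show "continuous_map (top_of_set T) euclideanreal (\<lambda>t. snd ([(x, 1 - f t), (y, f t)] ! i))"
    using assms(3) by (auto intro!: continuous_intros)
qed (use assms in \<open>auto intro!: valid_pair\<close>)

lemma continuous_triangle:
  assumes "q \<in> \<Union>lines" "p \<in> \<Union>lines"
  shows "continuous_map (top_of_set {-1..2}) (realization cliques) (triangle q p)"
proof -
  let ?R = "realization cliques"
  have id: "continuous_map (top_of_set T) euclideanreal (\<lambda>x. x)" for T :: "real set" by simp
  have one: "continuous_map (top_of_set {-1..0}) ?R (\<lambda>x. P [(origin, - x), (q, 1 + x)])"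
    using continuous_pair[OF origin(1) assms(1), of "{-1..0}" "\<lambda>x. 1 + x"] by (simp add: continuous_intros)
  have two: "continuous_map (top_of_set {0..1}) ?R (\<lambda>x. P [(q, 1 - x), (p, x)])"
    using continuous_pair[OF assms, of "{0..1}" "\<lambda>x. x"] by (simp add: continuous_intros)
  have three: "continuous_map (top_of_set {1..2}) ?R (\<lambda>x. P [(origin, x - 1), (p, 2 - x)])"
    using continuous_pair[OF origin(1) assms(2), of "{1..2}" "\<lambda>x. 2 - x"] by (simp add: continuous_intros)
  have e1: "P [(q, 1 - 1), (p, 1)] = P [(origin, 1 - 1), (p, 2 - 1)]"
    using assms origin by (intro P_eqI valid_pair) auto
  have e0: "P [(origin, - 0), (q, 1 + 0)] = P [(q, 1 - 0), (p, 0)]"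
    using assms origin by (intro P_eqI valid_pair) auto
  have "continuous_map (top_of_set {0..2}) ?R (\<lambda>x. if x \<le> 1 then P [(q, 1 - x), (p, x)] else P [(origin, x - 1), (p, 2 - x)])"
    (is "continuous_map _ _ ?f")
  proof (rule continuous_map_cases_le)
    have "{0..2} \<inter> {x. x \<in> topspace (top_of_set {0..2::real}) \<and> x \<le> 1} = {0..1}"
      "{0..2} \<inter> {x. x \<in> topspace (top_of_set {0..2::real}) \<and> 1 \<le> x} = {1..2}" by auto
    then show "continuous_map (subtopology (top_of_set {0..2}) {x \<in> topspace (top_of_set {0..2}). x \<le> 1}) ?R (\<lambda>x. P [(q, 1 - x), (p, x)])"
      "continuous_map (subtopology (top_of_set {0..2}) {x \<in> topspace (top_of_set {0..2}). 1 \<le> x}) ?R (\<lambda>x. P [(origin, x - 1), (p, 2 - x)])"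
      using two three by (simp_all only: subtopology_subtopology)
  qed (use e1 in auto)
  moreover have "continuous_map (top_of_set {-1..2}) ?R (\<lambda>x. if x \<le> 0 then P [(origin, - x), (q, 1 + x)] else ?f x)"
    if "continuous_map (top_of_set {0..2}) ?R ?f"
  proof (rule continuous_map_cases_le)
    have "{-1..2} \<inter> {x. x \<in> topspace (top_of_set {-1..2::real}) \<and> x \<le> 0} = {-1..0}"
      "{-1..2} \<inter> {x. x \<in> topspace (top_of_set {-1..2::real}) \<and> 0 \<le> x} = {0..2}" by auto
    then show "continuous_map (subtopology (top_of_set {-1..2}) {x \<in> topspace (top_of_set {-1..2}). x \<le> 0}) ?R (\<lambda>x. P [(origin, - x), (q, 1 + x)])"
      "continuous_map (subtopology (top_of_set {-1..2}) {x \<in> topspace (top_of_set {-1..2}). 0 \<le> x}) ?R ?f"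
      using one that by (simp_all only: subtopology_subtopology)
  qed (use e0 in auto)
  ultimately show ?thesis by (simp add: triangle_def[abs_def])
qed

text \<open>The second homotopy moves every tip \<open>p\<close> along its edge to \<open>origin\<close>.  A special edge is dragged
  along the triangle; every other edge lies with \<open>origin\<close> in one line, or is a point, and can be
  contracted to \<open>origin\<close>.\<close>

definition slide :: "real \<Rightarrow> 'v set \<Rightarrow> 'v \<Rightarrow> real \<Rightarrow> (nat \<times> 'v list \<times> (nat \<Rightarrow> real)) set" where
  "slide s L p u = (if special L p then triangle (base L) p (u * (1 + 2 * s) - s)
     else P [(origin, s), (base L, (1 - s) * (1 - u)), (p, (1 - s) * u)])"

lemma valid_cone:
  assumes "L \<in> lines" "p \<in> rep ` L" "\<not> special L p" "s \<in> {0..1}" "u \<in> {0..1}"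
  shows "valid collinear [(origin, s), (base L, (1 - s) * (1 - u)), (p, (1 - s) * u)]"
proof -
  have p: "p \<in> L" using rep_image assms by blast
  have b: "base L \<in> L" using base(1)[OF assms(1) p] .
  obtain L' where "L' \<in> lines" "{origin, base L, p} \<subseteq> L'"
  proof (cases "origin \<in> L")
    case True
    then show ?thesis using that[of L] assms(1) p b by blast
  next
    case False
    then have "p = base L" using assms(3) by (simp add: special_def)
    then show ?thesis using line_through[of origin p] that origin(1) p assms(1) by blast
  qed
  moreover have "s + ((1 - s) * (1 - u) + (1 - s) * u) = 1" by (simp add: algebra_simps)
  ultimately show ?thesis using assms(4,5) by (intro valid_line[of L']) auto
qed

lemma slide_ends:
  assumes L: "L \<in> lines" "p \<in> rep ` L" and s: "s \<in> {0..1}"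
  shows "slide s L p 0 = P [(origin, s), (base L, 1 - s)]" "slide s L p 1 = P [(origin, s), (p, 1 - s)]"
proof -
  have p: "p \<in> L" using rep_image L by blast
  have U: "p \<in> \<Union>lines" "base L \<in> \<Union>lines" using L(1) p base(1)[OF L(1) p] by auto
  show "slide s L p 0 = P [(origin, s), (base L, 1 - s)]"
  proof (cases "special L p")
    case True
    then show ?thesis using s by (simp add: slide_def triangle_def)
  next
    case False
    have "P [(origin, s), (base L, (1 - s) * (1 - 0)), (p, (1 - s) * 0)] = P [(origin, s), (base L, 1 - s)]"
      using s U origin by (intro P_eqI valid_pair valid_cone L False) (auto simp: push_push simp del: push.simps)
    then show ?thesis using False by (simp add: slide_def)
  qed
  show "slide s L p 1 = P [(origin, s), (p, 1 - s)]"
  proof (cases "special L p")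
    case True
    have "P [(base L, 0), (p, 1)] = P [(origin, 0), (p, 1)]"
      using s U origin by (intro P_eqI valid_pair) auto
    then show ?thesis using s True by (cases "s = 0") (auto simp: slide_def triangle_def)
  next
    case False
    have "P [(origin, s), (base L, (1 - s) * (1 - 1)), (p, (1 - s) * 1)] = P [(origin, s), (p, 1 - s)]"
      using s U origin by (intro P_eqI valid_pair valid_cone L False) (auto simp: push_push simp del: push.simps)
    then show ?thesis using False by (simp add: slide_def)
  qed
qed

lemma compatible_slide:
  assumes s: "s \<in> {0..1}"
  shows "compatible (slide s)"
  unfolding compatible_def
proof (intro ballI conjI impI)
  fix L p assume L: "L \<in> lines" "p \<in> rep ` L"
  then have "base L \<in> rep ` L" using base(3) by blast
  then show "slide s L p 0 = slide s L (base L) 0" using slide_ends L s by metis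
  fix L' assume "L' \<in> lines" "p \<in> rep ` L'"
  then show "slide s L p 1 = slide s L' p 1" using slide_ends(2) L s by metis
qed

lemma slide_0:
  assumes L: "L \<in> lines" "p \<in> rep ` L" and u: "u \<in> {0..1}"
  shows "slide 0 L p u = star_point L p u"
proof -
  have p: "p \<in> L" using rep_image L by blast
  have U: "p \<in> \<Union>lines" "base L \<in> \<Union>lines" using L(1) p base(1)[OF L(1) p] by auto
  show ?thesis
  proof (cases "special L p")
    case True
    have "P [(origin, 0), (base L, 1)] = P [(base L, 1), (p, 0)]"
      using U origin by (intro P_eqI valid_pair) auto
    then show ?thesis using True u by (auto simp: slide_def star_point_def triangle_def)
  next
    case False
    have "P [(origin, 0), (base L, (1 - 0) * (1 - u)), (p, (1 - 0) * u)] = P [(base L, 1 - u), (p, u)]"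
      using u U by (intro P_eqI valid_cone valid_pair L False) auto
    then show ?thesis using False by (simp add: slide_def star_point_def)
  qed
qed

abbreviation square :: "(real \<times> real) topology" where
  "square \<equiv> prod_topology (top_of_set {0..1}) (top_of_set {0..1})"

lemma continuous_slide:
  assumes L: "L \<in> lines" "p \<in> rep ` L"
  shows "continuous_map square (realization cliques) (\<lambda>z. slide (fst z) L p (snd z))"
proof -
  have p: "p \<in> L" using rep_image L by blast
  have U: "p \<in> \<Union>lines" "base L \<in> \<Union>lines" using L(1) p base(1)[OF L(1) p] by auto
  have fs: "continuous_map square euclideanreal fst" "continuous_map square euclideanreal snd"
    by (auto intro: continuous_map_into_fulltopology continuous_map_fst continuous_map_snd simp del: prod_topology_subtopology_eu)
  show ?thesis
  proof (cases "special L p")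
    case True
    have "continuous_map square (top_of_set {-1..2}) (\<lambda>z. snd z * (1 + 2 * fst z) - fst z)"
      unfolding continuous_map_in_subtopology
    proof
      show "continuous_map square euclideanreal (\<lambda>z. snd z * (1 + 2 * fst z) - fst z)"
        by (intro continuous_intros fs) simp
      have "u * (1 + 2 * s) - s \<in> {-1..2}" if "s \<in> {0..1}" "u \<in> {0..1}" for s u :: real
      proof -
        define w where "w = u * (1 + 2 * s)"
        have "w \<le> 1 * (1 + 2 * s)" unfolding w_def using that by (intro mult_right_mono) auto
        moreover have "0 \<le> w" using that by (simp add: w_def)
        ultimately have "w - s \<in> {-1..2}" using that by auto
        then show ?thesis by (simp only: w_def)
      qed
      then show "(\<lambda>z. snd z * (1 + 2 * fst z) - fst z) \<in> topspace square \<rightarrow> {-1..2}" by auto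
    qed
    from continuous_map_compose[OF this continuous_triangle[OF U(2,1)]] True show ?thesis
      by (simp add: slide_def o_def)
  next
    case False
    have "continuous_map square (realization cliques)
       (\<lambda>z. P [(origin, fst z), (base L, (1 - fst z) * (1 - snd z)), (p, (1 - fst z) * snd z)])"
    proof (rule continuous_map_pt)
      fix z assume "z \<in> topspace square"
      then have "fst z \<in> {0..1}" "snd z \<in> {0..1}" by auto
      then show "valid collinear [(origin, fst z), (base L, (1 - fst z) * (1 - snd z)), (p, (1 - fst z) * snd z)] \<and>
         map fst [(origin, fst z), (base L, (1 - fst z) * (1 - snd z)), (p, (1 - fst z) * snd z)] = [origin, base L, p]"
        using valid_cone[OF L False] by simp
    next
      fix i assume "i < length [origin, base L, p]"
      then consider "i = 0" | "i = 1" | "i = 2" by force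
      then show "continuous_map square euclideanreal
         (\<lambda>z. snd ([(origin, fst z), (base L, (1 - fst z) * (1 - snd z)), (p, (1 - fst z) * snd z)] ! i))"
      proof cases
        case 1
        show ?thesis unfolding 1 nth_Cons_0 snd_conv by (rule fs)
      next
        case 2
        show ?thesis unfolding 2 One_nat_def nth_Cons_Suc nth_Cons_0 snd_conv by (intro continuous_intros fs) simp_all
      next
        case 3
        show ?thesis unfolding 3 numeral_2_eq_2 nth_Cons_Suc nth_Cons_0 snd_conv by (intro continuous_intros fs) simp_all
      qed
    qed
    then show ?thesis using False by (simp add: slide_def)
  qed
qed

lemma spread_cong:
  assumes v: "valid collinear l"
    and eq: "\<And>L p u. L \<in> lines \<Longrightarrow> p \<in> rep ` L \<Longrightarrow> u \<in> {0..1} \<Longrightarrow> \<Phi> L p u = \<Psi> L p u"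
  shows "spread \<Phi> l = spread \<Psi> l"
proof -
  let ?L = "line_of (fst ` set l)"
  have L: "?L \<in> lines" "fst ` set l \<subseteq> ?L" using v line_of unfolding valid_def by blast+
  have ne: "fst (hd l) \<in> ?L" using L(2) v by (auto simp: valid_def)
  show ?thesis
  proof (cases "\<exists>p. mass l p > 1/2")
    case True
    then obtain p where p: "mass l p > 1/2" by blast
    then have "p \<in> rep ` fst ` set l" using valid_mass(5)[OF v, of p] by auto
    then have "p \<in> rep ` ?L" using L(2) by blast
    moreover have "(THE p. mass l p > 1/2) = p"
    proof (rule the_equality)
      show "1/2 < mass l p" by (rule p)
      fix p' assume "1/2 < mass l p'"
      then show "p' = p" using valid_mass(3)[OF v, of p p'] p by (cases "p = p'") auto
    qed
    ultimately show ?thesis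
      using True eq[OF L(1), of p "2 * mass l p - 1"] p valid_mass(2)[OF v, of p]
      unfolding spread_def Let_def by (simp only: if_True) auto
  next
    case False
    then show ?thesis
      using eq[OF L(1) base(3)[OF L(1) ne], of 0] unfolding spread_def Let_def by (simp only: if_False) auto
  qed
qed

lemma spread_comp: "h (spread \<Phi> l) = spread (\<lambda>L p u. h (\<Phi> L p u)) l"
  by (simp add: spread_def Let_def)

lemma homotopic_star_slide:
  "homotopic_with (\<lambda>_. True) (realization cliques) (realization cliques)
     (realization_lift collinear (spread star_point)) (realization_lift collinear (spread (slide 1)))"
proof -
  have "homotopic_with (\<lambda>_. True) (realization cliques) (realization cliques)
     (realization_lift collinear (spread (slide 0))) (realization_lift collinear (spread (slide 1)))"
  proof (rule homotopic_realization_lift)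
    show "move_invariant collinear (spread (slide s))" if "s \<in> {0..1}" for s
      by (rule move_invariant_spread[OF compatible_slide[OF that]])
    show "continuous_map (prod_topology (top_of_set {0..1}) (simplex_space (length g - 1))) (realization cliques)
       (\<lambda>(s, t). spread (slide s) (weigh g t))" if "g \<noteq> []" "collinear (set g)" for g
      by (rule continuous_spread[OF compatible_slide continuous_slide that])
  qed
  then show ?thesis
  proof (rule homotopic_with_eq)
    fix z assume "z \<in> topspace (realization cliques)"
    then obtain l where l: "valid collinear l" "z = P l" using topspace_clique by blast
    then show "realization_lift collinear (spread star_point) z = realization_lift collinear (spread (slide 0)) z"
      using realization_lift_pt[OF move_invariant_spread[OF compatible_star_point] l(1)]
        realization_lift_pt[OF move_invariant_spread[OF compatible_slide] l(1), of 0]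
        spread_cong[OF l(1), of "slide 0" star_point] slide_0 by simp
  qed auto
qed

definition flags :: "('v set \<times> 'v) set" where
  "flags = {(L, p). L \<in> lines \<and> p \<in> rep ` L \<and> special L p}"

definition edge_loop :: "'v set \<Rightarrow> 'v \<Rightarrow> real \<Rightarrow> (nat \<times> complex) set" where
  "edge_loop L p u = (if special L p then wedge_point (to_nat_on flags (L, p)) u else wedge_point 0 0)"

lemma edge_loop_end: "edge_loop L p 1 = wedge_point 0 0" "edge_loop L p 0 = wedge_point 0 0"
  using wedge_point_ends unfolding edge_loop_def by metis+

lemma compatible_edge_loop: "compatible edge_loop"
  by (simp add: compatible_def edge_loop_end)

lemma continuous_wedge_point: "continuous_map (top_of_set {0..1}) wedge_of_circles (wedge_point i)"
  using final_for_wedge by (simp add: final_for_def)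

abbreviation to_wedge :: "(nat \<times> 'v list \<times> (nat \<Rightarrow> real)) set \<Rightarrow> (nat \<times> complex) set" where
  "to_wedge \<equiv> realization_lift collinear (spread edge_loop)"

lemma to_wedge_P: "valid collinear l \<Longrightarrow> to_wedge (P l) = spread edge_loop l"
  by (rule realization_lift_pt[OF move_invariant_spread[OF compatible_edge_loop]])

lemma continuous_to_wedge: "continuous_map (realization cliques) wedge_of_circles to_wedge"
proof (rule continuous_map_realization_lift[OF move_invariant_spread[OF compatible_edge_loop]])
  fix g :: "'v list" assume g: "g \<noteq> []" "collinear (set g)"
  let ?D = "simplex_space (length g - 1)"
  have "continuous_map (prod_topology (top_of_set {0..1::real}) ?D) wedge_of_circles (\<lambda>(s, t). spread edge_loop (weigh g t))"
  proof (rule continuous_spread[OF compatible_edge_loop _ g])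
    fix L p assume "L \<in> lines" "p \<in> rep ` L"
    have "continuous_map (top_of_set {0..1}) wedge_of_circles (edge_loop L p)"
      using continuous_wedge_point continuous_map_image_subset_topspace[OF continuous_wedge_point, of 0]
      by (auto simp: edge_loop_def[abs_def] image_subset_iff)
    from continuous_map_compose[OF continuous_map_snd this]
    show "continuous_map square wedge_of_circles (\<lambda>z. edge_loop L p (snd z))" by (simp only: o_def)
  qed
  moreover have "continuous_map ?D (prod_topology (top_of_set {0..1::real}) ?D) (\<lambda>t. (0, t))"
    by (intro continuous_map_pairedI) auto
  ultimately have "continuous_map ?D wedge_of_circles ((\<lambda>(s, t). spread edge_loop (weigh g t)) \<circ> (\<lambda>t. (0 :: real, t)))"
    by (intro continuous_map_compose)
  then show "continuous_map ?D wedge_of_circles (\<lambda>t. spread edge_loop (weigh g t))" by (simp add: o_def)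
qed

lemma edge_loop_through_origin: "origin \<in> L \<Longrightarrow> edge_loop L p u = wedge_point 0 0"
  by (simp add: edge_loop_def special_def)

text \<open>A line through \<open>origin\<close> has no special edges, so all of it goes to the wedge point.\<close>

lemma to_wedge_origin:
  assumes "x \<in> \<Union>lines" "0 \<le> a" "0 \<le> b" "a + b = 1"
  shows "to_wedge (P [(origin, a), (x, b)]) = wedge_point 0 0"
proof -
  have v: "valid collinear [(origin, a), (x, b)]" using assms origin by (intro valid_pair) auto
  then have "{origin, x} \<subseteq> line_of {origin, x}" by (intro line_of(2)) (simp add: valid_def)
  then show ?thesis unfolding to_wedge_P[OF v] spread_def Let_def by (simp add: edge_loop_through_origin)
qed

text \<open>The middle third of the triangle of a flag \<open>(L, p)\<close> is sent around the circle of the flag, but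
  only from the midpoint of the edge on; the rest of the triangle is sent to the wedge point.\<close>

lemma to_wedge_triangle:
  assumes L: "L \<in> lines" "p \<in> rep ` L" "special L p" and y: "y \<in> {-1..2}"
  shows "to_wedge (triangle (base L) p y) = wedge_point (to_nat_on flags (L, p)) (min 1 (max 0 (2 * y - 1)))"
proof -
  let ?i = "to_nat_on flags (L, p)"
  have p: "p \<in> L" "rep p = p" using rep_image L by blast+
  note b = base[OF L(1) p(1)]
  have U: "p \<in> \<Union>lines" "base L \<in> \<Union>lines" using L(1) p b by auto
  have ne: "p \<noteq> base L" using L(3) by (simp add: special_def)
  consider "y \<le> 0" | "0 < y" "y \<le> 1" | "1 < y" by linarith
  then show ?thesis
  proof cases
    case 1
    then have "to_wedge (triangle (base L) p y) = wedge_point 0 0"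
      using y U by (simp add: triangle_def to_wedge_origin)
    then show ?thesis using 1 wedge_point_ends(1)[of ?i 0] by (simp add: min_def max_def)
  next
    case 2
    let ?l = "[(base L, 1 - y), (p, y)]"
    have v: "valid collinear ?l" using 2 U by (intro valid_pair) auto
    have line: "line_of (fst ` set ?l) = L"
      using p b ne by (intro line_of_eq[OF L(1), of _ p "base L"]) auto
    have m: "mass ?l p = y" "mass ?l (base L) = 1 - y" using p b ne by auto
    have "to_wedge (triangle (base L) p y) = spread edge_loop ?l"
      using 2 to_wedge_P[OF v] by (simp add: triangle_def)
    also have "\<dots> = wedge_point ?i (min 1 (max 0 (2 * y - 1)))"
    proof (cases "y \<ge> 1/2")
      case True
      then have "spread edge_loop ?l = edge_loop L p (2 * y - 1)"
        using spread_ray[OF compatible_edge_loop v, of p] unfolding line m by simp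
      then show ?thesis using True 2 L(3) by (simp add: edge_loop_def min_def max_def)
    next
      case False
      then have "spread edge_loop ?l = edge_loop L (base L) (2 * (1 - y) - 1)"
        using spread_ray[OF compatible_edge_loop v, of "base L"] unfolding line m by simp
      then show ?thesis
        using False wedge_point_ends(1)[of ?i 0] by (simp add: edge_loop_def special_def min_def max_def)
    qed
    finally show ?thesis .
  next
    case 3
    then have "to_wedge (triangle (base L) p y) = wedge_point 0 0"
      using y U by (simp add: triangle_def to_wedge_origin)
    then show ?thesis using 3 wedge_point_ends(2)[of ?i 0] by (simp add: min_def max_def)
  qed
qed

text \<open>The map back from the wedge sends the circle of a flag around its triangle.  Composed with
  \<open>to_wedge\<close> it is exactly the end of the sliding homotopy on the one side, and a
  reparametrization of every circle on the other.\<close>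

theorem cliques_homotopy_equivalent_wedge:
  assumes fl: "countable flags" "infinite flags"
  shows "realization cliques homotopy_equivalent_space wedge_of_circles"
proof -
  let ?R = "realization cliques"
  define LL where "LL i = fst (from_nat_into flags i)" for i
  define pp where "pp i = snd (from_nat_into flags i)" for i
  have "from_nat_into flags i \<in> flags" for i using fl(2) by (intro from_nat_into) auto
  then have fi: "LL i \<in> lines" "pp i \<in> rep ` LL i" "special (LL i) (pp i)" for i
    by (auto simp: LL_def pp_def flags_def split_beta)
  have nn: "to_nat_on flags (LL i, pp i) = i" for i
    using to_nat_on_from_nat_into_infinite[OF fl] by (simp add: LL_def pp_def)
  have U: "pp i \<in> \<Union>lines" "base (LL i) \<in> \<Union>lines" for i
    using rep_image[OF fi(1,2)] base(1)[OF fi(1)] fi(1) by blast+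
  define c where "c = P [(origin, 1), (origin, 0)]"
  have cc: "P [(origin, 1), (x, 0)] = c" if "x \<in> \<Union>lines" for x
    unfolding c_def using that origin by (intro P_eqI valid_pair) auto
  define loop where "loop i x = triangle (base (LL i)) (pp i) (3 * x - 1)" for i x
  have ends: "loop i 0 = c" "loop i 1 = c" for i
    using U cc by (simp_all add: loop_def triangle_def)
  have cont_loop: "continuous_map (top_of_set {0..1}) ?R (loop i)" for i
  proof -
    have "continuous_map (top_of_set {0..1}) (top_of_set {-1..2}) (\<lambda>x::real. 3 * x - 1)"
      by (auto simp: continuous_map_in_subtopology intro!: continuous_intros)
    from continuous_map_compose[OF this continuous_triangle[OF U(2,1), of i i]] show ?thesis
      by (simp add: o_def loop_def[abs_def])
  qed
  let ?from = "wedge_lift loop"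
  have from_pt: "?from (wedge_point i x) = loop i x" if "x \<in> {0..1}" for i x
    using wedge_lift[of loop c, OF ends that] .
  have cont_from: "continuous_map wedge_of_circles ?R ?from"
    by (rule continuous_map_wedge_lift[of loop c, OF ends cont_loop])
  have from_edge: "?from (edge_loop L p u) = slide 1 L p u" if "L \<in> lines" "p \<in> rep ` L" "u \<in> {0..1}" for L p u
  proof (cases "special L p")
    case True
    then have "(L, p) \<in> flags" using that by (simp add: flags_def)
    then have "LL (to_nat_on flags (L, p)) = L" "pp (to_nat_on flags (L, p)) = p"
      using fl(1) by (simp_all add: LL_def pp_def)
    then show ?thesis
      using True from_pt[OF that(3)] by (simp add: edge_loop_def slide_def loop_def mult.commute)
  next
    case False
    have pU: "p \<in> \<Union>lines" using rep_image that by blast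
    have "P [(origin, 1), (base L, (1 - 1) * (1 - u)), (p, (1 - 1) * u)] = P [(origin, 1), (p, 0)]"
      using origin pU that(3) by (intro P_eqI valid_cone valid_pair that False) auto
    then show ?thesis using False from_pt[of 0 0] ends cc[OF pU] by (simp add: edge_loop_def slide_def)
  qed
  have "homotopic_with (\<lambda>_. True) ?R ?R id (realization_lift collinear (spread (slide 1)))"
    by (rule homotopic_with_trans[OF homotopic_id_star homotopic_star_slide])
  then have "homotopic_with (\<lambda>_. True) ?R ?R id (?from \<circ> to_wedge)"
  proof (rule homotopic_with_eq)
    fix z assume "z \<in> topspace ?R"
    then obtain l where l: "valid collinear l" "z = P l" using topspace_clique by blast
    have "?from (to_wedge z) = spread (\<lambda>L p u. ?from (edge_loop L p u)) l"
      unfolding l(2) to_wedge_P[OF l(1)] by (rule spread_comp)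
    also have "\<dots> = spread (slide 1) l" by (rule spread_cong[OF l(1) from_edge])
    also have "\<dots> = realization_lift collinear (spread (slide 1)) z"
      using realization_lift_pt[OF move_invariant_spread[OF compatible_slide] l(1), of 1] l(2) by simp
    finally show "(?from \<circ> to_wedge) z = realization_lift collinear (spread (slide 1)) z" by simp
  qed auto
  moreover have "homotopic_with (\<lambda>_. True) wedge_of_circles wedge_of_circles (to_wedge \<circ> ?from) id"
  proof -
    \<comment> \<open>The composite moves the point with parameter \<open>x\<close> to the one with parameter \<open>\<tau> x\<close>.\<close>
    define \<tau> where "\<tau> x = min 1 (max 0 (2 * (3 * x - 1) - 1))" for x :: real
    define k where "k s i x = wedge_point i ((1 - s) * \<tau> x + s * x)" for s i x
    have \<tau>01: "\<tau> 0 = 0" "\<tau> 1 = 1" and \<tau>: "\<tau> x \<in> {0..1}" for x by (auto simp: \<tau>_def)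
    have kends: "k s i 0 = wedge_point 0 0" "k s i 1 = wedge_point 0 0" for s i
      using wedge_point_ends[of i 0] by (simp_all add: k_def \<tau>01)
    have kl: "wedge_lift (k s) (wedge_point i x) = k s i x" if "x \<in> {0..1}" for s i x
      using wedge_lift[of "k s" "wedge_point 0 0", OF kends that] .
    show ?thesis
    proof (rule final_for_homotopic[OF final_for_wedge, where h = "\<lambda>s. wedge_lift (k s)"])
      fix i
      have "continuous_map square (top_of_set {0..1}) (\<lambda>z. (1 - fst z) * \<tau> (snd z) + fst z * snd z)"
        unfolding continuous_map_in_subtopology
      proof
        have fs: "continuous_map square euclideanreal fst" "continuous_map square euclideanreal snd"
          by (auto intro: continuous_map_into_fulltopology continuous_map_fst continuous_map_snd simp del: prod_topology_subtopology_eu)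
        show "continuous_map square euclideanreal (\<lambda>z. (1 - fst z) * \<tau> (snd z) + fst z * snd z)"
          unfolding \<tau>_def by (intro continuous_intros fs) simp_all
        have "(1 - s) * \<tau> x + s * x \<in> {0..1}" if "s \<in> {0..1}" "x \<in> {0..1}" for s x
        proof -
          have "(1 - s) * \<tau> x + s * x \<le> (1 - s) * 1 + s * 1"
            using that \<tau>[of x] by (intro add_mono mult_left_mono) auto
          moreover have "0 \<le> (1 - s) * \<tau> x + s * x" using that \<tau>[of x] by auto
          ultimately show ?thesis by simp
        qed
        then show "(\<lambda>z. (1 - fst z) * \<tau> (snd z) + fst z * snd z) \<in> topspace square \<rightarrow> {0..1}" by auto
      qed
      from continuous_map_compose[OF this continuous_wedge_point[of i]]
      have "continuous_map square wedge_of_circles (\<lambda>z. k (fst z) i (snd z))"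
        by (simp only: o_def k_def)
      then show "continuous_map square wedge_of_circles (\<lambda>(s, x). wedge_lift (k s) (wedge_point i x))"
        by (rule continuous_map_eq) (auto simp: kl)
    next
      fix z assume "z \<in> topspace wedge_of_circles"
      moreover have "topspace wedge_of_circles = (\<Union>i. wedge_point i ` {0..1})"
        using final_for_wedge by (simp add: final_for_def)
      ultimately obtain i x where z: "z = wedge_point i x" "x \<in> {0..1}" by blast
      show "wedge_lift (k 1) z = id z" using z by (simp add: kl) (simp add: k_def)
      have "to_wedge (?from z) = wedge_point i (\<tau> x)"
        using to_wedge_triangle[OF fi, of "3 * x - 1" i] z nn by (simp add: from_pt loop_def \<tau>_def)
      then show "wedge_lift (k 0) z = (to_wedge \<circ> ?from) z" using z by (simp add: kl) (simp add: k_def)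
    qed
  qed
  ultimately show ?thesis
    unfolding homotopy_equivalent_space_def
    using continuous_to_wedge cont_from homotopic_with_sym by blast
qed

text \<open>A point outside an infinite line through \<open>origin\<close> is joined to the points of that line by
  pairwise different lines, which miss \<open>origin\<close>.\<close>

lemma infinite_flags:
  assumes L: "L \<in> lines" "origin \<in> L" "infinite (rep ` L)" and x: "x \<in> \<Union>lines" "x \<notin> L"
  shows "infinite flags"
proof -
  \<comment> \<open>Without \<open>rep x\<close>, every line through \<open>x\<close> and a point of \<open>Y\<close> has two points, one of which
    differs from its base.\<close>
  define Y where "Y = rep ` L - {origin, rep x}"
  have Y: "infinite Y" using L(3) by (simp add: Y_def)
  have ex: "\<exists>f. f \<in> flags \<and> x \<in> fst f \<and> y \<in> fst f" if "y \<in> Y" for y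
  proof -
    have "y \<in> rep ` L" and y': "y \<noteq> origin" "y \<noteq> rep x"
      using that by (simp_all add: Y_def)
    then have y: "y \<in> L" "rep y = y" using rep_image[OF L(1)] by blast+
    obtain M where M: "M \<in> lines" "x \<in> M" "y \<in> M" using line_through[OF x(1), of y] y(1) L(1) by blast
    have "origin \<notin> M" using lines_meet[OF M(1) L(1), of y origin] M y y' L(2) x(2) origin(2) by metis
    moreover have "rep x \<in> rep ` M" "y \<in> rep ` M" using M image_eqI[of y rep y M] y(2) by simp_all
    ultimately have "(M, if y = base M then rep x else y) \<in> flags"
      using M(1) y'(2) by (auto simp: flags_def special_def)
    then show ?thesis using M by (intro exI[of _ "(M, if y = base M then rep x else y)"]) simp
  qed
  define f where "f y = (SOME f. f \<in> flags \<and> x \<in> fst f \<and> y \<in> fst f)" for y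
  have f: "f y \<in> flags" "x \<in> fst (f y)" "y \<in> fst (f y)" if "y \<in> Y" for y
    using someI_ex[OF ex[OF that]] by (simp_all add: f_def)
  have "inj_on f Y"
  proof (rule inj_onI, rule ccontr)
    fix y z assume yz: "y \<in> Y" "z \<in> Y" "f y = f z" "y \<noteq> z"
    then have "y \<in> rep ` L" "z \<in> rep ` L" by (simp_all add: Y_def)
    then have r: "y \<in> L" "z \<in> L" "rep y = y" "rep z = z" using rep_image[OF L(1)] by blast+
    have "fst (f y) \<in> lines" using f(1)[OF yz(1)] by (auto simp: flags_def)
    then have "fst (f y) = L"
      using lines_meet[of "fst (f y)" L y z] L(1) f(3)[OF yz(1)] f(3)[OF yz(2)] yz r by simp
    then show False using f(2)[OF yz(1)] x(2) by simp
  qed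
  moreover have "f ` Y \<subseteq> flags" using f by blast
  ultimately show ?thesis using Y by (meson finite_imageD finite_subset)
qed

end

section \<open>Groups in which commuting is transitive outside the centre\<close>

context group
begin

definition central :: "'a \<Rightarrow> bool" where
  "central c \<longleftrightarrow> c \<in> carrier G \<and> (\<forall>y\<in>carrier G. c \<otimes> y = y \<otimes> c)"

lemma central_mult: "central c \<Longrightarrow> central d \<Longrightarrow> central (c \<otimes> d)"
  unfolding central_def using commute_mult by (metis m_closed)

lemma central_inv: "central c \<Longrightarrow> central (inv c)"
  unfolding central_def using commute_inv by (metis inv_closed)

text \<open>A representative of the coset \<open>x Z\<close> of the centre \<open>Z\<close>; it stays outside the group if \<open>x\<close> does,
  so that \<open>centre_rep\<close> is idempotent everywhere.\<close>

definition centre_rep :: "'a \<Rightarrow> 'a" where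
  "centre_rep x = (if x \<in> carrier G then SOME y. y \<in> carrier G \<and> central (inv x \<otimes> y) else x)"

lemma inv_difference_flip: "x \<in> carrier G \<Longrightarrow> y \<in> carrier G \<Longrightarrow> inv (inv x \<otimes> y) = inv y \<otimes> x"
  by (simp add: inv_mult_group)

lemma centre_rep:
  assumes "x \<in> carrier G"
  shows "centre_rep x \<in> carrier G" "central (inv x \<otimes> centre_rep x)"
proof -
  have "central \<one>" by (simp add: central_def)
  then have "\<exists>y. y \<in> carrier G \<and> central (inv x \<otimes> y)" using assms by (intro exI[of _ x]) simp
  from someI_ex[OF this] show "centre_rep x \<in> carrier G" "central (inv x \<otimes> centre_rep x)"
    using assms by (simp_all add: centre_rep_def)
qed

lemma centre_rep_eq:
  assumes "x \<in> carrier G" "y \<in> carrier G"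
  shows "centre_rep x = centre_rep y \<longleftrightarrow> central (inv x \<otimes> y)"
proof
  assume e: "centre_rep x = centre_rep y"
  have "inv x \<otimes> y = (inv x \<otimes> centre_rep x) \<otimes> inv (inv y \<otimes> centre_rep y)"
    using assms centre_rep[OF assms(1)] by (simp add: inv_difference_flip inv_mult_cancel flip: e)
  then show "central (inv x \<otimes> y)"
    using centre_rep(2) assms central_mult central_inv by simp
next
  assume c: "central (inv x \<otimes> y)"
  then have c': "central (inv y \<otimes> x)" using central_inv inv_difference_flip assms by metis
  have "central (inv x \<otimes> z) \<longleftrightarrow> central (inv y \<otimes> z)" if "z \<in> carrier G" for z
    using central_mult[OF c, of "inv y \<otimes> z"] central_mult[OF c', of "inv x \<otimes> z"] that assms
    by (auto simp: inv_mult_cancel)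
  then have "(\<lambda>z. z \<in> carrier G \<and> central (inv x \<otimes> z)) = (\<lambda>z. z \<in> carrier G \<and> central (inv y \<otimes> z))"
    by blast
  then show "centre_rep x = centre_rep y" using assms by (simp add: centre_rep_def)
qed

lemma centre_rep_idem: "centre_rep (centre_rep x) = centre_rep x"
proof (cases "x \<in> carrier G")
  case True
  then show ?thesis using centre_rep centre_rep_eq by metis
qed (simp add: centre_rep_def)

definition centralizer_coset :: "'a \<Rightarrow> 'a \<Rightarrow> 'a set" where
  "centralizer_coset x a = {y \<in> carrier G. (inv x \<otimes> y) \<otimes> a = a \<otimes> (inv x \<otimes> y)}"

lemma centralizer_coset_base:
  assumes "x \<in> carrier G" "a \<in> carrier G" "y \<in> centralizer_coset x a"
  shows "centralizer_coset x a = centralizer_coset y a"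
proof -
  have y: "y \<in> carrier G" "a \<otimes> (inv x \<otimes> y) = (inv x \<otimes> y) \<otimes> a"
    using assms(3) by (auto simp: centralizer_coset_def)
  then have y': "a \<otimes> (inv y \<otimes> x) = (inv y \<otimes> x) \<otimes> a"
    using commute_inv[of a "inv x \<otimes> y"] assms by (simp add: inv_difference_flip)
  have "a \<otimes> (inv x \<otimes> z) = (inv x \<otimes> z) \<otimes> a \<longleftrightarrow> a \<otimes> (inv y \<otimes> z) = (inv y \<otimes> z) \<otimes> a"
    if z: "z \<in> carrier G" for z
    using commute_mult[of a "inv x \<otimes> y" "inv y \<otimes> z"] commute_mult[of a "inv y \<otimes> x" "inv x \<otimes> z"] y y' z assms
    by (auto simp: inv_mult_cancel)
  then show ?thesis unfolding centralizer_coset_def by (metis (no_types, lifting))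
qed

text \<open>The lines are the cosets of centralizers of noncentral elements.  Transitivity makes these
  centralizers abelian, and a set with commuting differences from its element \<open>x\<close> lies in the coset
  \<open>x C(d)\<close> for any noncentral difference \<open>d\<close>.  The sequence \<open>b\<close> provides infinitely many points on
  the line \<open>C(a)\<close>.\<close>

theorem E_com_wedge_of_circles:
  assumes count: "countable (carrier G)"
    and trans: "\<And>x y z. x \<in> carrier G \<Longrightarrow> y \<in> carrier G \<Longrightarrow> z \<in> carrier G \<Longrightarrow> \<not> central y \<Longrightarrow>
       x \<otimes> y = y \<otimes> x \<Longrightarrow> y \<otimes> z = z \<otimes> y \<Longrightarrow> x \<otimes> z = z \<otimes> x"
    and a: "a \<in> carrier G" "\<not> central a"
    and b: "\<And>i::nat. b i \<in> carrier G" "\<And>i. b i \<otimes> a = a \<otimes> b i" "\<And>i j. central (inv (b i) \<otimes> b j) \<Longrightarrow> i = j"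
  shows "E_com G homotopy_equivalent_space wedge_of_circles"
proof -
  define lines where "lines = {centralizer_coset x c | x c. x \<in> carrier G \<and> c \<in> carrier G \<and> \<not> central c}"
  have lineI: "centralizer_coset x c \<in> lines" if "x \<in> carrier G" "c \<in> carrier G" "\<not> central c" for x c
    using that by (auto simp: lines_def)
  have lineE: "\<exists>c. c \<in> carrier G \<and> \<not> central c \<and> L = centralizer_coset x c" if "L \<in> lines" "x \<in> L" for L x
  proof -
    obtain x' c where c: "x' \<in> carrier G" "c \<in> carrier G" "\<not> central c" "L = centralizer_coset x' c"
      using \<open>L \<in> lines\<close> unfolding lines_def by blast
    have "L = centralizer_coset x c"
      using centralizer_coset_base[OF c(1,2), of x] \<open>x \<in> L\<close> unfolding c(4) by blast
    then show ?thesis using c by blast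
  qed
  have line_sub: "L \<subseteq> carrier G" if "L \<in> lines" for L
    using that by (auto simp: lines_def centralizer_coset_def)
  have self: "x \<in> centralizer_coset x c" if "x \<in> carrier G" "c \<in> carrier G" for x c
    using that by (simp add: centralizer_coset_def)
  have U: "\<Union>lines = carrier G"
    using line_sub self lineI a by blast
  \<comment> \<open>Elements commuting with a noncentral \<open>c\<close> commute with each other, so the line through \<open>x\<close>
    does not depend on the noncentral direction chosen inside it.\<close>
  have direction: "centralizer_coset x c = centralizer_coset x d"
    if "x \<in> carrier G" "c \<in> carrier G" "d \<in> carrier G" "\<not> central c" "\<not> central d" "c \<otimes> d = d \<otimes> c" for x c d
  proof -
    have "(inv x \<otimes> y) \<otimes> c = c \<otimes> (inv x \<otimes> y) \<longleftrightarrow> (inv x \<otimes> y) \<otimes> d = d \<otimes> (inv x \<otimes> y)" if "y \<in> carrier G" for y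
      using trans[of "inv x \<otimes> y" c d] trans[of "inv x \<otimes> y" d c] that
        \<open>x \<in> carrier G\<close> \<open>c \<in> carrier G\<close> \<open>d \<in> carrier G\<close> \<open>\<not> central c\<close> \<open>\<not> central d\<close> \<open>c \<otimes> d = d \<otimes> c\<close>
      by auto
    then show ?thesis unfolding centralizer_coset_def by blast
  qed
  interpret linear_space lines centre_rep "centre_rep \<one>"
  proof
    fix L x assume L: "L \<in> lines" "x \<in> L"
    then obtain c where c: "c \<in> carrier G" "L = centralizer_coset x c" using lineE by blast
    have x: "x \<in> carrier G" using L line_sub by blast
    then show "centre_rep x \<in> L"
      using centre_rep[OF x] c by (simp add: centralizer_coset_def central_def)
  next
    fix x show "centre_rep (centre_rep x) = centre_rep x" by (rule centre_rep_idem)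
  next
    fix x y assume "x \<in> \<Union>lines" "y \<in> \<Union>lines"
    then have xy: "x \<in> carrier G" "y \<in> carrier G" using U by auto
    show "\<exists>L\<in>lines. x \<in> L \<and> y \<in> L"
    proof (cases "central (inv x \<otimes> y)")
      case True
      then have "y \<in> centralizer_coset x a" using xy a by (simp add: centralizer_coset_def central_def)
      then show ?thesis using lineI[OF xy(1) a] self[OF xy(1) a(1)] by blast
    next
      case False
      then show ?thesis
        using lineI[OF xy(1) _ False] self[OF xy(1), of "inv x \<otimes> y"] xy
        by (intro bexI[of _ "centralizer_coset x (inv x \<otimes> y)"]) (auto simp: centralizer_coset_def)
    qed
  next
    fix L L' x y
    assume *: "L \<in> lines" "L' \<in> lines" "x \<in> L" "y \<in> L" "x \<in> L'" "y \<in> L'" "centre_rep x \<noteq> centre_rep y"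
    then have xy: "x \<in> carrier G" "y \<in> carrier G" using line_sub by blast+
    have d: "inv x \<otimes> y \<in> carrier G" "\<not> central (inv x \<otimes> y)" using * xy centre_rep_eq by simp_all
    have "M = centralizer_coset x (inv x \<otimes> y)" if M: "M \<in> lines" "x \<in> M" "y \<in> M" for M
    proof -
      obtain c where c: "c \<in> carrier G" "\<not> central c" "M = centralizer_coset x c" using lineE M by blast
      then have "c \<otimes> (inv x \<otimes> y) = (inv x \<otimes> y) \<otimes> c" using M(3) by (simp add: centralizer_coset_def)
      then show ?thesis using direction[OF xy(1) c(1) d(1) c(2) d(2)] c(3) by simp
    qed
    then show "L = L'" using * by metis
  next
    show "centre_rep \<one> \<in> \<Union>lines" using U centre_rep(1) by simp
    show "centre_rep (centre_rep \<one>) = centre_rep \<one>" by (rule centre_rep_idem)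
  qed
  have "collinear = commuting_differences G"
  proof (rule ext, rule iffI)
    fix S assume "collinear S"
    then obtain L where L: "L \<in> lines" "S \<subseteq> L" by (auto simp: collinear_def)
    show "commuting_differences G S"
      unfolding commuting_differences_def
    proof (intro conjI ballI)
      show "S \<subseteq> carrier G" using L line_sub by blast
      fix x y z assume S: "x \<in> S" "y \<in> S" "z \<in> S"
      then obtain c where c: "c \<in> carrier G" "\<not> central c" "L = centralizer_coset x c" using lineE L by blast
      have "x \<in> carrier G" "y \<in> L" "z \<in> L" using S L line_sub by blast+
      then show "(inv x \<otimes> y) \<otimes> (inv x \<otimes> z) = (inv x \<otimes> z) \<otimes> (inv x \<otimes> y)"
        unfolding c(3) centralizer_coset_def using trans[of "inv x \<otimes> y" c "inv x \<otimes> z"] c(1,2) by auto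
    qed
  next
    fix S assume S: "commuting_differences G S"
    then have Sc: "S \<subseteq> carrier G" by (simp add: commuting_differences_def)
    show "collinear S"
    proof (cases "S = {}")
      case True
      then show ?thesis using lineI[OF a(1) a] by (auto simp: collinear_def)
    next
      case False
      then obtain x where x: "x \<in> S" by blast
      show ?thesis
      proof (cases "\<exists>y\<in>S. \<not> central (inv x \<otimes> y)")
        case True
        then obtain y where y: "y \<in> S" "\<not> central (inv x \<otimes> y)" by blast
        then have "S \<subseteq> centralizer_coset x (inv x \<otimes> y)"
          using S x Sc by (auto simp: centralizer_coset_def commuting_differences_def)
        moreover have "centralizer_coset x (inv x \<otimes> y) \<in> lines" using x y Sc by (intro lineI) auto
        ultimately show ?thesis by (auto simp: collinear_def)
      next
        case False
        then have "S \<subseteq> centralizer_coset x a"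
          using x Sc a by (auto simp: centralizer_coset_def central_def)
        moreover have "centralizer_coset x a \<in> lines" using x Sc a by (intro lineI) auto
        ultimately show ?thesis by (auto simp: collinear_def)
      qed
    qed
  qed
  moreover have "countable flags"
  proof -
    have "lines \<subseteq> (\<lambda>(x, c). centralizer_coset x c) ` (carrier G \<times> carrier G)" by (auto simp: lines_def)
    then have "countable lines" using count by (meson countable_SIGMA countable_image countable_subset)
    moreover have "flags \<subseteq> lines \<times> carrier G"
    proof
      fix f assume "f \<in> flags"
      then obtain L p where f: "f = (L, p)" "L \<in> lines" "p \<in> centre_rep ` L" by (auto simp: flags_def)
      then have "p \<in> carrier G" using rep_image[OF f(2,3)] line_sub[OF f(2)] by blast
      then show "f \<in> lines \<times> carrier G" using f by simp
    qed
    ultimately show ?thesis using count by (meson countable_SIGMA countable_subset)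
  qed
  moreover have "infinite flags"
  proof -
    let ?L = "centralizer_coset \<one> a"
    have L: "?L \<in> lines" using a by (intro lineI) auto
    have "inj (\<lambda>i. centre_rep (b i))" using centre_rep_eq[OF b(1) b(1)] b(3) by (auto intro: injI)
    then have "infinite (range (\<lambda>i. centre_rep (b i)))" by (simp add: finite_image_iff)
    moreover have "range (\<lambda>i. centre_rep (b i)) \<subseteq> centre_rep ` ?L"
      using b by (auto simp: centralizer_coset_def)
    ultimately have inf: "infinite (centre_rep ` ?L)" using finite_subset by blast
    obtain x where x: "x \<in> carrier G" "a \<otimes> x \<noteq> x \<otimes> a" using a by (auto simp: central_def)
    then have "x \<notin> ?L" by (auto simp: centralizer_coset_def)
    moreover have "centre_rep \<one> \<in> ?L" using rep_line[OF L self[OF _ a(1)]] by simp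
    ultimately show ?thesis using infinite_flags[OF L _ inf] x(1) U by blast
  qed
  ultimately have "realization X_com homotopy_equivalent_space wedge_of_circles"
    using cliques_homotopy_equivalent_wedge by simp
  moreover have "E_com G homotopy_equivalent_space realization X_com"
    using homeomorphic_imp_homotopy_equivalent_space[OF E_com_homeomorphic] homotopy_equivalent_space_sym by blast
  ultimately show ?thesis using homotopy_eqv_trans by blast
qed

end

section \<open>The wallpaper groups\<close>

text \<open>In a semidirect product \<open>V \<rtimes> H\<close> of abelian groups, suppose that every element of \<open>H\<close> acts on \<open>V\<close>
  by \<open>F\<close> either trivially or without nonzero fixed vectors, and let \<open>(w, k)\<close> be noncentral.  If \<open>k\<close>
  acts nontrivially, and \<open>(v, h)\<close> and \<open>(v', h')\<close> commute with \<open>(w, k)\<close>, then the vector that measures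
  whether they commute with each other is fixed by \<open>k\<close>, hence zero.  If \<open>k\<close> acts trivially, then \<open>w\<close>
  is nonzero, and everything that commutes with \<open>(w, k)\<close> fixes \<open>w\<close> and therefore acts trivially.\<close>

lemma E_com_semidirect_wedge_of_circles:
  fixes G :: "('v::ab_group_add \<times> int) monoid" and F :: "int \<Rightarrow> 'v \<Rightarrow> 'v"
  assumes G: "group G" and carrier: "carrier G = UNIV \<times> H" and count: "countable (UNIV :: 'v set)"
    and mult: "\<And>v h w k. h \<in> H \<Longrightarrow> k \<in> H \<Longrightarrow> (v, h) \<otimes>\<^bsub>G\<^esub> (w, k) = (v + F h w, m h k)"
    and m: "\<And>h k. h \<in> H \<Longrightarrow> k \<in> H \<Longrightarrow> m h k = m k h"
    and add: "\<And>h v w. F h (v + w) = F h v + F h w"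
    and comm: "\<And>h k v. F h (F k v) = F k (F h v)"
    and free: "\<And>h v. h \<in> H \<Longrightarrow> F h v = v \<Longrightarrow> v = 0 \<or> (\<forall>w. F h w = w)"
    and zero: "0 \<in> H" "\<And>v. F 0 v = v"
    and e: "e \<in> H" "F e t \<noteq> t" and \<beta>: "inj (\<beta> :: nat \<Rightarrow> 'v)"
  shows "E_com G homotopy_equivalent_space wedge_of_circles"
proof -
  interpret group G by (rule G)
  have F0: "F h 0 = 0" for h using add[of h 0 0] by simp
  have diff: "F h (v - w) = F h v - F h w" for h v w using add[of h "v - w" w] by (simp add: algebra_simps)
  have commute: "(v, h) \<otimes>\<^bsub>G\<^esub> (w, k) = (w, k) \<otimes>\<^bsub>G\<^esub> (v, h) \<longleftrightarrow> v + F h w = w + F k v"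
    if "h \<in> H" "k \<in> H" for v h w k
    using that m by (simp add: mult)
  have centralD: "F h v = v" if "central (v, k)" "k \<in> H" "h \<in> H" for v k h
    using that commute[OF that(2,3), of v 0] by (simp add: central_def carrier F0)
  show ?thesis
  proof (rule E_com_wedge_of_circles)
    show "countable (carrier G)" unfolding carrier using count by (intro countable_SIGMA) auto
    show "(t, 0) \<in> carrier G" using zero by (simp add: carrier)
    show "\<not> central (t, 0)" using centralD[OF _ zero(1) e(1)] e(2) by blast
    show "(\<beta> i, 0) \<in> carrier G" for i using zero by (simp add: carrier)
    show "(\<beta> i, 0) \<otimes>\<^bsub>G\<^esub> (t, 0) = (t, 0) \<otimes>\<^bsub>G\<^esub> (\<beta> i, 0)" for i
      using zero by (simp add: commute add.commute)
    show "i = j" if "central (inv\<^bsub>G\<^esub> (\<beta> i, 0) \<otimes>\<^bsub>G\<^esub> (\<beta> j, 0))" for i j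
    proof -
      obtain d k where dk: "inv\<^bsub>G\<^esub> (\<beta> i, 0) \<otimes>\<^bsub>G\<^esub> (\<beta> j, 0) = (d, k)" by (cases "inv\<^bsub>G\<^esub> (\<beta> i, 0) \<otimes>\<^bsub>G\<^esub> (\<beta> j, 0)")
      have c: "(\<beta> i, 0) \<in> carrier G" "(\<beta> j, 0) \<in> carrier G" using zero by (simp_all add: carrier)
      then have k: "k \<in> H" using dk carrier by (metis SigmaD2 inv_closed m_closed)
      have "(\<beta> j, 0) = (\<beta> i, 0) \<otimes>\<^bsub>G\<^esub> (d, k)" unfolding dk[symmetric] using c by (simp flip: m_assoc)
      then have "\<beta> j = \<beta> i + d" using k zero by (simp add: mult)
      moreover have "F e d = d" using centralD[of d k e] that dk k e(1) by simp
      then have "d = 0" using free[OF e(1)] e(2) by blast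
      ultimately show "i = j" using \<beta> by (simp add: inj_eq)
    qed
    fix x y z assume "x \<in> carrier G" "y \<in> carrier G" "z \<in> carrier G" and nc: "\<not> central y"
      and xy: "x \<otimes>\<^bsub>G\<^esub> y = y \<otimes>\<^bsub>G\<^esub> x" and yz: "y \<otimes>\<^bsub>G\<^esub> z = z \<otimes>\<^bsub>G\<^esub> y"
    then obtain v h w k v' h' where x: "x = (v, h)" and y: "y = (w, k)" and z: "z = (v', h')"
      and H: "h \<in> H" "k \<in> H" "h' \<in> H"
      unfolding carrier by auto
    have 1: "F k v = v + F h w - w" using xy commute[OF H(1,2), of v w] by (simp add: x y algebra_simps)
    have 2: "F k v' = v' + F h' w - w" using yz commute[OF H(2,3), of w v'] by (simp add: y z algebra_simps)
    show "x \<otimes>\<^bsub>G\<^esub> z = z \<otimes>\<^bsub>G\<^esub> x"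
    proof (cases "\<forall>u. F k u = u")
      case True
      have fix_w: "F h w = w" "F h' w = w" using 1 2 True by (simp_all add: algebra_simps)
      have "w \<noteq> 0"
      proof
        assume "w = 0"
        then have "central y"
          using H(2) True commute[OF H(2), of _ 0] by (auto simp: central_def carrier y F0)
        then show False using nc by simp
      qed
      then have "F h u = u" "F h' u = u" for u using free[OF H(1) fix_w(1)] free[OF H(3) fix_w(2)] by auto
      then show ?thesis unfolding x z commute[OF H(1,3)] by (simp add: add.commute)
    next
      case False
      let ?d = "v + F h v' - v' - F h' v"
      have "F k ?d = F k v + F h (F k v') - F k v' - F h' (F k v)"
        by (simp add: diff add comm[of k])
      also have "\<dots> = ?d" unfolding 1 2 by (simp add: diff add comm[of h' h]) 
      finally have "?d = 0" using free[OF H(2), of ?d] False by blast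
      then show ?thesis unfolding x z commute[OF H(1,3)] by (simp add: algebra_simps)
    qed
  qed
qed

lemma cyclic_action_uminus:
  "cyclic_action integer_group uminus k v = (if even k then v else - v)"
proof -
  interpret A: group "AutoGroup integer_group" by (simp add: group.AutoGroup)
  let ?A = "AutoGroup integer_group"
  have one: "\<one>\<^bsub>?A\<^esub> = id" by (simp add: AutoGroup_def BijGroup_def fun_eq_iff)
  have u: "uminus \<in> carrier ?A" by (rule uminus_AutoGroup)
  have sq: "uminus [^]\<^bsub>?A\<^esub> (2 :: int) = \<one>\<^bsub>?A\<^esub>"
  proof -
    have "uminus [^]\<^bsub>?A\<^esub> (2 :: nat) = uminus ^^ 2"
      by (rule pow_AutoGroup_UNIV[OF _ _ u]) simp_all
    moreover have "uminus [^]\<^bsub>?A\<^esub> int 2 = uminus [^]\<^bsub>?A\<^esub> (2 :: nat)"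
      by (rule int_pow_int)
    ultimately show ?thesis unfolding one by (simp add: fun_eq_iff numeral_2_eq_2)
  qed
  have even: "uminus [^]\<^bsub>?A\<^esub> (2 * j :: int) = \<one>\<^bsub>?A\<^esub>" for j
    using A.int_pow_pow[OF u, of 2 j] by (simp add: sq)
  show ?thesis
  proof (cases "even k")
    case True
    then show ?thesis using even by (auto simp: cyclic_action_def one elim!: evenE)
  next
    case False
    then obtain j where j: "k = 2 * j + 1" by (auto elim!: oddE)
    then have "uminus [^]\<^bsub>?A\<^esub> k = uminus"
      using A.int_pow_mult[OF u, of "2 * j" 1] even[of j] u by simp
    then show ?thesis using False by (simp add: cyclic_action_def)
  qed
qed

lemma E_com_klein_bottle_group: "E_com klein_bottle_group homotopy_equivalent_space wedge_of_circles"
proof (rule E_com_semidirect_wedge_of_circles[where H = UNIV and m = "(+)" and e = 1 and t = 1 and \<beta> = int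
      and F = "\<lambda>k v. if even k then v else - v"])
  show "group klein_bottle_group" by (rule group_klein_bottle_group)
  show "carrier klein_bottle_group = UNIV \<times> UNIV" by (simp add: klein_bottle_group_def semidirect_product_def)
  show "(v, h) \<otimes>\<^bsub>klein_bottle_group\<^esub> (w, k) = (v + (if even h then w else - w), h + k)" for v h w k
    by (simp add: klein_bottle_group_def semidirect_product_def cyclic_action_uminus)
qed (auto simp: inj_def)

lemma cyclic_action_wallpaper:
  assumes "n \<in> {2, 3, 4, 6}" "0 \<le> k"
  shows "cyclic_action Z2_group ((*v) (wallpaper_matrix n)) k = ((*v) (wallpaper_matrix n)) ^^ nat k"
proof -
  have "(*v) (wallpaper_matrix n) [^]\<^bsub>AutoGroup Z2_group\<^esub> nat k = ((*v) (wallpaper_matrix n)) ^^ nat k"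
    by (rule pow_AutoGroup_UNIV[OF group_Z2_group _ wallpaper_matrix_AutoGroup[OF assms(1)]]) (simp add: Z2_group_def)
  moreover have "(*v) (wallpaper_matrix n) [^]\<^bsub>AutoGroup Z2_group\<^esub> int (nat k) =
      (*v) (wallpaper_matrix n) [^]\<^bsub>AutoGroup Z2_group\<^esub> nat k"
    by (rule int_pow_int)
  ultimately show ?thesis unfolding cyclic_action_def using assms(2) by (simp only: nat_0_le)
qed

text \<open>In each of the eleven cases the matrix \<open>A\<^sub>n\<close> raised to the power \<open>k\<close>, minus the identity, has
  nonzero determinant.\<close>

lemma wallpaper_matrix_fixed_vector:
  assumes "n \<in> {2, 3, 4, 6}" "0 < k" "k < n" "(((*v) (wallpaper_matrix n)) ^^ k) v = v"
  shows "v = 0"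
proof -
  have "k \<in> {1, 2, 3, 4, 5}" "n = 2 \<or> n = 3 \<or> n = 4 \<or> n = 6" using assms(1-3) by auto
  then show ?thesis
    using assms(3,4)
    by (auto simp: wallpaper_matrix_def eval_nat_numeral vec_eq_iff forall_2 matrix_vector_mult_def sum_2)
qed

lemma countable_int_vector: "countable (UNIV :: (int ^ 2) set)"
proof (rule countableI')
  show "inj (\<lambda>v :: int ^ 2. to_nat (v $ 1, v $ 2))"
    by (rule injI) (auto simp: vec_eq_iff forall_2)
qed

lemma E_com_wallpaper_group:
  assumes n: "n \<in> {2, 3, 4, 6}"
  shows "E_com (wallpaper_group n) homotopy_equivalent_space wedge_of_circles"
proof -
  let ?A = "(*v) (wallpaper_matrix n) :: int ^ 2 \<Rightarrow> int ^ 2"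
  have n2: "2 \<le> n" using n by auto
  have lin: "(?A ^^ i) (v + w) = (?A ^^ i) v + (?A ^^ i) w" for i v w
    by (induction i) (simp_all add: matrix_vector_right_distrib)
  show ?thesis
  proof (rule E_com_semidirect_wedge_of_circles[where H = "{0..<int n}" and m = "\<lambda>h k. (h + k) mod int n"
        and e = 1 and t = "\<chi> i. 1" and \<beta> = "\<lambda>i. \<chi> j. int i" and F = "\<lambda>k. ?A ^^ nat k"])
    show "group (wallpaper_group n)" by (rule group_wallpaper_group[OF n])
    show "carrier (wallpaper_group n) = UNIV \<times> {0..<int n}"
      using n2 by (simp add: wallpaper_group_def semidirect_product_def Z2_group_def carrier_integer_mod_group)
    show "countable (UNIV :: (int ^ 2) set)" by (rule countable_int_vector)
    show "(v, h) \<otimes>\<^bsub>wallpaper_group n\<^esub> (w, k) = (v + (?A ^^ nat h) w, (h + k) mod int n)"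
      if "h \<in> {0..<int n}" "k \<in> {0..<int n}" for v h w k
      using that cyclic_action_wallpaper[OF n, of h]
      by (simp add: wallpaper_group_def semidirect_product_def Z2_group_def mult_integer_mod_group)
    show "(?A ^^ nat h) ((?A ^^ nat k) v) = (?A ^^ nat k) ((?A ^^ nat h) v)" for h k v
      by (metis add.commute comp_apply funpow_add)
    show "v = 0 \<or> (\<forall>w. (?A ^^ nat h) w = w)" if "h \<in> {0..<int n}" "(?A ^^ nat h) v = v" for h v
      using wallpaper_matrix_fixed_vector[OF n, of "nat h" v] that by (cases "h = 0") (auto simp: nat_less_iff)
    show "(?A ^^ nat 1) (\<chi> i. 1) \<noteq> (\<chi> i. 1)"
      using wallpaper_matrix_fixed_vector[OF n, of 1 "\<chi> i. 1"] n2 by (auto simp: vec_eq_iff)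
    show "inj (\<lambda>i. (\<chi> j. int i) :: int ^ 2)" by (rule injI) (simp add: vec_eq_iff)
  qed (use n2 lin in \<open>auto simp: add.commute\<close>)
qed

theorem theorem1p5:
  shows "E_com klein_bottle_group homotopy_equivalent_space wedge_of_circles \<and>
         (\<forall>n\<in>{2, 3, 4, 6}. E_com (wallpaper_group n) homotopy_equivalent_space wedge_of_circles)"
  using E_com_klein_bottle_group E_com_wallpaper_group by blast

end
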